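(* Let $m\ge 4$ be an integer, $0<\epsilon\le 1$, $\Omega=(a,b)$, $T_{\rm end}>0$, and let $\Phi$ be the exact solution of the one-dimensional semiclassical Dirac equation with periodic boundary conditions (written out in the context). Assume: (A) $\Phi\in C^2([0,T_{\rm end}];W^{m,\infty}_p(\Omega))$ and $V,A_1\in C^m(\Omega)$, with $V,A_1$ periodic on $\Omega$; (B) for all $0\le r\le 2$ and $0\le k\le m$, $$\Big\|\frac{\partial^{r+k}}{\partial t^r\partial x^k}\Phi\Big\|_{L^\infty([0,T_{\rm end}];(L^\infty(\Omega))^2)}\le \frac{C_{r+k}}{\epsilon^{r+k}},\qquad \|\partial_x^kV\|_{L^\infty(\Omega)}\le D_k,\qquad \|\partial_x^kA_1\|_{L^\infty(\Omega)}\le D_k,$$ with constants $C_{r+k},D_k$ independent of $\epsilon$. Assume further that $\tau=o(\epsilon)$ and $h=o(\epsilon)$. Let $\Phi_I^n$ be the trigonometric interpolant of the numerical solution $\Phi^n$ produced by the first-order splitting scheme $S_1$. Then there are positive constants $C_1$ and $E_{m,1}$, independent of $\epsilon,\tau,h$, such that for all integers $0\le n\le T_{\rm end}/\tau$, $$\|\Phi(t_n,\cdot)-\Phi_I^n(\cdot)\|_{L^2}\le C_1T_{\rm end}\,\frac{\tau}{\epsilon^2}+E_{m,1}\,\frac{T_{\rm end}}{\tau}\Big(\frac{h}{\epsilon(b-a)}\Big)^m .$$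
   Context: Pauli matrices: $\sigma_1=\begin{pmatrix}0&1\\1&0\end{pmatrix}$, $\sigma_3=\begin{pmatrix}1&0\\0&-1\end{pmatrix}$; $I_2$ is the $2\times2$ identity. Problem: $V,A_1:\overline\Omega\to\mathbb R$ are given time-independent potentials, $\Phi=\Phi(t,x)\in\mathbb C^2$ solves $$i\epsilon\,\partial_t\Phi=\big[-i\epsilon\sigma_1\partial_x+\sigma_3+V(x)I_2-A_1(x)\sigma_1\big]\Phi,\quad x\in\Omega=(a,b),$$ with $\Phi(t,a)=\Phi(t,b)$, $\partial_x\Phi(t,a)=\partial_x\Phi(t,b)$ and $\Phi(0,x)=\Phi_0(x)$. The solution (and initial datum) may depend on $\epsilon$. $W^{m,\infty}_p(\Omega)=\{f\in W^{m,\infty}(\Omega):\partial_x^kf(a)=\partial_x^kf(b),\ k=0,\dots,m-1\}$ (componentwise for $\mathbb C^2$-valued functions). Periodicity of $V,A_1$ means that $\partial_x^k V$ and $\partial_x^k A_1$ agree at $a$ and $b$ for $k=0,\dots,m-1$. $\|f\|_{L^2}=(\int_\Omega|f|^2dx)^{1/2}$. Grid: $M$ is an even positive integer, $h=(b-a)/M$, $x_j=a+jh$ $(0\le j\le M-1)$, $\tau>0$, $t_n=n\tau$, $\mu_l=2\pi l/(b-a)$ for $-M/2\le l\le M/2-1$. For grid values $U=(U_0,\dots,U_{M-1})$ put $\hat U_l=\frac1M\sum_{j=0}^{M-1}U_je^{-i\mu_l(x_j-a)}$ and let the interpolant be $U_I(x)=\sum_{l=-M/2}^{M/2-1}\hat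 U_le^{i\mu_l(x-a)}$. Scheme $S_1$: $\Phi_j^0=\Phi_0(x_j)$ and, for $n\ge0$, $$\Phi_j^{n,*}=\sum_{l=-M/2}^{M/2-1}e^{\tau(-i\mu_l\sigma_1-\frac i\epsilon\sigma_3)}\,\hat\Phi^n_l\,e^{i\mu_l(x_j-a)},\qquad \Phi_j^{n+1}=e^{\tau[-\frac i\epsilon V(x_j)I_2+\frac i\epsilon A_1(x_j)\sigma_1]}\,\Phi_j^{n,*}.$$ Asymptotic conditions: $\tau=o(\epsilon)$, $h=o(\epsilon)$ are understood as: there is a fixed bounded function $\eta:(0,1]\to(0,\infty)$ with $\eta(\epsilon)\to0$ as $\epsilon\to0^+$ such that $\tau/\epsilon\le\eta(\epsilon)$ and $h/\epsilon\le\eta(\epsilon)$; constants in the conclusion may depend on $\eta$ and on the data of the problem ($m$, $T_{\rm end}$, $a$, $b$, the $C_{r+k}$, $D_k$), but not on $\epsilon,\tau,h$. *)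

theory Defs
  imports "HOL-Analysis.Analysis" "HOL-Probability.Essential_Supremum"
begin

section \<open>Lebesgue norms on the interval $(a,b)$\<close>

text \<open>The essential supremum is extended-real valued, so infinite norms stay infinite;
  \<^const>\<open>esssup\<close> of a non-measurable function is \<open>\<infinity>\<close>.\<close>

definition Linf_norm :: "real \<Rightarrow> real \<Rightarrow> (real \<Rightarrow> 'v::real_normed_vector) \<Rightarrow> ereal" where
  "Linf_norm a b f = esssup (lebesgue_on {a<..<b}) (\<lambda>x. ereal (norm (f x)))"

definition L2_norm_on :: "real \<Rightarrow> real \<Rightarrow> (real \<Rightarrow> 'v::real_normed_vector) \<Rightarrow> real" where
  "L2_norm_on a b f = sqrt (LINT x:{a<..<b}|lebesgue. (norm (f x))\<^sup>2)"


section \<open>Weak derivatives and periodic Sobolev spaces\<close>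

definition test_function :: "real \<Rightarrow> real \<Rightarrow> (real \<Rightarrow> real) \<Rightarrow> bool" where
  "test_function a b \<phi> \<longleftrightarrow>
     (\<forall>k x. (deriv ^^ k) \<phi> field_differentiable at x) \<and>
     compact (closure {x. \<phi> x \<noteq> 0}) \<and> closure {x. \<phi> x \<noteq> 0} \<subseteq> {a<..<b}"

definition loc_integrable ::
    "real \<Rightarrow> real \<Rightarrow> (real \<Rightarrow> 'v::{banach, second_countable_topology}) \<Rightarrow> bool" where
  "loc_integrable a b f \<longleftrightarrow> (\<forall>c d. a < c \<and> d < b \<longrightarrow> set_integrable lebesgue {c..d} f)"

definition has_weak_deriv ::
    "real \<Rightarrow> real \<Rightarrow> nat \<Rightarrow> (real \<Rightarrow> 'v::{banach, second_countable_topology}) \<Rightarrow> (real \<Rightarrow> 'v) \<Rightarrow> bool" where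
  "has_weak_deriv a b k f g \<longleftrightarrow>
     loc_integrable a b f \<and> loc_integrable a b g \<and>
     (\<forall>\<phi>. test_function a b \<phi> \<longrightarrow>
        (LINT x:{a<..<b}|lebesgue. (deriv ^^ k) \<phi> x *\<^sub>R f x)
          = (- 1) ^ k *\<^sub>R (LINT x:{a<..<b}|lebesgue. \<phi> x *\<^sub>R g x))"

text \<open>The choice is unique up to a null set of $(a,b)$, hence immaterial under \<^const>\<open>Linf_norm\<close>.\<close>

definition weak_deriv ::
    "real \<Rightarrow> real \<Rightarrow> nat \<Rightarrow> (real \<Rightarrow> 'v::{banach, second_countable_topology}) \<Rightarrow> (real \<Rightarrow> 'v)" where
  "weak_deriv a b k f = (SOME g. has_weak_deriv a b k f g)"

definition Wminf :: "nat \<Rightarrow> real \<Rightarrow> real \<Rightarrow> (real \<Rightarrow> 'v::{banach, second_countable_topology}) set" where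
  "Wminf m a b =
     {f. \<forall>k\<le>m. has_weak_deriv a b k f (weak_deriv a b k f) \<and> Linf_norm a b (weak_deriv a b k f) < \<infinity>}"

text \<open>The norm of $W^{m,\infty}(a,b)$.  It is meaningful only on \<^const>\<open>Wminf\<close>.\<close>

definition Wminf_norm ::
    "nat \<Rightarrow> real \<Rightarrow> real \<Rightarrow> (real \<Rightarrow> 'v::{banach, second_countable_topology}) \<Rightarrow> ereal" where
  "Wminf_norm m a b f = (SUP k\<in>{..m}. Linf_norm a b (weak_deriv a b k f))"

text \<open>Elements of $W^{m,\infty}$ are a.e. classes whose derivatives of order below $m$ have unique
  continuous representatives on $[a,b]$; the boundary values are those of the representatives \<open>g\<close>.
  The function \<open>f\<close> itself is required to be the continuous representative of its class, since it
  is sampled at grid points.\<close>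

definition Wminf_per :: "nat \<Rightarrow> real \<Rightarrow> real \<Rightarrow> (real \<Rightarrow> 'v::{banach, second_countable_topology}) set" where
  "Wminf_per m a b =
     {f \<in> Wminf m a b. continuous_on {a..b} f \<and>
        (\<forall>k<m. \<exists>g. has_weak_deriv a b k f g \<and> continuous_on {a..b} g \<and> g a = g b)}"


section \<open>Functions of time with values in $W^{m,\infty}_p$\<close>

text \<open>Differentiability is in the norm of $W^{m,\infty}$, one-sided at the ends of $[0,T]$.\<close>

definition has_time_deriv ::
    "nat \<Rightarrow> real \<Rightarrow> real \<Rightarrow> real \<Rightarrow> (real \<Rightarrow> real \<Rightarrow> 'v::{banach, second_countable_topology})
      \<Rightarrow> (real \<Rightarrow> 'v) \<Rightarrow> real \<Rightarrow> bool" where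
  "has_time_deriv m a b T u v t \<longleftrightarrow>
     v \<in> Wminf_per m a b \<and>
     ((\<lambda>s. Wminf_norm m a b (\<lambda>x. (u s x - u t x) /\<^sub>R (s - t) - v x)) \<longlongrightarrow> 0) (at t within {0..T})"

text \<open>On $[a,b]$ the chosen function is unique, by continuity of the members of \<^const>\<open>Wminf_per\<close>.\<close>

definition time_deriv ::
    "nat \<Rightarrow> real \<Rightarrow> real \<Rightarrow> real \<Rightarrow> (real \<Rightarrow> real \<Rightarrow> 'v::{banach, second_countable_topology})
      \<Rightarrow> (real \<Rightarrow> real \<Rightarrow> 'v)" where
  "time_deriv m a b T u = (\<lambda>t. SOME v. has_time_deriv m a b T u v t)"

definition time_cont ::
    "nat \<Rightarrow> real \<Rightarrow> real \<Rightarrow> real \<Rightarrow> (real \<Rightarrow> real \<Rightarrow> 'v::{banach, second_countable_topology}) \<Rightarrow> bool" where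
  "time_cont m a b T u \<longleftrightarrow>
     (\<forall>t\<in>{0..T}. u t \<in> Wminf_per m a b \<and>
        ((\<lambda>s. Wminf_norm m a b (\<lambda>x. u s x - u t x)) \<longlongrightarrow> 0) (at t within {0..T}))"

text \<open>$u \in C^r([0,T]; W^{m,\infty}_p(a,b))$\<close>

definition C_time ::
    "nat \<Rightarrow> nat \<Rightarrow> real \<Rightarrow> real \<Rightarrow> real \<Rightarrow> (real \<Rightarrow> real \<Rightarrow> 'v::{banach, second_countable_topology}) \<Rightarrow> bool" where
  "C_time r m a b T u \<longleftrightarrow>
     (\<forall>j\<le>r. time_cont m a b T ((time_deriv m a b T ^^ j) u)) \<and>
     (\<forall>j<r. \<forall>t\<in>{0..T}.
        has_time_deriv m a b T ((time_deriv m a b T ^^ j) u) ((time_deriv m a b T ^^ Suc j) u t) t)"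

text \<open>The norm of $\partial_t^r \partial_x^k u$ in $L^\infty([0,T]; L^\infty(a,b))$, with the
  Euclidean norm on the values.\<close>

definition mixed_Linf_norm ::
    "nat \<Rightarrow> real \<Rightarrow> real \<Rightarrow> real \<Rightarrow> nat \<Rightarrow> nat \<Rightarrow>
      (real \<Rightarrow> real \<Rightarrow> 'v::{banach, second_countable_topology}) \<Rightarrow> ereal" where
  "mixed_Linf_norm m a b T r k u =
     esssup (lebesgue_on {0..T})
       (\<lambda>t. Linf_norm a b (weak_deriv a b k ((time_deriv m a b T ^^ r) u t)))"


section \<open>Potentials\<close>

definition Cm_on :: "nat \<Rightarrow> real set \<Rightarrow> (real \<Rightarrow> real) \<Rightarrow> bool" where
  "Cm_on m S f \<longleftrightarrow>
     (\<forall>k<m. \<forall>x\<in>S. (deriv ^^ k) f field_differentiable at x) \<and> continuous_on S ((deriv ^^ m) f)"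

text \<open>The derivatives live on the open interval; their values at \<open>a\<close> and \<open>b\<close> are the one-sided
  limits.  For \<open>f\<close> itself these limits are the actual values \<open>f a\<close>, \<open>f b\<close>.\<close>

definition periodic_derivs :: "nat \<Rightarrow> real \<Rightarrow> real \<Rightarrow> (real \<Rightarrow> real) \<Rightarrow> bool" where
  "periodic_derivs m a b f \<longleftrightarrow>
     continuous_on {a..b} f \<and>
     (\<forall>k<m. \<exists>L. ((deriv ^^ k) f \<longlongrightarrow> L) (at_right a) \<and> ((deriv ^^ k) f \<longlongrightarrow> L) (at_left b))"


section \<open>The semiclassical Dirac equation\<close>

definition sigma1 :: "complex^2^2" where
  "sigma1 = vector [vector [0, 1], vector [1, 0]]"

definition sigma3 :: "complex^2^2" where
  "sigma3 = vector [vector [1, 0], vector [0, - 1]]"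

definition scale_mat :: "complex \<Rightarrow> complex^2^2 \<Rightarrow> complex^2^2" (infixr \<open>*m\<close> 75) where
  "c *m A = (\<chi> i j. c * A $ i $ j)"

text \<open>The library product \<open>*\<close> on \<^typ>\<open>complex^2^2\<close> is entrywise, so the exponential is built
  from powers for the matrix product \<open>**\<close>.\<close>

definition mat_exp :: "complex^2^2 \<Rightarrow> complex^2^2" where
  "mat_exp A = (\<Sum>n. (1 / fact n) *\<^sub>R (((**) A) ^^ n) (mat 1))"

definition dirac_solution ::
    "real \<Rightarrow> real \<Rightarrow> real \<Rightarrow> real \<Rightarrow> (real \<Rightarrow> real) \<Rightarrow> (real \<Rightarrow> real) \<Rightarrow>
      (real \<Rightarrow> complex^2) \<Rightarrow> (real \<Rightarrow> real \<Rightarrow> complex^2) \<Rightarrow> bool" where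
  "dirac_solution \<epsilon> a b T V A1 \<Phi>0 \<Phi> \<longleftrightarrow>
     (\<forall>t\<in>{0..T}. \<forall>x\<in>{a<..<b}. \<exists>\<Phi>t \<Phi>x.
        ((\<lambda>s. \<Phi> s x) has_vector_derivative \<Phi>t) (at t within {0..T}) \<and>
        (\<Phi> t has_vector_derivative \<Phi>x) (at x) \<and>
        (\<i> * of_real \<epsilon>) *s \<Phi>t =
          ((- \<i> * of_real \<epsilon>) *m sigma1) *v \<Phi>x
          + (sigma3 + of_real (V x) *m mat 1 - of_real (A1 x) *m sigma1) *v \<Phi> t x) \<and>
     (\<forall>t\<in>{0..T}. \<Phi> t a = \<Phi> t b \<and>
        (\<exists>d. (\<Phi> t has_vector_derivative d) (at a within {a..b}) \<and>
             (\<Phi> t has_vector_derivative d) (at b within {a..b}))) \<and>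
     (\<forall>x\<in>{a..b}. \<Phi> 0 x = \<Phi>0 x)"


section \<open>Trigonometric interpolation and the splitting scheme\<close>

definition mesh :: "real \<Rightarrow> real \<Rightarrow> nat \<Rightarrow> real" where
  "mesh a b M = (b - a) / real M"

definition grid :: "real \<Rightarrow> real \<Rightarrow> nat \<Rightarrow> nat \<Rightarrow> real" where
  "grid a b M j = a + real j * mesh a b M"

definition freq :: "real \<Rightarrow> real \<Rightarrow> int \<Rightarrow> real" where
  "freq a b l = 2 * pi * of_int l / (b - a)"

definition modes :: "nat \<Rightarrow> int set" where
  "modes M = {- (int M div 2) .. int M div 2 - 1}"

definition dft :: "real \<Rightarrow> real \<Rightarrow> nat \<Rightarrow> (nat \<Rightarrow> complex^2) \<Rightarrow> int \<Rightarrow> complex^2" where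
  "dft a b M U l =
     (1 / of_nat M) *s (\<Sum>j<M. exp (- \<i> * of_real (freq a b l * (grid a b M j - a))) *s U j)"

definition interpolant :: "real \<Rightarrow> real \<Rightarrow> nat \<Rightarrow> (nat \<Rightarrow> complex^2) \<Rightarrow> real \<Rightarrow> complex^2" where
  "interpolant a b M U x =
     (\<Sum>l\<in>modes M. exp (\<i> * of_real (freq a b l * (x - a))) *s dft a b M U l)"

definition S1_free ::
    "real \<Rightarrow> real \<Rightarrow> real \<Rightarrow> real \<Rightarrow> nat \<Rightarrow> (nat \<Rightarrow> complex^2) \<Rightarrow> nat \<Rightarrow> complex^2" where
  "S1_free \<epsilon> \<tau> a b M U j =
     (\<Sum>l\<in>modes M.
        exp (\<i> * of_real (freq a b l * (grid a b M j - a))) *s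
        (mat_exp (of_real \<tau> *m ((- \<i> * of_real (freq a b l)) *m sigma1 - (\<i> / of_real \<epsilon>) *m sigma3))
           *v dft a b M U l))"

primrec S1 ::
    "real \<Rightarrow> real \<Rightarrow> real \<Rightarrow> real \<Rightarrow> nat \<Rightarrow> (real \<Rightarrow> real) \<Rightarrow> (real \<Rightarrow> real) \<Rightarrow> (real \<Rightarrow> complex^2) \<Rightarrow>
      nat \<Rightarrow> nat \<Rightarrow> complex^2" where
  "S1 \<epsilon> \<tau> a b M V A1 \<Phi>0 0 = (\<lambda>j. \<Phi>0 (grid a b M j))"
| "S1 \<epsilon> \<tau> a b M V A1 \<Phi>0 (Suc n) = (\<lambda>j.
     mat_exp (of_real \<tau> *m ((- \<i> / of_real \<epsilon> * of_real (V (grid a b M j))) *m mat 1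
                           + (\<i> / of_real \<epsilon> * of_real (A1 (grid a b M j))) *m sigma1))
       *v S1_free \<epsilon> \<tau> a b M (S1 \<epsilon> \<tau> a b M V A1 \<Phi>0 n) j)"

end

theory Submission
  imports Defs
begin

text \<open>Let \<open>X\<^sub>n\<close> be the grid samples of the exact solution at time \<open>t\<^sub>n\<close>, \<open>A\<close> the free part and \<open>B\<close>
  the potential part of the generator, \<open>F\<close> the free step and \<open>K\<close> the potential step.  Both steps
  are isometries of the discrete \<open>l\<^sup>2\<close> norm, so each step adds at most
  \<open>\<parallel>X\<^sub>n\<^sub>+\<^sub>1 - K F X\<^sub>n\<parallel>\<close> to the error.  On the truncated Fourier series of the solution,
  \<open>F = 1 + \<tau> A + O(\<tau>\<^sup>2 A\<^sup>2)\<close> mode by mode, where \<open>A\<^sup>2\<close> costs only \<open>1 / \<epsilon>\<^sup>2\<close>; replacing the truncated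
  series by samples costs the aliasing errors \<open>(h / \<epsilon>)\<^sup>m\<close> for the solution and
  \<open>(\<tau> / \<epsilon>) (h / \<epsilon>)\<^sup>m\<^sup>-\<^sup>1\<close> for \<open>\<tau> A\<close> applied to it.  As \<open>h / \<epsilon>\<close> is bounded, the latter is
  dominated by \<open>(\<tau> / \<epsilon>)\<^sup>2 + (h / \<epsilon>)\<^sup>m\<close>.  Taylor expansion of \<open>K\<close> and of the solution in time,
  together with the equation itself, leaves \<open>(\<tau> / \<epsilon>)\<^sup>2\<close>.\<close>

section \<open>Smooth cutoff functions\<close>

text \<open>The regularity of the solution is given weakly: integration by parts is available only
  against real test functions with compact support in the open interval, while periodicity sits in
  the boundary values of continuous representatives. Hence the cutoffs: multiplied onto a Fourier
  mode and removed in the limit, they show that differentiation multiplies the coefficient by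
  \<open>\<i> * of_real (freq a b l)\<close>, the two boundary terms cancelling. From then on the
  space derivatives enter through Bessel's inequality, as weighted l^2 bounds on the coefficients.
  The assumed bounds hold for almost every time; continuity in time of finitely many coefficients
  carries them to each t_n. At most T/\<tau> local errors add up, so (\<tau>/\<epsilon>)^2 becomes T
  \<tau>/\<epsilon>^2 and (h/\<epsilon>)^m acquires the factor T/\<tau>. The interpolation error at
  the final time comes without that factor; it fits into the same term because \<tau> \<le>
  \<tau>/\<epsilon> is bounded.\<close>

definition smooth :: "(real \<Rightarrow> real) \<Rightarrow> bool" where
  "smooth f \<longleftrightarrow> (\<forall>k x. (deriv ^^ k) f field_differentiable at x)"

text \<open>A finite order to induct on: the derivative of a product is a sum of products of other
  functions, each differentiable one time less.\<close>

definition diffble :: "nat \<Rightarrow> (real \<Rightarrow> real) \<Rightarrow> bool" where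
  "diffble n f \<longleftrightarrow> (\<forall>k<n. \<forall>x. (deriv ^^ k) f field_differentiable at x)"

lemma smooth_iff_diffble: "smooth f \<longleftrightarrow> (\<forall>n. diffble n f)"
  unfolding smooth_def diffble_def by blast

lemma diffble_0 [simp]: "diffble 0 f"
  by (simp add: diffble_def)

lemma diffble_mono: "diffble n f \<Longrightarrow> k \<le> n \<Longrightarrow> diffble k f"
  by (auto simp: diffble_def)

lemma diffble_Suc:
  "diffble (Suc n) f \<longleftrightarrow> (\<forall>x. f field_differentiable at x) \<and> diffble n (deriv f)"
  unfolding diffble_def All_less_Suc2 by (simp add: funpow_Suc_right del: funpow.simps)

lemma diffble_SucI:
  assumes "\<And>x. (f has_field_derivative f' x) (at x)" "diffble n f'"
  shows "diffble (Suc n) f"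
proof -
  have "deriv f = f'" using assms(1) by (intro ext DERIV_imp_deriv)
  then show ?thesis using assms unfolding diffble_Suc field_differentiable_def by auto
qed

lemma diffble_SucE:
  assumes "diffble (Suc n) f"
  shows "(f has_field_derivative deriv f x) (at x)" "diffble n (deriv f)" "diffble n f"
  using assms diffble_mono[OF assms, of n]
  by (auto simp: diffble_Suc field_differentiable_derivI)

text \<open>Serves families closed under differentiation (constants, trigonometric functions,
  \<open>flat_exp\<close>), where the iterated derivatives have no convenient formula.\<close>

lemma smooth_coinduct:
  assumes "P f" and step: "\<And>f. P f \<Longrightarrow> \<exists>f'. P f' \<and> (\<forall>x. (f has_field_derivative f' x) (at x))"
  shows "smooth f"
proof -
  have "P f \<Longrightarrow> diffble n f" for n f
  proof (induction n arbitrary: f)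
    case (Suc n)
    then obtain f' where "P f'" "\<forall>x. (f has_field_derivative f' x) (at x)" using step by blast
    then show ?case using Suc.IH by (intro diffble_SucI[of f f']) auto
  qed simp
  then show ?thesis using assms(1) by (auto simp: smooth_iff_diffble)
qed

lemma smooth_DERIV: "smooth f \<Longrightarrow> (f has_field_derivative deriv f x) (at x)"
  by (metis diffble_SucE(1) smooth_iff_diffble)

lemma smooth_deriv: "smooth f \<Longrightarrow> smooth (deriv f)"
  by (meson diffble_SucE(2) smooth_iff_diffble)

lemma smoothI_deriv:
  assumes "\<And>x. (f has_field_derivative f' x) (at x)" "smooth f'"
  shows "smooth f"
  unfolding smooth_iff_diffble
proof
  fix n show "diffble n f"
    using diffble_SucI[OF assms(1)] assms(2) by (cases n) (auto simp: smooth_iff_diffble)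
qed

lemma smooth_continuous_on: "smooth f \<Longrightarrow> continuous_on A f"
  using smooth_DERIV DERIV_isCont continuous_at_imp_continuous_on by blast

lemma diffble_add: "diffble n f \<Longrightarrow> diffble n g \<Longrightarrow> diffble n (\<lambda>x. f x + g x)"
proof (induction n arbitrary: f g)
  case (Suc n)
  show ?case
    using Suc.IH[OF diffble_SucE(2)[OF Suc.prems(1)] diffble_SucE(2)[OF Suc.prems(2)]]
    by (intro diffble_SucI[where f' = "\<lambda>x. deriv f x + deriv g x"] DERIV_add)
      (use Suc.prems in \<open>auto intro: diffble_SucE\<close>)
qed simp

lemma diffble_mult: "diffble n f \<Longrightarrow> diffble n g \<Longrightarrow> diffble n (\<lambda>x. f x * g x)"
proof (induction n arbitrary: f g)
  case (Suc n)
  have "((\<lambda>x. f x * g x) has_field_derivative deriv f x * g x + f x * deriv g x) (at x)" for x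
    using diffble_SucE(1)[OF Suc.prems(1)] diffble_SucE(1)[OF Suc.prems(2)]
    by (auto intro!: derivative_eq_intros)
  moreover have "diffble n (\<lambda>x. deriv f x * g x + f x * deriv g x)"
    using Suc diffble_SucE by (intro diffble_add Suc.IH) blast+
  ultimately show ?case by (rule diffble_SucI)
qed simp

lemma diffble_affine: "diffble n f \<Longrightarrow> diffble n (\<lambda>x. f (c * x + d))"
proof (induction n arbitrary: f)
  case (Suc n)
  have "((\<lambda>x. f (c * x + d)) has_field_derivative c * deriv f (c * x + d)) (at x)" for x
  proof -
    have "((\<lambda>x. c * x + d) has_field_derivative c) (at x)"
      by (auto intro!: derivative_eq_intros)
    from DERIV_chain2[OF diffble_SucE(1)[OF Suc.prems] this] show ?thesis
      by (simp add: mult.commute)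
  qed
  moreover have "diffble n (\<lambda>x. c)" for c :: real
  proof (induction n arbitrary: c)
    case (Suc n) then show ?case by (intro diffble_SucI[where f' = "\<lambda>_. 0"]) auto
  qed simp
  then have "diffble n (\<lambda>x. c * deriv f (c * x + d))"
    using Suc diffble_SucE by (intro diffble_mult) auto
  ultimately show ?case by (rule diffble_SucI)
qed simp

lemma smooth_mult: "smooth f \<Longrightarrow> smooth g \<Longrightarrow> smooth (\<lambda>x. f x * g x)"
  and smooth_add: "smooth f \<Longrightarrow> smooth g \<Longrightarrow> smooth (\<lambda>x. f x + g x)"
  and smooth_affine: "smooth f \<Longrightarrow> smooth (\<lambda>x. f (c * x + d))"
  by (auto simp: smooth_iff_diffble diffble_mult diffble_add diffble_affine)

lemma smooth_const: "smooth (\<lambda>x. c)"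
  by (rule smooth_coinduct[where P = "\<lambda>f. \<exists>c. f = (\<lambda>x. c)"]) (auto intro!: exI[of _ "\<lambda>_. 0"])

lemma smooth_cmult: "smooth f \<Longrightarrow> smooth (\<lambda>x. c * f x)"
  by (intro smooth_mult smooth_const)

lemma smooth_diff: "smooth f \<Longrightarrow> smooth g \<Longrightarrow> smooth (\<lambda>x. f x - g x)"
  using smooth_add[OF _ smooth_cmult[of g "-1"], of f] by simp

lemma smooth_trig: "smooth (\<lambda>x. \<alpha> * cos (c * x + d) + \<beta> * sin (c * x + d))"
proof (rule smooth_coinduct[where P = "\<lambda>f. \<exists>\<alpha> \<beta>. f = (\<lambda>x. \<alpha> * cos (c * x + d) + \<beta> * sin (c * x + d))"])
  fix f :: "real \<Rightarrow> real"
  assume "\<exists>\<alpha> \<beta>. f = (\<lambda>x. \<alpha> * cos (c * x + d) + \<beta> * sin (c * x + d))"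
  then obtain \<alpha> \<beta> where f: "f = (\<lambda>x. \<alpha> * cos (c * x + d) + \<beta> * sin (c * x + d))" by blast
  show "\<exists>f'. (\<exists>\<alpha> \<beta>. f' = (\<lambda>x. \<alpha> * cos (c * x + d) + \<beta> * sin (c * x + d))) \<and>
          (\<forall>x. (f has_field_derivative f' x) (at x))"
  proof (intro exI conjI allI)
    show "(f has_field_derivative (c * \<beta>) * cos (c * x + d) + (- c * \<alpha>) * sin (c * x + d)) (at x)" for x
      unfolding f by (auto intro!: derivative_eq_intros simp: algebra_simps)
  qed (rule refl)
qed blast

section \<open>The flat function exp(-1/x) and a smooth monotone step\<close>

definition flat_exp :: "real poly \<Rightarrow> real \<Rightarrow> real" where
  "flat_exp p x = (if x > 0 then poly p (1 / x) * exp (- (1 / x)) else 0)"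

lemma poly_exp_decay: "((\<lambda>y. poly p y * exp (- y)) \<longlongrightarrow> 0) at_top" for p :: "real poly"
proof -
  have "((\<lambda>y. \<Sum>i\<le>degree p. coeff p i * (y ^ i / exp y)) \<longlongrightarrow> (\<Sum>i\<le>degree p. coeff p i * 0)) at_top"
    by (intro tendsto_intros tendsto_power_div_exp_0)
  then show ?thesis
    by (simp add: poly_altdef exp_minus sum_distrib_right divide_inverse mult.assoc)
qed

text \<open>In the variable y = 1/x, d/dx is -y^2 d/dy and sends p(y) e^(-y) to y^2 (p - p')(y)
  e^(-y); this is the polynomial in the statement, and it keeps the family closed under
  differentiation.\<close>

lemma flat_exp_DERIV:
  "(flat_exp p has_field_derivative flat_exp ([:0, 0, 1:] * (p - pderiv p)) x) (at x)"
proof -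
  consider "x > 0" | "x < 0" | "x = 0" by linarith
  then show ?thesis
  proof cases
    case 1
    have "((\<lambda>x. poly p (1 / x) * exp (- (1 / x))) has_field_derivative
        flat_exp ([:0, 0, 1:] * (p - pderiv p)) x) (at x)"
      using 1 by (auto intro!: derivative_eq_intros DERIV_chain2[OF poly_DERIV]
          simp: flat_exp_def field_simps power2_eq_square)
    then show ?thesis
      by (rule has_field_derivative_transform_within_open[where S = "{0<..}"])
        (use 1 in \<open>auto simp: flat_exp_def\<close>)
  next
    case 2
    have "((\<lambda>x. 0) has_field_derivative flat_exp ([:0, 0, 1:] * (p - pderiv p)) x) (at x)"
      using 2 by (auto simp: flat_exp_def)
    then show ?thesis
      by (rule has_field_derivative_transform_within_open[where S = "{..<0}"])
        (use 2 in \<open>auto simp: flat_exp_def\<close>)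
  next
    case 3
    \<comment> \<open>\<open>pCons 0 p\<close> is y p(y): the extra factor y is the 1/h of the
      difference quotient at 0.\<close>
    have "((\<lambda>y. poly (pCons 0 p) y * exp (- y)) \<longlongrightarrow> 0) at_top" by (rule poly_exp_decay)
    then have "((\<lambda>h. poly (pCons 0 p) (inverse h) * exp (- inverse h)) \<longlongrightarrow> 0) (at_right 0)"
      by (rule filterlim_compose[OF _ filterlim_inverse_at_top_right])
    then have "((\<lambda>h. flat_exp p h / h) \<longlongrightarrow> 0) (at_right 0)"
      by (rule Lim_transform_eventually)
        (auto simp: eventually_at_filter flat_exp_def field_simps)
    moreover have "((\<lambda>h. flat_exp p h / h) \<longlongrightarrow> 0) (at_left 0)"
      by (rule Lim_transform_eventually[OF tendsto_const])
        (auto simp: eventually_at_filter flat_exp_def)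
    ultimately have "((\<lambda>h. flat_exp p h / h) \<longlongrightarrow> 0) (at 0)"
      by (simp add: filterlim_split_at)
    then show ?thesis
      using 3 by (auto simp: DERIV_def flat_exp_def)
  qed
qed

lemma smooth_flat_exp: "smooth (flat_exp p)"
  by (rule smooth_coinduct[where P = "\<lambda>f. \<exists>p. f = flat_exp p"]) (use flat_exp_DERIV in blast)+

definition bump :: "real \<Rightarrow> real" where
  "bump x = flat_exp 1 x * flat_exp 1 (1 - x)"

lemma smooth_bump: "smooth bump"
proof -
  have "bump = (\<lambda>x. flat_exp 1 x * flat_exp 1 ((-1) * x + 1))"
    by (auto simp: bump_def)
  then show ?thesis by (metis smooth_mult[OF smooth_flat_exp smooth_affine[OF smooth_flat_exp]])
qed

lemma bump_nonneg: "bump x \<ge> 0" and bump_zero: "x \<notin> {0<..<1} \<Longrightarrow> bump x = 0"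
  and bump_pos: "x \<in> {0<..<1} \<Longrightarrow> bump x > 0"
  by (auto simp: bump_def flat_exp_def)

lemma bump_antiderivative: "\<exists>G. \<forall>x. (G has_field_derivative bump x) (at x)"
proof (intro exI allI)
  fix x :: real
  define r where "r = \<bar>x\<bar> + 1"
  have "((\<lambda>u. LBINT y=ereal 0..ereal u. bump y) has_vector_derivative bump x) (at x within {-r..r})"
    by (rule interval_integral_FTC2)
      (auto simp: r_def intro: smooth_continuous_on[OF smooth_bump])
  moreover have "at x within {-r..r} = at x"
    by (rule at_within_interior) (auto simp: r_def)
  ultimately show "((\<lambda>u. LBINT y=ereal 0..ereal u. bump y) has_field_derivative bump x) (at x)"
    by (simp add: has_real_derivative_iff_has_vector_derivative)
qed

text \<open>A normalised antiderivative of \<open>bump\<close>: monotone because \<open>bump\<close>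
  is nonnegative, constant on each side of (0,1) because \<open>bump\<close> vanishes there, and not
  constant by the mean value theorem.\<close>

lemma smooth_step_exists:
  "\<exists>S. smooth S \<and> mono S \<and> (\<forall>x\<le>0. S x = 0) \<and> (\<forall>x\<ge>1. S x = 1)"
proof -
  obtain G where G: "\<And>x. (G has_field_derivative bump x) (at x)"
    using bump_antiderivative by blast
  have mono: "mono G"
    by (rule monoI) (metis DERIV_nonneg_imp_nondecreasing G bump_nonneg)
  have cont: "continuous_on A G" for A
    using G DERIV_isCont continuous_at_imp_continuous_on by blast
  have const: "G y = G x" if "x \<le> y" "y \<le> 0 \<or> 1 \<le> x" for x y
  proof (cases "x = y")
    case False
    have "(G has_field_derivative 0) (at z)" if "x < z" "z < y" for z
      using G[of z] bump_zero[of z] \<open>y \<le> 0 \<or> 1 \<le> x\<close> that by auto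
    then show ?thesis
      using DERIV_isconst_end[of x y G] that cont False by auto
  qed simp
  have l: "G x = G 0" if "x \<le> 0" for x using const[of x 0] that by simp
  have r: "G x = G 1" if "x \<ge> 1" for x using const[of 1 x] that by simp
  have "G 0 < G 1"
  proof -
    obtain z where "0 < z" "z < 1" "G 1 - G 0 = (1 - 0) * bump z"
      using MVT2[of 0 1 G bump] G by auto
    then show ?thesis using bump_pos[of z] by auto
  qed
  define S where "S x = (1 / (G 1 - G 0)) * (G x - G 0)" for x
  have "smooth S"
    unfolding S_def[abs_def] by (intro smooth_cmult smooth_diff smooth_const smoothI_deriv[OF G smooth_bump])
  moreover have "mono S"
    using mono \<open>G 0 < G 1\<close> by (auto simp: mono_def S_def divide_simps)
  moreover have "S x = 0" if "x \<le> 0" for x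
    unfolding S_def l[OF that] by simp
  moreover have "S x = 1" if "x \<ge> 1" for x
    unfolding S_def r[OF that] using \<open>G 0 < G 1\<close> by simp
  ultimately show ?thesis by blast
qed

definition smooth_step :: "real \<Rightarrow> real" where
  "smooth_step = (SOME S. smooth S \<and> mono S \<and> (\<forall>x\<le>0. S x = 0) \<and> (\<forall>x\<ge>1. S x = 1))"

lemma smooth_smooth_step: "smooth smooth_step"
  and mono_smooth_step: "mono smooth_step"
  and smooth_step_0: "x \<le> 0 \<Longrightarrow> smooth_step x = 0"
  and smooth_step_1: "x \<ge> 1 \<Longrightarrow> smooth_step x = 1"
  using someI_ex[OF smooth_step_exists] by (auto simp: smooth_step_def)

lemma smooth_step_bounds: "0 \<le> smooth_step x" "smooth_step x \<le> 1"
  using monoD[OF mono_smooth_step, of "min x 0" x] monoD[OF mono_smooth_step, of x "max x 1"]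
  by (auto simp: smooth_step_0 smooth_step_1)

lemma deriv_smooth_step_nonneg: "deriv smooth_step x \<ge> 0"
  using mono_on_imp_deriv_nonneg[of UNIV smooth_step "deriv smooth_step x" x]
    mono_smooth_step smooth_DERIV[OF smooth_smooth_step] by simp

section \<open>Testing weak derivatives\<close>

lemma LINT_lebesgue_on:
  fixes f :: "real \<Rightarrow> 'v::{banach, second_countable_topology}"
  shows "S \<in> sets lebesgue \<Longrightarrow> (LINT x:S|lebesgue. f x) = integral\<^sup>L (lebesgue_on S) f"
  using integral_restrict_space[of S lebesgue f] by (simp add: set_lebesgue_integral_def)

lemma continuous_integral_open_interval:
  fixes f :: "real \<Rightarrow> 'v::euclidean_space"
  assumes "continuous_on {a..b} f"
  shows "integrable (lebesgue_on {a<..<b}) f"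
    and "integral\<^sup>L (lebesgue_on {a<..<b}) f = integral {a..b} f"
proof -
  have "integrable (lebesgue_on {a..b}) f"
    by (rule continuous_imp_integrable_real[OF assms])
  then show *: "integrable (lebesgue_on {a<..<b}) f"
    using set_integrable_subset[of lebesgue "{a..b}" f "{a<..<b}"]
    by (simp add: set_integrable_def integrable_restrict_space greaterThanLessThan_subseteq_atLeastAtMost_iff)
  show "integral\<^sup>L (lebesgue_on {a<..<b}) f = integral {a..b} f"
    using lebesgue_integral_eq_integral[OF *] by (simp add: integral_open_interval_real)
qed

lemma test_functionI:
  assumes "smooth \<phi>" "a < c" "d < b" "\<And>x. x \<notin> {c..d} \<Longrightarrow> \<phi> x = 0"
  shows "test_function a b \<phi>"
proof -
  have sub: "closure {x. \<phi> x \<noteq> 0} \<subseteq> {c..d}"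
    using assms(4) by (intro closure_minimal subsetI) (blast, simp)
  then have "compact (closure {x. \<phi> x \<noteq> 0})"
    by (metis closed_closure compact_Icc closed_Int_compact inf.absorb_iff1)
  then show ?thesis
    using sub assms unfolding test_function_def smooth_def by force
qed

text \<open>Rises from 0 to 1 on [a + 1/n, a + 2/n] and falls back on [b - 2/n, b - 1/n], once n (b
  - a) \<ge> 4. The margins of width 1/n keep the support compact inside the open interval.\<close>

definition cutoff :: "real \<Rightarrow> real \<Rightarrow> nat \<Rightarrow> real \<Rightarrow> real" where
  "cutoff a b n x = smooth_step (real n * (x - a) - 1) - smooth_step (real n * (x - b) + 2)"

text \<open>The derivative of a rescaled step: nonnegative, of mass 1, supported in [c, c + 1/n]. It
  serves both as the derivative of \<open>cutoff\<close> near an end and as a one-sided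
  mollifier.\<close>

definition kernel :: "nat \<Rightarrow> real \<Rightarrow> real \<Rightarrow> real" where
  "kernel n c x = real n * deriv smooth_step (real n * (x - c))"

lemma smooth_step_scaled_DERIV:
  "((\<lambda>x. smooth_step (r * x + d)) has_field_derivative r * deriv smooth_step (r * x + d)) (at x)"
proof -
  have "((\<lambda>x. r * x + d) has_field_derivative r) (at x)"
    by (auto intro!: derivative_eq_intros)
  from DERIV_chain2[OF smooth_DERIV[OF smooth_smooth_step] this] show ?thesis
    by (simp add: mult.commute)
qed

lemma smooth_kernel: "smooth (kernel n c)"
proof -
  have "kernel n c = (\<lambda>x. real n * deriv smooth_step (real n * x + - real n * c))"
    by (auto simp: kernel_def algebra_simps)
  then show ?thesis
    by (metis smooth_cmult[OF smooth_affine[OF smooth_deriv[OF smooth_smooth_step]]])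
qed

lemma deriv_smooth_step_zero:
  assumes "x \<notin> {0..1}"
  shows "deriv smooth_step x = 0"
proof (rule DERIV_imp_deriv)
  consider "x < 0" | "x > 1" using assms by force
  then show "(smooth_step has_field_derivative 0) (at x)"
  proof cases
    case 1
    show ?thesis
      by (rule has_field_derivative_transform_within_open[where S = "{..<0}" and f = "\<lambda>_. 0"])
        (use 1 in \<open>auto simp: smooth_step_0\<close>)
  next
    case 2
    show ?thesis
      by (rule has_field_derivative_transform_within_open[where S = "{1<..}" and f = "\<lambda>_. 1"])
        (use 2 in \<open>auto simp: smooth_step_1\<close>)
  qed
qed

lemma kernel_nonneg: "kernel n c x \<ge> 0"
  by (simp add: kernel_def deriv_smooth_step_nonneg)

lemma kernel_zero:
  assumes "n > 0" "x \<notin> {c..c + 1 / real n}"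
  shows "kernel n c x = 0"
proof -
  have "real n * (x - c) \<notin> {0..1}"
    using assms by (auto simp: field_simps not_le mult_less_0_iff zero_le_mult_iff)
  then show ?thesis by (simp add: kernel_def deriv_smooth_step_zero)
qed

lemma kernel_has_integral:
  assumes "n > 0" "a \<le> c" "c + 1 / real n \<le> b"
  shows "(kernel n c has_integral 1) {a..b}"
proof -
  have "a \<le> b" using assms by (smt (verit) divide_pos_pos of_nat_0_less_iff)
  have "((\<lambda>x. smooth_step (real n * x + - real n * c)) has_field_derivative kernel n c x) (at x)" for x
    using smooth_step_scaled_DERIV[of "real n" "- real n * c" x] by (simp add: kernel_def algebra_simps)
  then have "(kernel n c has_integral
      smooth_step (real n * b + - real n * c) - smooth_step (real n * a + - real n * c)) {a..b}"
    using \<open>a \<le> b\<close> by (intro fundamental_theorem_of_calculus)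
      (auto simp: has_real_derivative_iff_has_vector_derivative[symmetric] intro: DERIV_subset)
  moreover have "smooth_step (real n * b + - real n * c) = 1"
    using assms by (intro smooth_step_1) (simp add: field_simps)
  moreover have "smooth_step (real n * a + - real n * c) = 0"
    using assms by (intro smooth_step_0) (simp add: field_simps)
  ultimately show ?thesis by simp
qed

text \<open>The centres may move so that \<open>p\<close> can be an end of the interval: with
  centres a + 1/n and b - 2/n the kernels stay inside [a,b] and still produce the boundary values of
  \<open>u\<close>.\<close>

lemma approximate_identity:
  fixes u :: "real \<Rightarrow> 'v::euclidean_space"
  assumes u: "continuous_on {a..b} u" and p: "p \<in> {a..b}" and c: "c \<longlonglongrightarrow> p"
    and supp: "\<forall>\<^sub>F n in sequentially. a \<le> c n \<and> c n + 1 / real n \<le> b"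
  shows "(\<lambda>n. integral\<^sup>L (lebesgue_on {a<..<b}) (\<lambda>x. kernel n (c n) x *\<^sub>R u x)) \<longlonglongrightarrow> u p"
proof (rule tendstoI)
  fix e :: real assume "e > 0"
  then obtain d where d: "d > 0" "\<And>x. x \<in> {a..b} \<Longrightarrow> dist x p < d \<Longrightarrow> dist (u x) (u p) < e / 2"
    using u p unfolding continuous_on_iff by (metis half_gt_zero)
  have "\<forall>\<^sub>F n in sequentially. dist (c n) p < d / 2"
    using c d(1) by (intro tendstoD) auto
  moreover have "\<forall>\<^sub>F n in sequentially. 1 / real n < d / 2"
    using d(1) by (intro order_tendstoD(2)[OF lim_1_over_n]) auto
  ultimately show "\<forall>\<^sub>F n in sequentially.
      dist (integral\<^sup>L (lebesgue_on {a<..<b}) (\<lambda>x. kernel n (c n) x *\<^sub>R u x)) (u p) < e"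
    using supp eventually_gt_at_top[of 0]
  proof eventually_elim
    case (elim n)
    have cont: "continuous_on {a..b} (\<lambda>x. kernel n (c n) x *\<^sub>R v x)"
      if "continuous_on {a..b} v" for v :: "real \<Rightarrow> 'v"
      using smooth_continuous_on[OF smooth_kernel] that by (intro continuous_intros) auto
    have int1: "(kernel n (c n) has_integral 1) {a..b}"
      using elim by (intro kernel_has_integral) auto
    have "integral\<^sup>L (lebesgue_on {a<..<b}) (\<lambda>x. kernel n (c n) x *\<^sub>R u x) - u p
        = integral {a..b} (\<lambda>x. kernel n (c n) x *\<^sub>R u x) - integral {a..b} (\<lambda>x. kernel n (c n) x *\<^sub>R u p)"
      using has_integral_scaleR_left[OF int1, of "u p"]
      by (simp add: continuous_integral_open_interval(2)[OF cont[OF u]] integral_unique)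
    also have "\<dots> = integral {a..b} (\<lambda>x. kernel n (c n) x *\<^sub>R (u x - u p))"
      by (subst integral_diff[symmetric])
        (auto intro!: integrable_continuous_real cont u simp: scaleR_diff_right)
    also have "norm \<dots> \<le> integral {a..b} (\<lambda>x. kernel n (c n) x * (e / 2))"
    proof (rule integral_norm_bound_integral)
      show "(\<lambda>x. kernel n (c n) x *\<^sub>R (u x - u p)) integrable_on {a..b}"
        by (auto intro!: integrable_continuous_real cont u continuous_intros)
      show "(\<lambda>x. kernel n (c n) x * (e / 2)) integrable_on {a..b}"
        using has_integral_mult_left[OF int1] by blast
      fix x assume x: "x \<in> {a..b}"
      show "norm (kernel n (c n) x *\<^sub>R (u x - u p)) \<le> kernel n (c n) x * (e / 2)"
      proof (cases "x \<in> {c n..c n + 1 / real n}")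
        case True
        then have "dist x p < d"
          using elim(1,2) by (auto simp: dist_real_def abs_if split: if_splits)
        then have "norm (u x - u p) \<le> e / 2"
          using d(2)[OF x] by (simp add: dist_norm)
        then show ?thesis
          using mult_left_mono[OF _ kernel_nonneg[of n "c n" x], of "norm (u x - u p)" "e / 2"]
          by (simp add: kernel_nonneg)
      next
        case False
        then show ?thesis using kernel_zero[of n x "c n"] elim by simp
      qed
    qed
    also have "\<dots> = e / 2"
      using integral_unique[OF has_integral_mult_left[OF int1, of "e / 2"]] by simp
    finally show ?case using \<open>e > 0\<close> by (simp add: dist_norm)
  qed
qed

lemma smooth_cutoff: "smooth (cutoff a b n)"
proof -
  have "cutoff a b n = (\<lambda>x. smooth_step (real n * x + (- real n * a - 1)) -
      smooth_step (real n * x + (2 - real n * b)))"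
    by (auto simp: cutoff_def algebra_simps)
  then show ?thesis
    by (metis smooth_diff[OF smooth_affine[OF smooth_smooth_step] smooth_affine[OF smooth_smooth_step]])
qed

lemma cutoff_bound: "\<bar>cutoff a b n x\<bar> \<le> 1"
  unfolding cutoff_def
  using smooth_step_bounds[of "real n * (x - a) - 1"] smooth_step_bounds[of "real n * (x - b) + 2"]
  by linarith

lemma cutoff_DERIV:
  assumes "n > 0"
  shows "(cutoff a b n has_field_derivative kernel n (a + 1 / real n) x - kernel n (b - 2 / real n) x) (at x)"
proof -
  have *: "cutoff a b n = (\<lambda>x. smooth_step (real n * x + (- real n * a - 1)) -
      smooth_step (real n * x + (2 - real n * b)))"
    by (auto simp: cutoff_def algebra_simps)
  have "real n * x + (- real n * a - 1) = real n * (x - (a + 1 / real n))"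
    "real n * x + (2 - real n * b) = real n * (x - (b - 2 / real n))"
    using assms by (auto simp: field_simps)
  then show ?thesis
    using DERIV_diff[OF smooth_step_scaled_DERIV[of "real n" "- real n * a - 1" x]
        smooth_step_scaled_DERIV[of "real n" "2 - real n * b" x]]
    unfolding * by (simp add: kernel_def)
qed

text \<open>With n (b - a) \<ge> 4 the rise is over before the fall begins, so within 1/n of an end
  the two steps are both 0 or both 1 and cancel.\<close>

lemma test_function_cutoff:
  assumes "smooth \<psi>" "n > 0" "real n * (b - a) \<ge> 4"
  shows "test_function a b (\<lambda>x. cutoff a b n x * \<psi> x)"
proof (rule test_functionI)
  show "smooth (\<lambda>x. cutoff a b n x * \<psi> x)" by (intro smooth_mult smooth_cutoff assms)
  show "a < a + 1 / real n" "b - 1 / real n < b" using assms by auto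
  fix x assume "x \<notin> {a + 1 / real n..b - 1 / real n}"
  then consider "real n * (x - a) \<le> 1" | "real n * (x - b) \<ge> -1"
    using assms by (auto simp: field_simps not_le)
  then have "cutoff a b n x = 0"
  proof cases
    case 1
    then have "real n * (x - b) + 2 \<le> 0" using assms by (simp add: algebra_simps)
    then show ?thesis using 1 by (simp add: cutoff_def smooth_step_0)
  next
    case 2
    then have "real n * (x - a) - 1 \<ge> 1" using assms by (simp add: algebra_simps)
    then show ?thesis using 2 by (simp add: cutoff_def smooth_step_1)
  qed
  then show "cutoff a b n x * \<psi> x = 0" by simp
qed

lemma eventually_test_function_cutoff:
  assumes "smooth \<psi>" "a < b"
  shows "\<forall>\<^sub>F n in sequentially. n > 0 \<and> test_function a b (\<lambda>x. cutoff a b n x * \<psi> x)"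
proof -
  have "\<forall>\<^sub>F n in sequentially. real n \<ge> 4 / (b - a)"
    using filterlim_real_sequentially by (auto simp: filterlim_at_top)
  then show ?thesis
    using eventually_gt_at_top[of 0]
  proof eventually_elim
    case (elim n)
    then show ?case using assms by (intro conjI test_function_cutoff) (auto simp: field_simps)
  qed
qed

lemma cutoff_tendsto:
  assumes "x \<in> {a<..<b}"
  shows "(\<lambda>n. cutoff a b n x) \<longlonglongrightarrow> 1"
proof (rule Lim_transform_eventually[OF tendsto_const])
  have "\<forall>\<^sub>F n in sequentially. real n \<ge> 2 / (x - a)" "\<forall>\<^sub>F n in sequentially. real n \<ge> 2 / (b - x)"
    using filterlim_real_sequentially by (auto simp: filterlim_at_top)
  then show "\<forall>\<^sub>F n in sequentially. 1 = cutoff a b n x"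
  proof eventually_elim
    case (elim n)
    then have "real n * (x - a) - 1 \<ge> 1" "real n * (x - b) + 2 \<le> 0"
      using assms by (auto simp: field_simps)
    then show ?case by (simp add: cutoff_def smooth_step_0 smooth_step_1)
  qed
qed

lemma integrable_continuous_scaleR:
  fixes u :: "real \<Rightarrow> 'v::euclidean_space"
  assumes "continuous_on {a..b} \<psi>" "integrable (lebesgue_on {a<..<b}) u"
  shows "integrable (lebesgue_on {a<..<b}) (\<lambda>x. \<psi> x *\<^sub>R u x)"
proof -
  obtain B where B: "\<And>x. x \<in> {a..b} \<Longrightarrow> norm (\<psi> x) \<le> B"
    using compact_imp_bounded[OF compact_continuous_image[OF assms(1) compact_Icc]]
    unfolding bounded_iff by blast
  have "\<psi> \<in> borel_measurable (lebesgue_on {a<..<b})"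
    using continuous_integral_open_interval(1)[OF assms(1)] by auto
  then show ?thesis
    using assms(2) B
    by (intro Bochner_Integration.integrable_bound[OF integrable_mult_right[OF integrable_norm[OF assms(2)], of B]])
      (force intro!: AE_I2 mult_right_mono simp: abs_mult intro: order_trans[OF _ abs_ge_self])+
qed

lemma cutoff_integral_tendsto:
  fixes u :: "real \<Rightarrow> 'v::euclidean_space"
  assumes "continuous_on {a..b} \<psi>" "integrable (lebesgue_on {a<..<b}) u"
  shows "(\<lambda>n. integral\<^sup>L (lebesgue_on {a<..<b}) (\<lambda>x. (cutoff a b n x * \<psi> x) *\<^sub>R u x))
    \<longlonglongrightarrow> integral\<^sup>L (lebesgue_on {a<..<b}) (\<lambda>x. \<psi> x *\<^sub>R u x)"
proof (rule integral_dominated_convergence)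
  let ?M = "lebesgue_on {a<..<b}"
  note int = integrable_continuous_scaleR[OF assms]
  show "(\<lambda>x. \<psi> x *\<^sub>R u x) \<in> borel_measurable ?M" using int by auto
  have "integrable ?M (\<lambda>x. cutoff a b n x *\<^sub>R (\<psi> x *\<^sub>R u x))" for n
    by (intro integrable_continuous_scaleR smooth_continuous_on smooth_cutoff int)
  then show "(\<lambda>x. (cutoff a b n x * \<psi> x) *\<^sub>R u x) \<in> borel_measurable ?M" for n
    by auto
  show "integrable ?M (\<lambda>x. norm (\<psi> x *\<^sub>R u x))" using int by (rule integrable_norm)
  show "AE x in ?M. (\<lambda>n. (cutoff a b n x * \<psi> x) *\<^sub>R u x) \<longlonglongrightarrow> \<psi> x *\<^sub>R u x"
  proof (rule AE_I2)
    fix x assume "x \<in> space ?M"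
    then have "(\<lambda>n. (cutoff a b n x * \<psi> x) *\<^sub>R u x) \<longlonglongrightarrow> (1 * \<psi> x) *\<^sub>R u x"
      by (intro tendsto_intros cutoff_tendsto) auto
    then show "(\<lambda>n. (cutoff a b n x * \<psi> x) *\<^sub>R u x) \<longlonglongrightarrow> \<psi> x *\<^sub>R u x" by simp
  qed
  show "AE x in ?M. norm ((cutoff a b n x * \<psi> x) *\<^sub>R u x) \<le> norm (\<psi> x *\<^sub>R u x)" for n
    using mult_right_mono[OF cutoff_bound[of a b n], of "norm (\<psi> _ *\<^sub>R u _)"]
    by (intro AE_I2) (simp add: abs_mult mult.assoc)
qed

text \<open>Dominated convergence removes the cutoff, so the identity passes from compactly
  supported tests to all smooth ones, in particular to Fourier modes.\<close>

lemma weak_deriv_0_integral_eq: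
  fixes u v :: "real \<Rightarrow> 'v::euclidean_space"
  assumes "a < b" "has_weak_deriv a b 0 u v" "smooth \<psi>"
    and "integrable (lebesgue_on {a<..<b}) u" "integrable (lebesgue_on {a<..<b}) v"
  shows "integral\<^sup>L (lebesgue_on {a<..<b}) (\<lambda>x. \<psi> x *\<^sub>R u x)
    = integral\<^sup>L (lebesgue_on {a<..<b}) (\<lambda>x. \<psi> x *\<^sub>R v x)"
proof (rule LIMSEQ_unique)
  note cont = smooth_continuous_on[OF assms(3)]
  show "(\<lambda>n. integral\<^sup>L (lebesgue_on {a<..<b}) (\<lambda>x. (cutoff a b n x * \<psi> x) *\<^sub>R v x))
    \<longlonglongrightarrow> integral\<^sup>L (lebesgue_on {a<..<b}) (\<lambda>x. \<psi> x *\<^sub>R v x)"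
    by (rule cutoff_integral_tendsto[OF cont assms(5)])
  show "(\<lambda>n. integral\<^sup>L (lebesgue_on {a<..<b}) (\<lambda>x. (cutoff a b n x * \<psi> x) *\<^sub>R v x))
    \<longlonglongrightarrow> integral\<^sup>L (lebesgue_on {a<..<b}) (\<lambda>x. \<psi> x *\<^sub>R u x)"
    by (rule Lim_transform_eventually[OF cutoff_integral_tendsto[OF cont assms(4)]])
      (use eventually_test_function_cutoff[OF assms(3,1)] assms(2) in
        \<open>auto elim!: eventually_mono simp: has_weak_deriv_def LINT_lebesgue_on\<close>)
qed

text \<open>Tested with the cutoff times \<open>\<psi>\<close>. Differentiating the cutoff yields
  one kernel near each end, and these tend to the boundary values of \<open>\<psi>\<close> times
  \<open>u\<close>; by periodicity of both functions they cancel. This is where periodicity of the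
  solution is used.\<close>

lemma weak_deriv_1_integral_by_parts:
  fixes u v :: "real \<Rightarrow> 'v::euclidean_space"
  assumes "a < b" "has_weak_deriv a b 1 u v" "smooth \<psi>" "\<psi> a = \<psi> b"
    and u: "continuous_on {a..b} u" "u a = u b" and v: "integrable (lebesgue_on {a<..<b}) v"
  shows "integral\<^sup>L (lebesgue_on {a<..<b}) (\<lambda>x. deriv \<psi> x *\<^sub>R u x)
    = - integral\<^sup>L (lebesgue_on {a<..<b}) (\<lambda>x. \<psi> x *\<^sub>R v x)"
proof (rule LIMSEQ_unique)
  let ?I = "integral\<^sup>L (lebesgue_on {a<..<b})"
  note cont = smooth_continuous_on[OF assms(3)]
  note cont' = smooth_continuous_on[OF smooth_deriv[OF assms(3)]]
  have \<psi>u: "continuous_on {a..b} (\<lambda>x. \<psi> x *\<^sub>R u x)"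
    by (intro continuous_intros cont u)
  note K = continuous_on_scaleR[OF smooth_continuous_on[OF smooth_kernel] \<psi>u]
  let ?L = "\<lambda>n. ?I (\<lambda>x. (cutoff a b n x * deriv \<psi> x) *\<^sub>R u x)
      + (?I (\<lambda>x. kernel n (a + 1 / real n) x *\<^sub>R (\<psi> x *\<^sub>R u x)) -
         ?I (\<lambda>x. kernel n (b - 2 / real n) x *\<^sub>R (\<psi> x *\<^sub>R u x)))"
  have inv: "(\<lambda>n. c / real n) \<longlonglongrightarrow> 0" for c
    using tendsto_mult_right_zero[OF lim_1_over_n, of c] by (simp add: divide_inverse)
  have "\<forall>\<^sub>F n in sequentially. real n \<ge> 4 / (b - a)"
    using filterlim_real_sequentially by (auto simp: filterlim_at_top)
  then have supp: "\<forall>\<^sub>F n in sequentially. 4 / real n \<le> b - a \<and> n > 0"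
    using eventually_gt_at_top[of 0]
    by eventually_elim (use assms(1) in \<open>auto simp: field_simps\<close>)
  have "(\<lambda>n. a + 1 / real n) \<longlonglongrightarrow> a + 0" "(\<lambda>n. b - 2 / real n) \<longlonglongrightarrow> b - 0"
    by (intro tendsto_intros inv)+
  then have "?L \<longlonglongrightarrow> ?I (\<lambda>x. deriv \<psi> x *\<^sub>R u x) + (\<psi> a *\<^sub>R u a - \<psi> b *\<^sub>R u b)"
    using supp assms(1)
    by (intro tendsto_intros cutoff_integral_tendsto cont' continuous_integral_open_interval(1)
        approximate_identity[OF \<psi>u] u)
      (auto elim!: eventually_mono simp: field_simps)
  then have lim: "?L \<longlonglongrightarrow> ?I (\<lambda>x. deriv \<psi> x *\<^sub>R u x)"
    using assms(4) u(2) by simp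
  show "(\<lambda>n. - ?I (\<lambda>x. (cutoff a b n x * \<psi> x) *\<^sub>R v x)) \<longlonglongrightarrow> - ?I (\<lambda>x. \<psi> x *\<^sub>R v x)"
    by (intro tendsto_intros cutoff_integral_tendsto cont v)
  show "(\<lambda>n. - ?I (\<lambda>x. (cutoff a b n x * \<psi> x) *\<^sub>R v x)) \<longlonglongrightarrow> ?I (\<lambda>x. deriv \<psi> x *\<^sub>R u x)"
  proof (rule Lim_transform_eventually[OF lim])
    show "\<forall>\<^sub>F n in sequentially. ?L n = - ?I (\<lambda>x. (cutoff a b n x * \<psi> x) *\<^sub>R v x)"
      using eventually_test_function_cutoff[OF assms(3,1)]
    proof eventually_elim
      case (elim n)
      have d: "deriv (\<lambda>x. cutoff a b n x * \<psi> x) x = cutoff a b n x * deriv \<psi> x +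
          (kernel n (a + 1 / real n) x - kernel n (b - 2 / real n) x) * \<psi> x" for x
        using DERIV_mult[OF cutoff_DERIV smooth_DERIV[OF assms(3)], of n a b x] elim
        by (intro DERIV_imp_deriv) (simp add: algebra_simps)
      have "- ?I (\<lambda>x. (cutoff a b n x * \<psi> x) *\<^sub>R v x)
          = ?I (\<lambda>x. deriv (\<lambda>x. cutoff a b n x * \<psi> x) x *\<^sub>R u x)"
        using assms(2) elim by (simp add: has_weak_deriv_def LINT_lebesgue_on)
      also have "\<dots> = ?I (\<lambda>x. (cutoff a b n x * deriv \<psi> x) *\<^sub>R u x
          + (kernel n (a + 1 / real n) x *\<^sub>R (\<psi> x *\<^sub>R u x) - kernel n (b - 2 / real n) x *\<^sub>R (\<psi> x *\<^sub>R u x)))"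
        unfolding d by (simp add: scaleR_add_left scaleR_diff_left left_diff_distrib)
      also have "\<dots> = ?L n"
      proof -
        have "continuous_on {a..b} (\<lambda>x. (cutoff a b n x * deriv \<psi> x) *\<^sub>R u x)"
          by (intro continuous_on_scaleR continuous_on_mult smooth_continuous_on smooth_cutoff
              smooth_deriv assms(3) u)
        note * = this[THEN continuous_integral_open_interval(1)] K[THEN continuous_integral_open_interval(1)]
        show ?thesis
          by (simp only: Bochner_Integration.integral_add[OF *(1) Bochner_Integration.integrable_diff[OF *(2) *(2)]]
              Bochner_Integration.integral_diff[OF *(2) *(2)])
      qed
      finally show ?case by simp
    qed
  qed
qed

text \<open>A kernel centred at an interior point is itself a test function, so its averages of
  \<open>f\<close> and of \<open>g\<close> agree; the latter are at most \<open>c\<close> and the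
  former tend to the value of \<open>f\<close>. The ends follow by continuity.\<close>

lemma weak_deriv_0_sup_bound:
  fixes f g :: "real \<Rightarrow> 'v::euclidean_space"
  assumes "a < b" "has_weak_deriv a b 0 f g" and f: "continuous_on {a..b} f"
    and g: "integrable (lebesgue_on {a<..<b}) g" "AE x in lebesgue_on {a<..<b}. norm (g x) \<le> c"
    and x: "x \<in> {a..b}"
  shows "norm (f x) \<le> c"
proof -
  let ?I = "\<lambda>f. integral\<^sup>L (lebesgue_on {a<..<b}) f"
  have *: "norm (f p) \<le> c" if p: "p \<in> {a<..<b}" for p
  proof (rule tendsto_upperbound)
    have "\<forall>\<^sub>F n in sequentially. 1 / real n < b - p"
      using p by (intro order_tendstoD(2)[OF lim_1_over_n]) auto
    then have supp: "\<forall>\<^sub>F n in sequentially. n > 0 \<and> p + 1 / real n < b"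
      using eventually_gt_at_top[of 0] by eventually_elim auto
    show "(\<lambda>n. norm (?I (\<lambda>x. kernel n p x *\<^sub>R f x))) \<longlonglongrightarrow> norm (f p)"
      using p supp by (intro tendsto_norm approximate_identity f) (auto elim: eventually_mono)
    show "\<forall>\<^sub>F n in sequentially. norm (?I (\<lambda>x. kernel n p x *\<^sub>R f x)) \<le> c"
      using supp
    proof eventually_elim
      case (elim n)
      have int1: "(kernel n p has_integral 1) {a..b}"
        using elim p by (intro kernel_has_integral) auto
      have "test_function a b (kernel n p)"
        using elim p kernel_zero[of n _ p] by (intro test_functionI[OF smooth_kernel, where c = p]) auto
      then have "?I (\<lambda>x. kernel n p x *\<^sub>R f x) = ?I (\<lambda>x. kernel n p x *\<^sub>R g x)"
        using assms(2) by (simp add: has_weak_deriv_def LINT_lebesgue_on)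
      also have "norm \<dots> \<le> ?I (\<lambda>x. norm (kernel n p x *\<^sub>R g x))"
        by (rule integral_norm_bound)
      also have "\<dots> \<le> ?I (\<lambda>x. kernel n p x *\<^sub>R c)"
      proof (rule integral_mono_AE)
        show "integrable (lebesgue_on {a<..<b}) (\<lambda>x. norm (kernel n p x *\<^sub>R g x))"
          by (intro integrable_norm integrable_continuous_scaleR smooth_continuous_on smooth_kernel g)
        show "integrable (lebesgue_on {a<..<b}) (\<lambda>x. kernel n p x *\<^sub>R c)"
          by (intro continuous_integral_open_interval(1) continuous_on_scaleR smooth_continuous_on
              smooth_kernel continuous_on_const)
        show "AE x in lebesgue_on {a<..<b}. norm (kernel n p x *\<^sub>R g x) \<le> kernel n p x *\<^sub>R c"
          using g(2)
        proof eventually_elim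
          case (elim x)
          then show ?case
            using mult_left_mono[OF elim kernel_nonneg[of n p x]] kernel_nonneg[of n p x] by simp
        qed
      qed
      also have "\<dots> = integral {a..b} (\<lambda>x. kernel n p x *\<^sub>R c)"
        by (intro continuous_integral_open_interval(2) continuous_on_scaleR smooth_continuous_on
              smooth_kernel continuous_on_const)
      also have "\<dots> = c"
        using integral_unique[OF has_integral_scaleR_left[OF int1, of c]] by simp
      finally show ?case .
    qed
  qed simp
  have "closure {a<..<b} = {a..b}" using assms(1) by simp
  then show ?thesis
    using continuous_on_closure_norm_le[of "{a<..<b}" f c x] * f x by auto
qed

section \<open>Fourier coefficients on an interval\<close>

lemma norm_vector_scale [simp]: "norm (z *s v) = cmod z * norm (v :: complex ^ 'n)"
  by (simp add: norm_vec_def norm_mult L2_set_right_distrib)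

lemma scaleR_eq_vector_scale: "r *\<^sub>R v = of_real r *s (v :: complex ^ 'n)"
  unfolding vec_eq_iff vector_scaleR_component vector_smult_component
  by (simp add: scaleR_conv_of_real)

lemma bounded_bilinear_vector_scale: "bounded_bilinear (\<lambda>z (v :: complex ^ 'n). z *s v)"
proof
  show "\<exists>K. \<forall>z (v :: complex ^ 'n). norm (z *s v) \<le> norm z * norm v * K"
    by (rule exI[of _ 1]) simp
qed (simp_all add: vec_eq_iff algebra_simps)

lemmas continuous_on_vector_scale [continuous_intros] =
  bounded_bilinear.continuous_on[OF bounded_bilinear_vector_scale]
lemmas tendsto_vector_scale [tendsto_intros] =
  bounded_bilinear.tendsto[OF bounded_bilinear_vector_scale]
lemmas bounded_linear_vector_scale = bounded_bilinear.bounded_linear_right[OF bounded_bilinear_vector_scale]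
lemmas vector_scale_sum = linear_sum[OF bounded_linear.linear[OF bounded_linear_vector_scale]]

lemma inner_vector_scale_left: "(z *s v) \<bullet> w = v \<bullet> (cnj z *s (w :: complex ^ 'n))"
  unfolding inner_vec_def by (rule sum.cong) (auto simp: inner_complex_def algebra_simps)

lemma inner_vector_scale_right: "v \<bullet> (z *s w) = (cnj z *s v) \<bullet> (w :: complex ^ 'n)"
  using inner_vector_scale_left[of "cnj z" v w] by simp

section \<open>The exponentials of the interval and the Fourier coefficients\<close>

definition wave :: "real \<Rightarrow> real \<Rightarrow> int \<Rightarrow> real \<Rightarrow> complex" where
  "wave a b l x = cis (freq a b l * (x - a))"

lemma norm_wave [simp]: "cmod (wave a b l x) = 1"
  and wave_0 [simp]: "wave a b 0 x = 1"
  and wave_a [simp]: "wave a b l a = 1"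
  by (simp_all add: wave_def freq_def)

lemma wave_add: "wave a b (k + l) x = wave a b k x * wave a b l x"
  by (simp add: wave_def freq_def cis_mult add_divide_distrib algebra_simps)

lemma wave_uminus: "wave a b (- l) x = cnj (wave a b l x)"
  by (simp add: wave_def freq_def cis_cnj)

lemma wave_mult_uminus [simp]: "wave a b l x * wave a b (- l) x = 1" "wave a b (- l) x * wave a b l x = 1"
  using wave_add[of a b l "- l" x] by (simp_all add: mult.commute)

lemma wave_b [simp]:
  assumes "a < b" shows "wave a b l b = 1"
  using assms by (simp add: wave_def freq_def cis_multiple_2pi mult.assoc[symmetric] cis.ctr complex_eq_iff cos_int_2pin sin_int_2pin)

lemma wave_has_vector_derivative:
  "(wave a b l has_vector_derivative (\<i> * of_real (freq a b l)) * wave a b l x) (at x within A)"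
proof -
  have "((\<lambda>z. exp (\<i> * of_real (freq a b l) * (z - of_real a))) has_field_derivative
      (\<i> * of_real (freq a b l)) * wave a b l x) (at (of_real x))"
    by (auto intro!: derivative_eq_intros simp: wave_def cis_conv_exp mult_ac)
  then have "((\<lambda>x. exp (\<i> * of_real (freq a b l) * (of_real x - of_real a))) has_vector_derivative
      (\<i> * of_real (freq a b l)) * wave a b l x) (at x within A)"
    by (rule has_vector_derivative_real_field)
  then show ?thesis
    by (simp add: wave_def[abs_def] cis_conv_exp mult_ac)
qed

lemma continuous_on_wave [continuous_intros]: "continuous_on A (wave a b l)"
  using wave_has_vector_derivative by (intro continuous_on_vector_derivative)

text \<open>Test functions are real, so a complex exponential has to be tested through its cosine
  and sine. The phase is written as a slope times \<open>x\<close> plus a constant, the shape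
  covered by \<open>smooth_trig\<close>.\<close>

lemma wave_scale_eq:
  "wave a b (- l) x *s v = cos (- freq a b l * x + freq a b l * a) *\<^sub>R v
     + sin (- freq a b l * x + freq a b l * a) *\<^sub>R (\<i> *s (v :: complex ^ 'n))"
proof -
  have *: "freq a b (- l) * (x - a) = - freq a b l * x + freq a b l * a"
    by (simp add: freq_def right_diff_distrib)
  show ?thesis
    unfolding wave_def * scaleR_eq_vector_scale
    by (simp only: cis_conv_exp exp_Euler cos_of_real sin_of_real vector_smult_assoc mult.commute vector_sadd_rdistrib)
qed

lemma integrable_wave_scale:
  fixes f :: "real \<Rightarrow> complex ^ 'n"
  assumes "integrable (lebesgue_on {a<..<b}) f"
  shows "integrable (lebesgue_on {a<..<b}) (\<lambda>x. wave a b l x *s f x)"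
  using assms integrable_bounded_linear[OF bounded_linear_vector_scale[of \<i>] assms]
  unfolding wave_scale_eq[of a b "- l", simplified]
  by (intro Bochner_Integration.integrable_add integrable_continuous_scaleR continuous_intros) auto

definition fcoef :: "real \<Rightarrow> real \<Rightarrow> (real \<Rightarrow> complex ^ 'n) \<Rightarrow> int \<Rightarrow> complex ^ 'n" where
  "fcoef a b f l = (1 / (b - a)) *\<^sub>R integral\<^sup>L (lebesgue_on {a<..<b}) (\<lambda>x. wave a b (- l) x *s f x)"

lemma integral_wave_scale:
  fixes v :: "complex ^ 'n"
  assumes "a < b"
  shows "integral\<^sup>L (lebesgue_on {a<..<b}) (\<lambda>x. wave a b l x *s v)
    = (if l = 0 then (b - a) *\<^sub>R v else 0)"
proof -
  have *: "integral\<^sup>L (lebesgue_on {a<..<b}) (\<lambda>x. wave a b l x *s v) = integral {a..b} (\<lambda>x. wave a b l x *s v)"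
    by (intro continuous_integral_open_interval(2) continuous_intros)
  show ?thesis
  proof (cases "l = 0")
    case True
    then show ?thesis using assms unfolding * by simp
  next
    case False
    define c where "c = \<i> * of_real (freq a b l)"
    have "c \<noteq> 0" using False assms by (auto simp: c_def freq_def)
    have "((\<lambda>x. wave a b l x *s v) has_integral
        wave a b l b *s ((1 / c) *s v) - wave a b l a *s ((1 / c) *s v)) {a..b}"
    proof (rule fundamental_theorem_of_calculus)
      fix x
      have "((\<lambda>x. wave a b l x *s ((1 / c) *s v)) has_vector_derivative (c * wave a b l x) *s ((1 / c) *s v))
          (at x within {a..b})"
        unfolding c_def
        by (rule bounded_linear.has_vector_derivative[OF
              bounded_bilinear.bounded_linear_left[OF bounded_bilinear_vector_scale]
              wave_has_vector_derivative])
      then show "((\<lambda>x. wave a b l x *s ((1 / c) *s v)) has_vector_derivative wave a b l x *s v)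
          (at x within {a..b})"
        using \<open>c \<noteq> 0\<close> by simp
    qed (use assms in simp)
    then show ?thesis unfolding * using False assms by (simp add: integral_unique)
  qed
qed

lemma integral_wave_scale_split:
  fixes w :: "real \<Rightarrow> complex ^ 'n"
  assumes "integrable (lebesgue_on {a<..<b}) w"
  shows "integral\<^sup>L (lebesgue_on {a<..<b}) (\<lambda>x. wave a b (- l) x *s w x)
    = integral\<^sup>L (lebesgue_on {a<..<b}) (\<lambda>x. cos (- freq a b l * x + freq a b l * a) *\<^sub>R w x)
      + \<i> *s integral\<^sup>L (lebesgue_on {a<..<b}) (\<lambda>x. sin (- freq a b l * x + freq a b l * a) *\<^sub>R w x)"
proof -
  let ?M = "lebesgue_on {a<..<b}"
  define s where "s x = sin (- freq a b l * x + freq a b l * a)" for x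
  have int: "integrable ?M (\<lambda>x. s x *\<^sub>R w x)"
    unfolding s_def by (intro integrable_continuous_scaleR continuous_intros assms)
  have eq: "s x *\<^sub>R (\<i> *s w x) = \<i> *s (s x *\<^sub>R w x)" for x
    by (simp add: scaleR_eq_vector_scale vector_smult_assoc mult.commute)
  show ?thesis
    unfolding wave_scale_eq s_def[symmetric] eq
    by (subst Bochner_Integration.integral_add)
      (auto intro!: integrable_continuous_scaleR continuous_intros assms int
        integrable_bounded_linear[OF bounded_linear_vector_scale]
        simp: integral_bounded_linear[OF bounded_linear_vector_scale int])
qed

lemma fcoef_weak_deriv_0:
  fixes u v :: "real \<Rightarrow> complex ^ 'n"
  assumes "a < b" "has_weak_deriv a b 0 u v"
    and u: "integrable (lebesgue_on {a<..<b}) u" and v: "integrable (lebesgue_on {a<..<b}) v"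
  shows "fcoef a b v l = fcoef a b u l"
proof -
  have "smooth (\<lambda>x. cos (c * x + d))" "smooth (\<lambda>x. sin (c * x + d))" for c d
    using smooth_trig[of 1 c d 0] smooth_trig[of 0 c d 1] by simp_all
  note * = this[of "- freq a b l" "freq a b l * a", THEN weak_deriv_0_integral_eq[OF assms(1,2) _ u v]]
  show ?thesis
    unfolding fcoef_def integral_wave_scale_split[OF u] integral_wave_scale_split[OF v] * ..
qed

text \<open>The phases at the two ends differ by a multiple of 2 pi, so cosine and sine are
  admissible periodic tests; differentiation exchanges them, and recombining gives the
  factor.\<close>

lemma fcoef_weak_deriv_1:
  fixes u v :: "real \<Rightarrow> complex ^ 'n"
  assumes "a < b" "has_weak_deriv a b 1 u v"
    and u: "continuous_on {a..b} u" "u a = u b" and v: "integrable (lebesgue_on {a<..<b}) v"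
  shows "fcoef a b v l = (\<i> * of_real (freq a b l)) *s fcoef a b u l"
proof -
  let ?I = "integral\<^sup>L (lebesgue_on {a<..<b})"
  define c d where "c = - freq a b l" and "d = freq a b l * a"
  have sm: "smooth (\<lambda>x. cos (c * x + d))" "smooth (\<lambda>x. sin (c * x + d))"
    using smooth_trig[of 1 c d 0] smooth_trig[of 0 c d 1] by simp_all
  have a: "c * a + d = 0" by (simp add: c_def d_def)
  have "freq a b l * (b - a) = 2 * pi * of_int l"
    using assms(1) by (simp add: freq_def)
  then have b: "c * b + d = - (2 * pi * of_int l)"
    by (simp add: c_def d_def algebra_simps)
  have per: "cos (c * a + d) = cos (c * b + d)" "sin (c * a + d) = sin (c * b + d)"
    unfolding a b by (simp_all add: cos_int_2pin sin_int_2pin)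
  have "deriv (\<lambda>x. cos (c * x + d)) x = - c * sin (c * x + d)"
    "deriv (\<lambda>x. sin (c * x + d)) x = c * cos (c * x + d)" for x
    by (auto intro!: DERIV_imp_deriv derivative_eq_intros)
  then have eqs: "?I (\<lambda>x. cos (c * x + d) *\<^sub>R v x) = c *\<^sub>R ?I (\<lambda>x. sin (c * x + d) *\<^sub>R u x)"
    "?I (\<lambda>x. sin (c * x + d) *\<^sub>R v x) = - c *\<^sub>R ?I (\<lambda>x. cos (c * x + d) *\<^sub>R u x)"
    using weak_deriv_1_integral_by_parts[OF assms(1,2) sm(1) per(1) u v]
      weak_deriv_1_integral_by_parts[OF assms(1,2) sm(2) per(2) u v]
    by (simp_all flip: scaleR_scaleR)
  have "?I (\<lambda>x. wave a b (- l) x *s v x) = (\<i> * of_real (freq a b l)) *s ?I (\<lambda>x. wave a b (- l) x *s u x)"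
    using eqs unfolding integral_wave_scale_split[OF v]
      integral_wave_scale_split[OF continuous_integral_open_interval(1)[OF u(1)]]
    unfolding c_def d_def
    by (simp only: vec_eq_iff vector_add_component vector_smult_component vector_scaleR_component)
      (simp add: complex_eq_iff algebra_simps)
  then show ?thesis
    unfolding fcoef_def by (simp add: scaleR_eq_vector_scale vector_smult_assoc mult.commute)
qed

section \<open>Bessel's inequality and the decay of coefficients\<close>

lemma bounded_AE_integrable:
  fixes g :: "real \<Rightarrow> 'v::euclidean_space"
  assumes "g \<in> borel_measurable (lebesgue_on {a<..<b})" "AE x in lebesgue_on {a<..<b}. norm (g x) \<le> c"
  shows "integrable (lebesgue_on {a<..<b}) g"
proof -
  interpret finite_measure "lebesgue_on {a<..<b}"
    by (rule finite_measure_lebesgue_on) auto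
  show ?thesis using assms(2,1) by (rule integrable_const_bound)
qed

lemma norm_wave_sum_square:
  fixes c :: "int \<Rightarrow> complex ^ 'n"
  shows "(norm (\<Sum>l\<in>F. wave a b l x *s c l))\<^sup>2
    = (\<Sum>k\<in>F. \<Sum>l\<in>F. (wave a b (l - k) x *s c l) \<bullet> c k)"
proof -
  have "(wave a b l x *s c l) \<bullet> (wave a b k x *s c k) = (wave a b (l - k) x *s c l) \<bullet> c k" for l k
    using wave_add[of a b "- k" l x]
    by (simp add: inner_vector_scale_right wave_uminus vector_smult_assoc)
  then show ?thesis
    by (simp add: power2_norm_eq_inner inner_sum_left inner_sum_right)
qed

lemma trig_poly_norm_square:
  fixes c :: "int \<Rightarrow> complex ^ 'n"
  assumes "a < b" "finite F"
  shows "integral\<^sup>L (lebesgue_on {a<..<b}) (\<lambda>x. (norm (\<Sum>l\<in>F. wave a b l x *s c l))\<^sup>2)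
    = (b - a) * (\<Sum>l\<in>F. (norm (c l))\<^sup>2)"
proof -
  let ?I = "integral\<^sup>L (lebesgue_on {a<..<b})"
  have int: "integrable (lebesgue_on {a<..<b}) (\<lambda>x. wave a b l x *s v)" for l and v :: "complex ^ 'n"
    by (intro continuous_integral_open_interval(1) continuous_intros)
  have "?I (\<lambda>x. (norm (\<Sum>l\<in>F. wave a b l x *s c l))\<^sup>2)
      = (\<Sum>k\<in>F. \<Sum>l\<in>F. ?I (\<lambda>x. (wave a b (l - k) x *s c l)) \<bullet> c k)"
    using int by (simp add: norm_wave_sum_square Bochner_Integration.integral_sum)
  also have "\<dots> = (\<Sum>k\<in>F. \<Sum>l\<in>F. if l = k then (b - a) * (norm (c k))\<^sup>2 else 0)"
    by (intro sum.cong refl) (auto simp: integral_wave_scale[OF assms(1)] power2_norm_eq_inner)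
  finally show ?thesis using assms(2) by (simp add: sum_distrib_left)
qed

text \<open>Integrate 2 f.q - |q|^2 \<le> |f|^2 \<le> c^2 for the partial sum q, whose products with
  f and with itself both integrate to (b - a) times the coefficient sum. The normalisation of
  \<open>fcoef\<close> cancels the interval length, which leaves c^2.\<close>

lemma bessel_inequality:
  fixes f :: "real \<Rightarrow> complex ^ 'n"
  assumes "a < b" and f: "integrable (lebesgue_on {a<..<b}) f"
    and c: "AE x in lebesgue_on {a<..<b}. norm (f x) \<le> c" and F: "finite F"
  shows "(\<Sum>l\<in>F. (norm (fcoef a b f l))\<^sup>2) \<le> c\<^sup>2"
proof -
  let ?I = "integral\<^sup>L (lebesgue_on {a<..<b})"
  define q where "q x = (\<Sum>l\<in>F. wave a b l x *s fcoef a b f l)" for x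
  define S where "S = (\<Sum>l\<in>F. (norm (fcoef a b f l))\<^sup>2)"
  have q: "continuous_on {a..b} q" unfolding q_def by (intro continuous_intros)
  have fq: "f x \<bullet> q x = (\<Sum>l\<in>F. (wave a b (- l) x *s f x) \<bullet> fcoef a b f l)" for x
    unfolding q_def inner_sum_right
    by (simp add: inner_vector_scale_right wave_uminus)
  have int_fq: "integrable (lebesgue_on {a<..<b}) (\<lambda>x. f x \<bullet> q x)"
    unfolding fq by (intro Bochner_Integration.integrable_sum integrable_inner_left integrable_wave_scale f)
  have "?I (\<lambda>x. f x \<bullet> q x) = (\<Sum>l\<in>F. ?I (\<lambda>x. wave a b (- l) x *s f x) \<bullet> fcoef a b f l)"
    unfolding fq using integrable_wave_scale[OF f] by (simp add: Bochner_Integration.integral_sum)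
  also have "\<dots> = (\<Sum>l\<in>F. (b - a) * (norm (fcoef a b f l))\<^sup>2)"
    using assms(1) unfolding fcoef_def power2_norm_eq_inner by (intro sum.cong refl) simp
  finally have I1: "?I (\<lambda>x. f x \<bullet> q x) = (b - a) * S" by (simp add: S_def sum_distrib_left)
  have I2: "?I (\<lambda>x. (norm (q x))\<^sup>2) = (b - a) * S"
    unfolding q_def S_def by (rule trig_poly_norm_square[OF assms(1) F])
  have int_q: "integrable (lebesgue_on {a<..<b}) (\<lambda>x. (norm (q x))\<^sup>2)"
    by (intro continuous_integral_open_interval(1) continuous_intros q)
  have "?I (\<lambda>x. 2 * (f x \<bullet> q x) - (norm (q x))\<^sup>2) \<le> ?I (\<lambda>x. c\<^sup>2)"
  proof (rule integral_mono_AE)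
    show "AE x in lebesgue_on {a<..<b}. 2 * (f x \<bullet> q x) - (norm (q x))\<^sup>2 \<le> c\<^sup>2"
      using c
    proof eventually_elim
      case (elim x)
      have "0 \<le> (norm (f x - q x))\<^sup>2" by simp
      also have "\<dots> = (norm (f x))\<^sup>2 - 2 * (f x \<bullet> q x) + (norm (q x))\<^sup>2"
        by (simp add: power2_norm_eq_inner inner_diff_left inner_diff_right inner_commute)
      finally show ?case using power_mono[OF elim norm_ge_zero, of 2] by linarith
    qed
    show "integrable (lebesgue_on {a<..<b}) (\<lambda>x. c\<^sup>2)"
      by (intro continuous_integral_open_interval(1) continuous_intros)
  qed (intro Bochner_Integration.integrable_diff integrable_mult_right int_fq int_q)
  also have "?I (\<lambda>x. 2 * (f x \<bullet> q x) - (norm (q x))\<^sup>2) = (b - a) * S"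
    using int_fq int_q by (simp add: I1 I2)
  also have "?I (\<lambda>x. c\<^sup>2) = (b - a) * c\<^sup>2"
    using continuous_integral_open_interval(2)[of a b "\<lambda>_. c\<^sup>2"] assms(1) by simp
  finally show ?thesis using assms(1) by (simp add: S_def)
qed

text \<open>The Riemann-Lebesgue lemma: by Bessel the squares are summable along any injective
  sequence of indices.\<close>

lemma fcoef_vanish:
  fixes f :: "real \<Rightarrow> complex ^ 'n"
  assumes "a < b" "continuous_on {a..b} f" "inj s"
  shows "(\<lambda>n. fcoef a b f (s n)) \<longlonglongrightarrow> 0"
proof -
  obtain c where c: "\<And>x. x \<in> {a..b} \<Longrightarrow> norm (f x) \<le> c"
    using compact_imp_bounded[OF compact_continuous_image[OF assms(2) compact_Icc]]
    unfolding bounded_iff by blast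
  have "(\<Sum>n<N. (norm (fcoef a b f (s n)))\<^sup>2) \<le> c\<^sup>2" for N :: nat
  proof -
    have "(\<Sum>n<N. (norm (fcoef a b f (s n)))\<^sup>2) = (\<Sum>l\<in>s ` {..<N}. (norm (fcoef a b f l))\<^sup>2)"
      by (simp add: sum.reindex[OF inj_on_subset[OF assms(3) subset_UNIV]])
    also have "\<dots> \<le> c\<^sup>2"
      by (intro bessel_inequality assms(1) continuous_integral_open_interval(1)[OF assms(2)] AE_I2)
        (auto simp: c)
    finally show ?thesis .
  qed
  then have "summable (\<lambda>n. (norm (fcoef a b f (s n)))\<^sup>2)"
    by (rule summableI_nonneg_bounded[where x = "c\<^sup>2", rotated]) simp
  then have "(\<lambda>n. sqrt ((norm (fcoef a b f (s n)))\<^sup>2)) \<longlonglongrightarrow> sqrt 0"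
    by (intro tendsto_real_sqrt summable_LIMSEQ_zero)
  then have "(\<lambda>n. norm (fcoef a b f (s n))) \<longlonglongrightarrow> 0" by simp
  then show ?thesis by (rule tendsto_norm_zero_cancel)
qed

section \<open>Telescoping partial Fourier sums\<close>

lemma sum_telescope_int:
  "(\<Sum>l\<in>{p..<p + int n}. H (l - 1) - H l) = H (p - 1) - (H (p + int n - 1) :: 'v::ab_group_add)"
proof (induction n)
  case (Suc n)
  have "{p..<p + int (Suc n)} = insert (p + int n) {p..<p + int n}" by auto
  then show ?case using Suc by simp
qed simp

text \<open>Chernoff's argument: dividing \<open>f - v\<close> by \<open>exp (2 pi i (y - x) / (b - a)) - 1\<close> turns the
  partial Fourier sums at \<open>x\<close> into telescoping sums.\<close>

lemma fourier_series_tendsto_quotient: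
  fixes f g :: "real \<Rightarrow> complex ^ 'n"
  assumes "a < b" and f: "continuous_on {a..b} f" and g: "continuous_on {a..b} g"
    and fg: "\<And>y. y \<in> {a<..<b} \<Longrightarrow> f y - v = (wave a b 1 y * wave a b (- 1) x - 1) *s g y"
    and A: "filterlim A at_top sequentially" and B: "filterlim B at_top sequentially"
  shows "(\<lambda>n. \<Sum>l\<in>{- int (A n)..<int (B n)}. wave a b l x *s fcoef a b f l) \<longlonglongrightarrow> v"
proof -
  let ?M = "lebesgue_on {a<..<b}"
  let ?I = "integral\<^sup>L ?M"
  define H where "H l = wave a b l x *s fcoef a b g l" for l
  note ig = integrable_wave_scale[OF continuous_integral_open_interval(1)[OF g]]
  \<comment> \<open>Multiplication by \<open>wave a b 1\<close> shifts the coefficients of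
    \<open>g\<close> by one index, and the constant \<open>v\<close> has only the coefficient at
    0.\<close>
  have coef: "wave a b l x *s fcoef a b f l = (if l = 0 then v else 0) + (H (l - 1) - H l)" for l
  proof -
    have "?I (\<lambda>y. wave a b (- l) y *s f y) = ?I (\<lambda>y. wave a b (- l) y *s v +
        (wave a b (- 1) x *s (wave a b (- (l - 1)) y *s g y) - wave a b (- l) y *s g y))"
    proof (rule Bochner_Integration.integral_cong)
      fix y assume "y \<in> space ?M"
      then have "y \<in> {a<..<b}" by simp
      then have fy: "f y = v + (wave a b 1 y * wave a b (- 1) x - 1) *s g y"
        using fg[of y] by (metis add.commute diff_add_cancel \<open>y \<in> {a<..<b}\<close>)
      have wy: "wave a b (- (l - 1)) y = wave a b (- l) y * wave a b 1 y"
        using wave_add[of a b "- l" 1 y] by simp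
      show "wave a b (- l) y *s f y = wave a b (- l) y *s v +
        (wave a b (- 1) x *s (wave a b (- (l - 1)) y *s g y) - wave a b (- l) y *s g y)"
        unfolding fy wy by (simp only: vec_eq_iff) (simp add: algebra_simps)
    qed simp
    also have "\<dots> = ?I (\<lambda>y. wave a b (- l) y *s v) +
        (wave a b (- 1) x *s ?I (\<lambda>y. wave a b (- (l - 1)) y *s g y) - ?I (\<lambda>y. wave a b (- l) y *s g y))"
      using ig[of "- (l - 1)"] ig[of "- l"]
        integrable_wave_scale[OF continuous_integral_open_interval(1)[OF continuous_on_const], of a b "- l" v]
        integrable_bounded_linear[OF bounded_linear_vector_scale ig[of "- (l - 1)"], of "wave a b (- 1) x"]
        integral_bounded_linear[OF bounded_linear_vector_scale ig[of "- (l - 1)"], of "wave a b (- 1) x"]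
      by simp
    finally have eq: "?I (\<lambda>y. wave a b (- l) y *s f y) = (if l = 0 then (b - a) *\<^sub>R v else 0) +
        (wave a b (- 1) x *s ?I (\<lambda>y. wave a b (- (l - 1)) y *s g y) - ?I (\<lambda>y. wave a b (- l) y *s g y))"
      by (simp add: integral_wave_scale[OF assms(1)])
    have E: "fcoef a b f l = (if l = 0 then v else 0) +
        (wave a b (- 1) x *s fcoef a b g (l - 1) - fcoef a b g l)"
    proof -
      have "complex_of_real (1 / (b - a)) * (complex_of_real (b - a) * z) = z" for z
        using assms(1) by (simp flip: of_real_mult mult.assoc)
      then show ?thesis
        unfolding fcoef_def eq scaleR_eq_vector_scale vec_eq_iff
        by (simp add: distrib_left right_diff_distrib mult.left_commute del: of_real_diff of_real_divide)
    qed
    have "wave a b (l - 1) x = wave a b l x * wave a b (- 1) x"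
      using wave_add[of a b l "- 1" x] by simp
    then show ?thesis
      unfolding H_def E by (simp only: vec_eq_iff) (simp add: algebra_simps)
  qed
  have H: "(\<lambda>n. H (s n)) \<longlonglongrightarrow> 0" if "inj s" for s :: "nat \<Rightarrow> int"
  proof (rule tendsto_norm_zero_cancel)
    show "(\<lambda>n. norm (H (s n))) \<longlonglongrightarrow> 0"
      using tendsto_norm_zero[OF fcoef_vanish[OF assms(1) g that]] by (simp add: H_def)
  qed
  have "(\<lambda>n. H (- int n - 1)) \<longlonglongrightarrow> 0" "(\<lambda>n. H (int n - 1)) \<longlonglongrightarrow> 0"
    by (auto intro!: H injI)
  from filterlim_compose[OF this(1) A] filterlim_compose[OF this(2) B]
  have "(\<lambda>n. v + (H (- int (A n) - 1) - H (int (B n) - 1))) \<longlonglongrightarrow> v + (0 - 0)"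
    by (intro tendsto_intros)
  moreover have "\<forall>\<^sub>F n in sequentially. v + (H (- int (A n) - 1) - H (int (B n) - 1)) =
      (\<Sum>l\<in>{- int (A n)..<int (B n)}. wave a b l x *s fcoef a b f l)"
    \<comment> \<open>The index range is half-open, so it contains 0, and the sum contains
      \<open>v\<close>, only once \<open>B n\<close> is at least 1.\<close>
    using filterlim_at_top[THEN iffD1, OF B, rule_format, of 1]
  proof eventually_elim
    case (elim n)
    have "(\<Sum>l\<in>{- int (A n)..<- int (A n) + int (A n + B n)}. H (l - 1) - H l)
        = H (- int (A n) - 1) - H (int (B n) - 1)"
      by (subst sum_telescope_int) simp
    then show ?case
      unfolding coef sum.distrib using elim by simp
  qed
  ultimately show ?thesis by (auto elim: Lim_transform_eventually)
qed

section \<open>Convergence of Fourier series\<close>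

text \<open>For an interior \<open>x\<close> no point of [a,b] lies a full period away. At x = a the
  factor would vanish a second time, at y = b; hence convergence is shown in the open interval and
  extended to the ends by continuity.\<close>

lemma wave_neq:
  assumes "a < b" "x \<in> {a<..<b}" "y \<in> {a..b}" "x \<noteq> y"
  shows "wave a b 1 y * wave a b (- 1) x \<noteq> 1"
proof
  assume "wave a b 1 y * wave a b (- 1) x = 1"
  moreover have "wave a b 1 y * wave a b (- 1) x = cis (2 * pi * ((y - x) / (b - a)))"
    unfolding wave_def cis_mult
    by (rule arg_cong[where f = cis]) (simp add: freq_def diff_divide_distrib right_diff_distrib)
  ultimately have "cos (2 * pi * ((y - x) / (b - a))) = 1"
    by (simp add: complex_eq_iff)
  then obtain k :: int where "2 * pi * ((y - x) / (b - a)) = 2 * pi * of_int k"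
    unfolding cos_one_2pi_int by (auto simp: mult_ac)
  then have k: "(y - x) / (b - a) = of_int k"
    by (subst (asm) mult_cancel_left) auto
  have "\<bar>(y - x) / (b - a)\<bar> < 1" using assms by (auto simp: abs_if field_simps)
  then have "k = 0" unfolding k by linarith
  then show False using k assms by auto
qed

lemma has_vector_derivative_iff_quotient:
  "(f has_vector_derivative f') (at x within A) \<longleftrightarrow>
    ((\<lambda>y. (f y - f x) /\<^sub>R (y - x)) \<longlongrightarrow> f') (at x within A)"
proof -
  have "(f has_vector_derivative f') (at x within A) \<longleftrightarrow>
      ((\<lambda>y. norm ((f y - f x - (y - x) *\<^sub>R f') /\<^sub>R norm (y - x))) \<longlongrightarrow> 0) (at x within A)"
    unfolding tendsto_norm_zero_iff
    by (simp add: has_vector_derivative_def has_derivative_within divide_inverse_commute diff_diff_eq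
        bounded_linear_scaleR_left)
  also have "\<dots> \<longleftrightarrow> ((\<lambda>y. norm ((f y - f x) /\<^sub>R (y - x) - f')) \<longlongrightarrow> 0) (at x within A)"
  proof (rule Lim_cong_within[OF refl refl refl])
    fix y assume "y \<noteq> x"
    then have "(f y - f x) /\<^sub>R (y - x) - f' = (f y - f x - (y - x) *\<^sub>R f') /\<^sub>R (y - x)"
      by (simp add: scaleR_diff_right)
    then show "norm ((f y - f x - (y - x) *\<^sub>R f') /\<^sub>R norm (y - x)) = norm ((f y - f x) /\<^sub>R (y - x) - f')"
      by simp
  qed
  finally show ?thesis by (simp add: tendsto_norm_zero_iff LIM_zero_iff)
qed

lemmas has_vector_derivative_quotient = has_vector_derivative_iff_quotient[THEN iffD1]

lemma fourier_series_tendsto_interior: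
  fixes f :: "real \<Rightarrow> complex ^ 'n"
  assumes "a < b" and f: "continuous_on {a..b} f" and x: "x \<in> {a<..<b}"
    and f': "(f has_vector_derivative f') (at x)"
    and A: "filterlim A at_top sequentially" and B: "filterlim B at_top sequentially"
  shows "(\<lambda>n. \<Sum>l\<in>{- int (A n)..<int (B n)}. wave a b l x *s fcoef a b f l) \<longlonglongrightarrow> f x"
proof -
  define w where "w y = wave a b 1 y * wave a b (- 1) x" for y
  define c where "c = \<i> * of_real (freq a b 1)"
  \<comment> \<open>The value at \<open>x\<close> is the limit of the quotient of the two difference
    quotients, since \<open>c\<close> is the nonzero derivative of \<open>w\<close> there;
    differentiability of \<open>f\<close> at this one point makes \<open>g\<close>
    continuous.\<close>
  define g where "g y = (if y = x then (1 / c) *s f' else (1 / (w y - 1)) *s (f y - f x))" for y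
  have "c \<noteq> 0" using assms(1) by (auto simp: c_def freq_def)
  have wx: "w x = 1" by (simp add: w_def)
  have w_neq: "w y \<noteq> 1" if "y \<in> {a..b}" "y \<noteq> x" for y
    using wave_neq[OF assms(1) x that(1)] that(2) by (auto simp: w_def)
  have cw: "continuous_on S w" for S unfolding w_def by (intro continuous_intros)
  have "(w has_vector_derivative c) (at x)"
    using has_vector_derivative_mult_left[OF wave_has_vector_derivative[of a b 1 x UNIV], of "wave a b (- 1) x"]
    by (simp add: w_def[abs_def] c_def mult.assoc)
  then have w': "((\<lambda>y. (w y - 1) /\<^sub>R (y - x)) \<longlongrightarrow> c) (at x)"
    using has_vector_derivative_quotient wx by fastforce
  have f'': "((\<lambda>y. (f y - f x) /\<^sub>R (y - x)) \<longlongrightarrow> f') (at x)"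
    by (rule has_vector_derivative_quotient[OF f'])
  have "((\<lambda>y. (1 / ((w y - 1) /\<^sub>R (y - x))) *s ((f y - f x) /\<^sub>R (y - x))) \<longlongrightarrow> (1 / c) *s f') (at x)"
    by (intro tendsto_intros w' f'' \<open>c \<noteq> 0\<close>)
  then have "(g \<longlongrightarrow> g x) (at x)"
    unfolding g_def[of x] if_P[OF refl]
  proof (rule Lim_transform_within[OF _ zero_less_one])
    fix y assume y: "0 < dist y x"
    then have "complex_of_real (y - x) * (complex_of_real (inverse (y - x))) = 1"
      by (simp flip: of_real_mult)
    then have "1 / ((w y - 1) /\<^sub>R (y - x)) * of_real (inverse (y - x)) = 1 / (w y - 1)"
      by (simp add: scaleR_conv_of_real field_simps del: of_real_diff of_real_inverse)
    then have "(1 / ((w y - 1) /\<^sub>R (y - x))) *s ((f y - f x) /\<^sub>R (y - x)) = (1 / (w y - 1)) *s (f y - f x)"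
      unfolding scaleR_eq_vector_scale[of "inverse (y - x)"] vector_smult_assoc by simp
    then show "(1 / ((w y - 1) /\<^sub>R (y - x))) *s ((f y - f x) /\<^sub>R (y - x)) = g y"
      using y by (simp add: g_def)
  qed
  then have gx: "continuous (at x within {a..b}) g"
    unfolding continuous_within by (rule tendsto_within_subset) simp
  have "continuous_on {a..b} g"
    unfolding continuous_on_eq_continuous_within
  proof
    fix y assume y: "y \<in> {a..b}"
    show "continuous (at y within {a..b}) g"
    proof (cases "y = x")
      case False
      have "continuous (at y within {a..b}) (\<lambda>y. (1 / (w y - 1)) *s (f y - f x))"
        unfolding continuous_within
        using w_neq[OF y False] f cw[of "{a..b}"] y
        by (intro tendsto_intros) (auto simp: continuous_on_def)
      then show ?thesis
        by (rule continuous_transform_within[of _ _ _ "dist y x"]) (use False y in \<open>auto simp: g_def dist_commute\<close>)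
    qed (use gx in simp)
  qed
  moreover have "f y - f x = (w y - 1) *s g y" if "y \<in> {a..b}" for y
    using w_neq[OF that] by (cases "y = x") (auto simp: g_def wx vector_smult_assoc)
  ultimately show ?thesis
    using fourier_series_tendsto_quotient[OF assms(1) f, of g "f x" x A B] A B
    by (simp add: w_def)
qed

text \<open>For even \<open>M\<close> this is the set of modes enlarged by \<open>P\<close> blocks
  of \<open>M\<close> frequencies on either side, so that series can be summed blockwise;
  \<open>window 1 P\<close> serves for ordinary partial sums.\<close>

definition window :: "nat \<Rightarrow> nat \<Rightarrow> int set" where
  "window M P = {- int (P * M + M div 2)..<int (P * M + M div 2)}"

lemma finite_window [simp]: "finite (window M P)"
  by (simp add: window_def)

lemma finite_int_bound:
  fixes F :: "int set"
  assumes "finite F"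
  shows "\<exists>N. \<forall>l\<in>F. \<bar>l\<bar> \<le> int N"
proof (intro exI ballI)
  fix l assume "l \<in> F"
  then have "nat \<bar>l\<bar> \<le> Max ((\<lambda>l. nat \<bar>l\<bar>) ` F)" using assms by (intro Max_ge) auto
  then show "\<bar>l\<bar> \<le> int (Max ((\<lambda>l. nat \<bar>l\<bar>) ` F))" by linarith
qed

lemma filterlim_window_bound: "M > 0 \<Longrightarrow> filterlim (\<lambda>P. P * M + M div 2) at_top sequentially"
  by (rule filterlim_at_top_mono[OF filterlim_ident]) (auto intro!: always_eventually trans_le_add1)

lemma filterlim_window:
  assumes "M > 0"
  shows "filterlim (window M) (finite_subsets_at_top UNIV) sequentially"
  unfolding filterlim_finite_subsets_at_top
proof safe
  fix X :: "int set" assume X: "finite X"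
  obtain N where N: "\<And>l. l \<in> X \<Longrightarrow> \<bar>l\<bar> \<le> int N"
    using finite_int_bound[OF X] by blast
  have "\<forall>\<^sub>F P in sequentially. N + 1 \<le> P * M + M div 2"
    using filterlim_window_bound[OF assms] unfolding filterlim_at_top by blast
  then show "\<forall>\<^sub>F P in sequentially. finite (window M P) \<and> X \<subseteq> window M P \<and> window M P \<subseteq> UNIV"
  proof eventually_elim
    case (elim P)
    have "l \<in> window M P" if "l \<in> X" for l
      using N[OF that] elim unfolding window_def atLeastLessThan_iff by linarith
    then show ?case by auto
  qed
qed

section \<open>Summability of coefficients and termwise differentiation\<close>

lemma sum_inverse_squares_le: "(\<Sum>p = 1..P. 1 / real p ^ 2) \<le> 2 - 1 / real P"
proof (induction P)
  case (Suc P)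
  show ?case
  proof (cases "P = 0")
    case False
    then have "1 / real P - 1 / real (Suc P) = 1 / (real P * real (Suc P))"
      by (simp add: field_simps)
    moreover have "1 / real (Suc P) ^ 2 \<le> 1 / (real P * real (Suc P))"
      using False unfolding power2_eq_square by (intro divide_left_mono mult_mono mult_pos_pos) auto
    ultimately have "1 / real (Suc P) ^ 2 \<le> 1 / real P - 1 / real (Suc P)" by simp
    then show ?thesis using Suc by simp
  qed simp
qed simp

text \<open>The index 0 may stay in: its term is 1 / 0 = 0.\<close>

lemma summable_on_int_inverse_squares: "(\<lambda>l. 1 / real_of_int l ^ 2) summable_on UNIV"
proof (rule nonneg_bdd_above_summable_on)
  show "bdd_above (sum (\<lambda>l. 1 / real_of_int l ^ 2) ` {F. F \<subseteq> UNIV \<and> finite F})"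
  proof (rule bdd_aboveI, clarify)
    fix F :: "int set" assume F: "finite F"
    obtain N where N: "\<And>l. l \<in> F \<Longrightarrow> \<bar>l\<bar> \<le> int N"
      using finite_int_bound[OF F] by blast
    have "(\<Sum>l\<in>F. 1 / real_of_int l ^ 2) \<le> (\<Sum>l\<in>{- int N..int N}. 1 / real_of_int l ^ 2)"
      using N by (intro sum_mono2) (auto simp: abs_le_iff minus_le_iff)
    also have "\<dots> = 2 * (\<Sum>p = 1..N. 1 / real p ^ 2)"
    proof (induction N)
      case (Suc N)
      have "{- int (Suc N)..int (Suc N)} = insert (int (Suc N)) (insert (- int (Suc N)) {- int N..int N})"
        by auto
      moreover have "(- 1 - real N)\<^sup>2 = (1 + real N)\<^sup>2" by (simp add: power2_eq_square algebra_simps)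
      ultimately show ?case using Suc by simp
    qed simp
    also have "\<dots> \<le> 2 * 2"
      using sum_inverse_squares_le[of N] by (smt (verit) divide_nonneg_nonneg of_nat_0_le_iff)
    finally show "(\<Sum>l\<in>F. 1 / real_of_int l ^ 2) \<le> 4" by simp
  qed
qed simp

text \<open>Two derivatives in l^2 give one in l^1: with \<mu> the frequency and c the modulus of
  the coefficient, |\<mu>| c = (1/|\<mu>|) (\<mu>^2 c) is at most 1/\<mu>^2 + (\<mu>^2 c)^2, a sum
  of two summable terms.\<close>

lemma summable_on_freq_coef:
  fixes c :: "int \<Rightarrow> complex ^ 'n"
  assumes "a < b" and S: "\<And>F. finite F \<Longrightarrow> (\<Sum>l\<in>F. (\<bar>freq a b l\<bar> ^ 2 * norm (c l))\<^sup>2) \<le> S"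
  shows "(\<lambda>l. \<bar>freq a b l\<bar> * norm (c l)) summable_on UNIV"
proof (rule summable_on_comparison_test)
  have "(\<lambda>l. (\<bar>freq a b l\<bar> ^ 2 * norm (c l))\<^sup>2) summable_on UNIV"
  proof (rule nonneg_bdd_above_summable_on)
    show "bdd_above (sum (\<lambda>l. (\<bar>freq a b l\<bar> ^ 2 * norm (c l))\<^sup>2) ` {F. F \<subseteq> UNIV \<and> finite F})"
      by (rule bdd_aboveI[of _ S]) (clarify, rule S)
  qed simp
  then show "(\<lambda>l. ((b - a) / (2 * pi))\<^sup>2 * (1 / real_of_int l ^ 2) + (\<bar>freq a b l\<bar> ^ 2 * norm (c l))\<^sup>2)
      summable_on UNIV"
    by (intro summable_on_add summable_on_cmult_right summable_on_int_inverse_squares)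
  fix l :: int
  show "\<bar>freq a b l\<bar> * norm (c l) \<le>
    ((b - a) / (2 * pi))\<^sup>2 * (1 / real_of_int l ^ 2) + (\<bar>freq a b l\<bar> ^ 2 * norm (c l))\<^sup>2"
  proof (cases "l = 0")
    case False
    define x y where "x = (b - a) / (2 * pi) * (1 / real_of_int l)" and "y = \<bar>freq a b l\<bar> ^ 2 * norm (c l)"
    have "\<bar>x\<bar> * \<bar>freq a b l\<bar> = 1"
      using False assms(1) by (simp add: x_def freq_def abs_mult)
    moreover have "\<bar>x\<bar> * y = (\<bar>x\<bar> * \<bar>freq a b l\<bar>) * (\<bar>freq a b l\<bar> * norm (c l))"
      unfolding y_def power2_eq_square by (simp only: mult_ac)
    ultimately have "\<bar>freq a b l\<bar> * norm (c l) = \<bar>x\<bar> * y" by simp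
    also have "\<dots> \<le> x\<^sup>2 + y\<^sup>2"
    proof -
      have "2 * (\<bar>x\<bar> * y) \<le> x\<^sup>2 + y\<^sup>2"
        using zero_le_power2[of "\<bar>x\<bar> - y"] by (simp add: power2_diff)
      moreover have "0 \<le> \<bar>x\<bar> * y" by (simp add: y_def)
      ultimately show ?thesis by linarith
    qed
    also have "x\<^sup>2 = ((b - a) / (2 * pi))\<^sup>2 * (1 / real_of_int l ^ 2)"
      unfolding x_def power_mult_distrib power_one_over ..
    finally show ?thesis unfolding y_def .
  qed (simp add: freq_def)
qed simp

lemma summable_on_coef:
  fixes c :: "int \<Rightarrow> complex ^ 'n"
  assumes "a < b" "(\<lambda>l. \<bar>freq a b l\<bar> * norm (c l)) summable_on UNIV"
  shows "(\<lambda>l. norm (c l)) summable_on UNIV"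
proof (rule summable_on_comparison_test)
  have "(\<lambda>l. if l = 0 then norm (c 0) else 0) summable_on (UNIV :: int set)"
    by (rule finite_nonzero_values_imp_summable_on) (rule finite_subset[of _ "{0}"], auto)
  then show "(\<lambda>l. (b - a) / (2 * pi) * (\<bar>freq a b l\<bar> * norm (c l)) + (if l = 0 then norm (c 0) else 0))
      summable_on UNIV"
    by (intro summable_on_add summable_on_cmult_right assms(2))
  fix l :: int
  show "norm (c l) \<le> (b - a) / (2 * pi) * (\<bar>freq a b l\<bar> * norm (c l)) + (if l = 0 then norm (c 0) else 0)"
  proof (cases "l = 0")
    case False
    have "1 \<le> \<bar>real_of_int l\<bar>" using False by linarith
    moreover have "(b - a) / (2 * pi) * \<bar>freq a b l\<bar> = \<bar>real_of_int l\<bar>"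
      using assms(1) by (simp add: freq_def abs_mult)
    ultimately show ?thesis
      using mult_right_mono[of 1 "\<bar>real_of_int l\<bar>" "norm (c l)"] False by (simp flip: mult.assoc)
  qed (simp add: freq_def)
qed simp

lemma wave_series_uniform_limit:
  fixes c :: "int \<Rightarrow> complex ^ 'n"
  assumes "M > 0" "(\<lambda>l. norm (c l)) summable_on UNIV"
  shows "uniform_limit A (\<lambda>P x. \<Sum>l\<in>window M P. wave a b l x *s c l)
    (\<lambda>x. \<Sum>\<^sub>\<infinity>l. wave a b l x *s c l) sequentially"
proof (rule uniform_limitI)
  fix e :: real assume "e > 0"
  moreover have "uniform_limit A (\<lambda>X x. \<Sum>l\<in>X. wave a b l x *s c l)
      (\<lambda>x. \<Sum>\<^sub>\<infinity>l. wave a b l x *s c l) (finite_subsets_at_top UNIV)"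
    by (rule Weierstrass_m_test_general[OF _ assms(2)]) simp
  ultimately have "\<forall>\<^sub>F X in finite_subsets_at_top UNIV. \<forall>x\<in>A.
      dist (\<Sum>l\<in>X. wave a b l x *s c l) (\<Sum>\<^sub>\<infinity>l. wave a b l x *s c l) < e"
    by (simp add: uniform_limit_iff)
  then show "\<forall>\<^sub>F P in sequentially. \<forall>x\<in>A.
      dist (\<Sum>l\<in>window M P. wave a b l x *s c l) (\<Sum>\<^sub>\<infinity>l. wave a b l x *s c l) < e"
    using filterlim_window[OF assms(1)] by (rule eventually_compose_filterlim)
qed

lemma wave_series_continuous:
  fixes c :: "int \<Rightarrow> complex ^ 'n"
  assumes "(\<lambda>l. norm (c l)) summable_on UNIV"
  shows "continuous_on A (\<lambda>x. \<Sum>\<^sub>\<infinity>l. wave a b l x *s c l)"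
  by (rule uniform_limit_theorem[OF _ wave_series_uniform_limit[OF zero_less_one assms]])
    (auto intro!: always_eventually continuous_intros)

lemma continuous_eq_on_closed_interval:
  fixes f g :: "real \<Rightarrow> 'v::real_normed_vector"
  assumes "a < b" "continuous_on {a..b} f" "continuous_on {a..b} g"
    "\<And>x. x \<in> {a<..<b} \<Longrightarrow> f x = g x" "x \<in> {a..b}"
  shows "f x = g x"
proof -
  have "norm (f x - g x) \<le> 0"
    by (rule continuous_on_closure_norm_le[of "{a<..<b}" "\<lambda>x. f x - g x"])
      (use assms in \<open>auto intro!: continuous_intros\<close>)
  then show ?thesis by simp
qed

text \<open>Differentiability identifies the limit of the partial sums in the open interval;
  absolute summability makes the series continuous, which settles the ends, and the grid contains
  \<open>a\<close>.\<close>

lemma fourier_series_eq: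
  fixes f :: "real \<Rightarrow> complex ^ 'n"
  assumes "a < b" and f: "continuous_on {a..b} f"
    and f': "\<And>x. x \<in> {a<..<b} \<Longrightarrow> (f has_vector_derivative f' x) (at x)"
    and sum: "(\<lambda>l. norm (fcoef a b f l)) summable_on UNIV" and "x \<in> {a..b}"
  shows "f x = (\<Sum>\<^sub>\<infinity>l. wave a b l x *s fcoef a b f l)"
proof (rule continuous_eq_on_closed_interval[OF assms(1) f wave_series_continuous[OF sum] _ assms(5)])
  fix x assume x: "x \<in> {a<..<b}"
  have "(\<lambda>P. \<Sum>l\<in>window 1 P. wave a b l x *s fcoef a b f l) \<longlonglongrightarrow> f x"
    unfolding window_def
    by (rule fourier_series_tendsto_interior[OF assms(1) f x f'[OF x]];
        intro filterlim_window_bound zero_less_one)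
  moreover have "(\<lambda>P. \<Sum>l\<in>window 1 P. wave a b l x *s fcoef a b f l) \<longlonglongrightarrow> (\<Sum>\<^sub>\<infinity>l. wave a b l x *s fcoef a b f l)"
    by (rule tendsto_uniform_limitI[OF wave_series_uniform_limit[OF zero_less_one sum, where A = "{a..b}"]])
      (use x in auto)
  ultimately show "f x = (\<Sum>\<^sub>\<infinity>l. wave a b l x *s fcoef a b f l)"
    by (rule LIMSEQ_unique)
qed

text \<open>The differentiated partial sums converge uniformly by the majorant \<open>c\<close>;
  windows turn the unordered sum into the sequence that the limit theorem expects.\<close>

lemma wave_series_has_vector_derivative:
  fixes c :: "int \<Rightarrow> complex ^ 'n"
  assumes "a < b" and c: "(\<lambda>l. \<bar>freq a b l\<bar> * norm (c l)) summable_on UNIV"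
  shows "((\<lambda>x. \<Sum>\<^sub>\<infinity>l. wave a b l x *s c l) has_vector_derivative
    (\<Sum>\<^sub>\<infinity>l. wave a b l x *s ((\<i> * of_real (freq a b l)) *s c l))) (at x)"
proof -
  define d where "d l = (\<i> * of_real (freq a b l)) *s c l" for l
  define D where "D x = (\<Sum>\<^sub>\<infinity>l. wave a b l x *s d l)" for x
  have d: "(\<lambda>l. norm (d l)) summable_on UNIV"
    using c by (simp add: d_def norm_mult)
  note c' = summable_on_coef[OF assms]
  have lim: "(\<lambda>P. \<Sum>l\<in>window 1 P. wave a b l x *s c l) \<longlonglongrightarrow> (\<Sum>\<^sub>\<infinity>l. wave a b l x *s c l)" for x
    by (rule tendsto_uniform_limitI[OF wave_series_uniform_limit[OF zero_less_one c', where A = UNIV]]) simp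
  have "\<exists>g. \<forall>x\<in>UNIV. (\<lambda>P. \<Sum>l\<in>window 1 P. wave a b l x *s c l) \<longlonglongrightarrow> g x \<and>
      (g has_derivative (\<lambda>h. h *\<^sub>R D x)) (at x within UNIV)"
  proof (rule has_derivative_sequence[OF convex_UNIV])
    fix P and x :: real
    have "((\<lambda>x. \<Sum>l\<in>window 1 P. wave a b l x *s c l) has_vector_derivative
        (\<Sum>l\<in>window 1 P. wave a b l x *s d l)) (at x)"
    proof (rule has_vector_derivative_sum)
      fix l
      have "((\<lambda>x. wave a b l x *s c l) has_vector_derivative
          ((\<i> * of_real (freq a b l)) * wave a b l x) *s c l) (at x)"
        by (rule bounded_linear.has_vector_derivative[OF
              bounded_bilinear.bounded_linear_left[OF bounded_bilinear_vector_scale]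
              wave_has_vector_derivative])
      then show "((\<lambda>x. wave a b l x *s c l) has_vector_derivative wave a b l x *s d l) (at x)"
        by (simp add: d_def vector_smult_assoc mult.commute)
    qed
    then show "((\<lambda>x. \<Sum>l\<in>window 1 P. wave a b l x *s c l) has_derivative
        (\<lambda>h. h *\<^sub>R (\<Sum>l\<in>window 1 P. wave a b l x *s d l))) (at x within UNIV)"
      by (simp add: has_vector_derivative_def)
  next
    fix e :: real assume "e > 0"
    then have "\<forall>\<^sub>F P in sequentially. \<forall>x\<in>UNIV. dist (\<Sum>l\<in>window 1 P. wave a b l x *s d l) (D x) < e"
      using wave_series_uniform_limit[OF zero_less_one d, where A = UNIV and a = a and b = b]
      unfolding uniform_limit_iff D_def by blast
    then show "\<forall>\<^sub>F P in sequentially. \<forall>x\<in>UNIV. \<forall>h.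
        norm (h *\<^sub>R (\<Sum>l\<in>window 1 P. wave a b l x *s d l) - h *\<^sub>R D x) \<le> e * norm h"
    proof eventually_elim
      case (elim P)
      show ?case
      proof (intro ballI allI)
        fix x h :: real
        have "norm (h *\<^sub>R (\<Sum>l\<in>window 1 P. wave a b l x *s d l) - h *\<^sub>R D x)
          = \<bar>h\<bar> * dist (\<Sum>l\<in>window 1 P. wave a b l x *s d l) (D x)"
          by (simp add: dist_norm flip: scaleR_diff_right)
        also have "\<dots> \<le> \<bar>h\<bar> * e"
          using elim by (intro mult_left_mono) (auto intro: less_imp_le)
        finally show "norm (h *\<^sub>R (\<Sum>l\<in>window 1 P. wave a b l x *s d l) - h *\<^sub>R D x) \<le> e * norm h"
          by (simp add: mult.commute)
      qed
    qed
  qed (use lim[of 0] in auto)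
  then obtain g where g: "\<And>x. (\<lambda>P. \<Sum>l\<in>window 1 P. wave a b l x *s c l) \<longlonglongrightarrow> g x"
    "\<And>x. (g has_vector_derivative D x) (at x)"
    by (auto simp: has_vector_derivative_def)
  have "g = (\<lambda>x. \<Sum>\<^sub>\<infinity>l. wave a b l x *s c l)"
    using LIMSEQ_unique[OF g(1) lim] by blast
  then show ?thesis using g(2) by (simp add: D_def d_def)
qed

section \<open>Trigonometric interpolation and aliasing\<close>

lemma wave_grid:
  assumes "a < b" "M > 0"
  shows "wave a b l (grid a b M j) = cis (2 * pi * of_int l / real M) ^ j"
proof -
  have "freq a b l * (grid a b M j - a) = real j * (2 * pi * of_int l / real M)"
    using assms by (simp add: freq_def grid_def mesh_def)
  then show ?thesis unfolding wave_def Complex.DeMoivre by (rule arg_cong)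
qed

lemma cis_root_eq_1_iff:
  assumes "M > 0"
  shows "cis (2 * pi * of_int l / real M) = 1 \<longleftrightarrow> int M dvd l"
proof
  assume "cis (2 * pi * of_int l / real M) = 1"
  then have "cos (2 * pi * of_int l / real M) = 1" by (simp add: complex_eq_iff)
  then obtain k :: int where "2 * pi * of_int l / real M = 2 * pi * of_int k"
    unfolding cos_one_2pi_int by (auto simp: mult_ac)
  then have "real_of_int l = real_of_int (k * int M)"
    using assms by (simp add: field_simps)
  then show "int M dvd l" by (metis dvd_triv_right of_int_eq_iff)
next
  assume "int M dvd l"
  then obtain k where "l = int M * k" by blast
  then have "2 * pi * of_int l / real M = 2 * pi * of_int k" using assms by simp
  then show "cis (2 * pi * of_int l / real M) = 1" by (simp add: cis_multiple_2pi)
qed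

lemma sum_roots_of_unity:
  assumes "M > 0"
  shows "(\<Sum>j<M. cis (2 * pi * of_int l / real M) ^ j) = (if int M dvd l then of_nat M else 0)"
proof (cases "int M dvd l")
  case True
  then show ?thesis using cis_root_eq_1_iff[OF assms, of l] by simp
next
  case False
  have "cis (2 * pi * of_int l / real M) ^ M = cis (2 * pi * of_int l)"
    unfolding Complex.DeMoivre by (rule arg_cong) (use assms in simp)
  also have "\<dots> = 1" by (simp add: cis_multiple_2pi)
  finally show ?thesis
    using False cis_root_eq_1_iff[OF assms, of l] by (simp add: geometric_sum)
qed

lemma sum_wave_grid:
  assumes "a < b" "M > 0"
  shows "(\<Sum>j<M. wave a b l (grid a b M j)) = (if int M dvd l then of_nat M else 0)"
  using sum_roots_of_unity[OF assms(2), of l] by (simp add: wave_grid[OF assms])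

text \<open>The root mean square. With this normalisation the discrete Parseval identity has
  constant 1, and the L^2 norm of an interpolant is sqrt (b - a) times the grid norm of its
  samples.\<close>

definition grid_norm :: "nat \<Rightarrow> (nat \<Rightarrow> 'v::real_normed_vector) \<Rightarrow> real" where
  "grid_norm M U = L2_set (\<lambda>j. norm (U j)) {..<M} / sqrt (real M)"

lemma grid_norm_nonneg [simp]: "grid_norm M U \<ge> 0"
  by (simp add: grid_norm_def)

lemma grid_norm_cong: "(\<And>j. j < M \<Longrightarrow> norm (U j) = norm (V j)) \<Longrightarrow> grid_norm M U = grid_norm M V"
  by (simp add: grid_norm_def L2_set_def)

lemma grid_norm_zero [simp]: "grid_norm M (\<lambda>j. 0) = 0"
  by (simp add: grid_norm_def L2_set_def)

lemma grid_norm_add: "grid_norm M (\<lambda>j. U j + V j) \<le> grid_norm M U + grid_norm M V"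
proof -
  have "L2_set (\<lambda>j. norm (U j + V j)) {..<M} \<le> L2_set (\<lambda>j. norm (U j) + norm (V j)) {..<M}"
    by (intro L2_set_mono) (auto intro: norm_triangle_ineq)
  also have "\<dots> \<le> L2_set (\<lambda>j. norm (U j)) {..<M} + L2_set (\<lambda>j. norm (V j)) {..<M}"
    by (rule L2_set_triangle_ineq)
  finally show ?thesis
    by (simp add: grid_norm_def divide_right_mono flip: add_divide_distrib)
qed

lemma grid_norm_scaleR: "grid_norm M (\<lambda>j. r *\<^sub>R U j) = \<bar>r\<bar> * grid_norm M U"
  by (simp add: grid_norm_def flip: L2_set_right_distrib)

lemma grid_norm_bound:
  assumes "M > 0" "\<And>j. j < M \<Longrightarrow> norm (U j) \<le> c" "c \<ge> 0"
  shows "grid_norm M U \<le> c"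
proof -
  have "L2_set (\<lambda>j. norm (U j)) {..<M} \<le> L2_set (\<lambda>j. c) {..<M}"
    using assms by (intro L2_set_mono) auto
  also have "\<dots> = sqrt (real M) * c"
    using assms by (simp add: L2_set_constant)
  finally show ?thesis
    using assms(1) by (simp add: grid_norm_def divide_le_eq mult.commute)
qed

lemma grid_norm_square: "(grid_norm M U)\<^sup>2 = (\<Sum>j<M. (norm (U j))\<^sup>2) / real M"
  by (simp add: grid_norm_def L2_set_def power_divide sum_nonneg)

lemma grid_norm_tendsto:
  assumes "\<And>j. j < M \<Longrightarrow> (\<lambda>n. U n j) \<longlonglongrightarrow> V j" "\<And>n. grid_norm M (U n) \<le> c"
  shows "grid_norm M V \<le> c"
proof -
  have "(\<lambda>n. grid_norm M (U n)) \<longlonglongrightarrow> grid_norm M V"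
    unfolding grid_norm_def L2_set_def divide_inverse
    by (intro tendsto_intros assms(1)) auto
  then show ?thesis using assms(2) by (intro LIMSEQ_le_const2) auto
qed

text \<open>Two exponentials are orthogonal on the grid unless their frequencies are congruent
  modulo \<open>M\<close>. Stated for any pairwise incongruent set, it covers the modes and every
  translated block of them.\<close>

lemma discrete_parseval:
  fixes c :: "int \<Rightarrow> complex ^ 'n"
  assumes "a < b" "M > 0" "finite F"
    and F: "\<And>k l. k \<in> F \<Longrightarrow> l \<in> F \<Longrightarrow> int M dvd l - k \<Longrightarrow> l = k"
  shows "grid_norm M (\<lambda>j. \<Sum>l\<in>F. wave a b l (grid a b M j) *s c l) = L2_set (\<lambda>l. norm (c l)) F"
proof -
  have "(\<Sum>j<M. (norm (\<Sum>l\<in>F. wave a b l (grid a b M j) *s c l))\<^sup>2)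
      = (\<Sum>j<M. \<Sum>k\<in>F. \<Sum>l\<in>F. (wave a b (l - k) (grid a b M j) *s c l) \<bullet> c k)"
    by (simp only: norm_wave_sum_square)
  also have "\<dots> = (\<Sum>k\<in>F. \<Sum>l\<in>F. \<Sum>j<M. (wave a b (l - k) (grid a b M j) *s c l) \<bullet> c k)"
    by (subst sum.swap, intro sum.cong refl, rule sum.swap)
  also have "\<dots> = (\<Sum>k\<in>F. \<Sum>l\<in>F. if l = k then real M * (norm (c k))\<^sup>2 else 0)"
  proof (intro sum.cong refl)
    fix k l assume kl: "k \<in> F" "l \<in> F"
    have "(\<Sum>j<M. (wave a b (l - k) (grid a b M j) *s c l) \<bullet> c k)
        = ((\<Sum>j<M. wave a b (l - k) (grid a b M j)) *s c l) \<bullet> c k"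
      by (simp only: inner_sum_left bounded_bilinear.sum_left[OF bounded_bilinear_vector_scale])
    also have "\<dots> = (if l = k then real M * (norm (c k))\<^sup>2 else 0)"
    proof (cases "l = k")
      case True
      moreover have "of_nat M *s c k = real M *\<^sub>R c k"
        by (simp add: scaleR_eq_vector_scale)
      ultimately show ?thesis
        by (simp add: sum_wave_grid[OF assms(1,2)] power2_norm_eq_inner)
    next
      case False
      then show ?thesis
        using F[OF kl] by (auto simp: sum_wave_grid[OF assms(1,2)])
    qed
    finally show "(\<Sum>j<M. (wave a b (l - k) (grid a b M j) *s c l) \<bullet> c k)
      = (if l = k then real M * (norm (c k))\<^sup>2 else 0)" .
  qed
  also have "\<dots> = real M * (\<Sum>l\<in>F. (norm (c l))\<^sup>2)"
    using assms(3) by (simp add: sum_distrib_left)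
  finally have "(grid_norm M (\<lambda>j. \<Sum>l\<in>F. wave a b l (grid a b M j) *s c l))\<^sup>2 = (L2_set (\<lambda>l. norm (c l)) F)\<^sup>2"
    using assms(2) by (simp add: grid_norm_square L2_set_def sum_nonneg)
  then show ?thesis by (simp add: power2_eq_iff_nonneg)
qed

lemma dvd_diff_small:
  fixes k l :: int
  assumes "int M dvd l - k" "\<bar>l - k\<bar> < int M"
  shows "l = k"
  using assms by (metis dvd_imp_le_int linorder_not_le abs_of_nat eq_iff_diff_eq_0)

lemma modes_eq_window: "even M \<Longrightarrow> modes M = window M 0"
  by (auto simp: modes_def window_def zdiv_int)

lemma finite_modes [simp]: "finite (modes M)"
  by (simp add: modes_def)

lemma modes_parseval:
  fixes c :: "int \<Rightarrow> complex ^ 'n"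
  assumes "a < b" "M > 0" "even M"
  shows "grid_norm M (\<lambda>j. \<Sum>l\<in>modes M. wave a b l (grid a b M j) *s c l) = L2_set (\<lambda>l. norm (c l)) (modes M)"
  by (rule discrete_parseval[OF assms(1,2) finite_modes], erule dvd_diff_small)
    (use assms in \<open>auto simp: modes_def abs_less_iff elim!: evenE\<close>)

lemma dft_eq:
  "dft a b M U l = (1 / of_nat M) *s (\<Sum>j<M. wave a b (- l) (grid a b M j) *s U j)"
  by (simp add: dft_def wave_def cis_conv_exp freq_def)

lemma dft_synthesis:
  fixes c :: "int \<Rightarrow> complex ^ 2"
  assumes "a < b" "M > 0" "even M" "l \<in> modes M"
  shows "dft a b M (\<lambda>j. \<Sum>k\<in>modes M. wave a b k (grid a b M j) *s c k) l = c l"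
proof -
  have "(\<Sum>j<M. wave a b (- l) (grid a b M j) *s (\<Sum>k\<in>modes M. wave a b k (grid a b M j) *s c k))
      = (\<Sum>j<M. \<Sum>k\<in>modes M. wave a b (k - l) (grid a b M j) *s c k)"
    using wave_add[of a b "- l"]
    by (simp add: vector_scale_sum vector_smult_assoc)
  also have "\<dots> = (\<Sum>k\<in>modes M. (\<Sum>j<M. wave a b (k - l) (grid a b M j)) *s c k)"
    by (subst sum.swap) (simp only: bounded_bilinear.sum_left[OF bounded_bilinear_vector_scale])
  also have "\<dots> = (\<Sum>k\<in>modes M. if k = l then of_nat M *s c l else 0)"
  proof (intro sum.cong refl)
    fix k assume "k \<in> modes M"
    then have "int M dvd k - l \<Longrightarrow> k = l"
      using assms by (intro dvd_diff_small) (auto simp: modes_def abs_less_iff elim!: evenE)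
    then show "(\<Sum>j<M. wave a b (k - l) (grid a b M j)) *s c k = (if k = l then of_nat M *s c l else 0)"
      by (auto simp: sum_wave_grid[OF assms(1,2)])
  qed
  finally show ?thesis
    using assms by (simp add: dft_eq vector_smult_assoc)
qed

lemma sum_modes_wave_grid:
  assumes "a < b" "M > 0" "even M" "i < M" "j < M"
  shows "(\<Sum>l\<in>modes M. wave a b l (grid a b M i) * wave a b (- l) (grid a b M j))
    = (if i = j then of_nat M else 0)"
proof -
  define q where "q = int i - int j"
  define r where "r = cis (2 * pi * of_int q / real M)"
  have "wave a b l (grid a b M i) * wave a b (- l) (grid a b M j) = cis (of_int l * (2 * pi * of_int q / real M))" for l
  proof -
    have "freq a b k * (grid a b M n - a) = of_int k * (2 * pi * real n / real M)" for k n
      using assms(1) by (simp add: freq_def grid_def mesh_def)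
    then have "freq a b l * (grid a b M i - a) + freq a b (- l) * (grid a b M j - a)
        = of_int l * (2 * pi * of_int q / real M)"
      by (simp add: q_def right_diff_distrib diff_divide_distrib)
    then show ?thesis by (simp add: wave_def cis_mult)
  qed
  \<comment> \<open>Shifting the modes to 0..M-1 leaves a constant phase times a geometric sum over
    a root of unity.\<close>
  moreover have "modes M = (\<lambda>n. int n - int (M div 2)) ` {..<M}"
  proof -
    have "l \<in> (\<lambda>n. int n - int (M div 2)) ` {..<M}" if "l \<in> modes M" for l
      by (rule image_eqI[of _ _ "nat (l + int (M div 2))"])
        (use that assms(3) in \<open>auto simp: modes_def elim!: evenE\<close>)
    then show ?thesis using assms(3) by (auto simp: modes_def elim!: evenE)
  qed
  ultimately have "(\<Sum>l\<in>modes M. wave a b l (grid a b M i) * wave a b (- l) (grid a b M j))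
      = (\<Sum>n<M. cis (of_int (int n - int (M div 2)) * (2 * pi * of_int q / real M)))"
    by (simp add: sum.reindex inj_on_def)
  also have "\<dots> = (\<Sum>n<M. cis (- (real (M div 2) * (2 * pi * of_int q / real M))) * r ^ n)"
    unfolding r_def Complex.DeMoivre cis_mult by (intro sum.cong refl arg_cong[where f = cis]) (simp add: algebra_simps diff_divide_distrib)
  also have "\<dots> = cis (- (real (M div 2) * (2 * pi * of_int q / real M))) * (if int M dvd q then of_nat M else 0)"
    unfolding r_def by (simp add: sum_roots_of_unity[OF assms(2)] flip: sum_distrib_left)
  also have "int M dvd q \<longleftrightarrow> i = j"
    using dvd_diff_small[of M "int i" "int j"] assms(4,5) by (auto simp: q_def)
  finally show ?thesis by (auto simp: q_def)
qed

lemma dft_inversion: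
  assumes "a < b" "M > 0" "even M" "i < M"
  shows "(\<Sum>l\<in>modes M. wave a b l (grid a b M i) *s dft a b M U l) = U i"
proof -
  have "(\<Sum>l\<in>modes M. wave a b l (grid a b M i) *s dft a b M U l)
      = (\<Sum>l\<in>modes M. \<Sum>j<M. (wave a b l (grid a b M i) * wave a b (- l) (grid a b M j)) *s ((1 / of_nat M) *s U j))"
    by (simp add: dft_eq vector_scale_sum vector_smult_assoc mult_ac)
  also have "\<dots> = (\<Sum>j<M. (\<Sum>l\<in>modes M. wave a b l (grid a b M i) * wave a b (- l) (grid a b M j)) *s ((1 / of_nat M) *s U j))"
    by (subst sum.swap) (simp only: bounded_bilinear.sum_left[OF bounded_bilinear_vector_scale])
  also have "\<dots> = (\<Sum>j<M. if i = j then of_nat M *s ((1 / of_nat M) *s U i) else 0)"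
    using assms(4) by (intro sum.cong refl) (auto simp: sum_modes_wave_grid[OF assms(1-3)])
  also have "\<dots> = U i" using assms by (simp add: vector_smult_assoc)
  finally show ?thesis .
qed

lemma grid_norm_dft:
  assumes "a < b" "M > 0" "even M"
  shows "grid_norm M U = L2_set (\<lambda>l. norm (dft a b M U l)) (modes M)"
  unfolding modes_parseval[OF assms, symmetric]
  by (rule grid_norm_cong) (simp add: dft_inversion[OF assms])

section \<open>Blocks of modes and the aliasing tail\<close>

definition mode_block :: "nat \<Rightarrow> int \<Rightarrow> int set" where
  "mode_block M p = {p * int M - int (M div 2)..<p * int M + int (M div 2)}"

lemma finite_mode_block [simp]: "finite (mode_block M p)"
  by (simp add: mode_block_def)

lemma mesh_mult_freq: "a < b \<Longrightarrow> mesh a b M * \<bar>freq a b l\<bar> = 2 * pi * \<bar>of_int l\<bar> / real M"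
  by (simp add: mesh_def freq_def abs_mult)

text \<open>In block \<open>p\<close> one has |l| \<ge> |p| M - M/2 \<ge> |p| M/2, and h |\<mu>_l| =
  2 pi |l| / M.\<close>

lemma freq_mode_block:
  assumes "a < b" "M > 0" "even M" "p \<noteq> 0" "l \<in> mode_block M p"
  shows "\<bar>of_int p\<bar> \<le> mesh a b M * \<bar>freq a b l\<bar>"
proof -
  have "\<bar>p\<bar> * int M \<le> 2 * \<bar>l\<bar>"
  proof -
    obtain K where K: "M = 2 * K" using assms(3) by blast
    have "p * (2 * int K) - int K \<le> l" "l \<le> p * (2 * int K) + int K"
      using assms(5) by (auto simp: mode_block_def K)
    moreover have "int K \<le> \<bar>p\<bar> * int K" using assms(4) mult_right_mono[of 1 "\<bar>p\<bar>" "int K"] by simp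
    ultimately show ?thesis
      unfolding K by (cases "p > 0") (auto simp: abs_if algebra_simps split: if_splits)
  qed
  then have "\<bar>of_int p\<bar> * real M \<le> 2 * \<bar>of_int l\<bar>"
    by (metis (mono_tags, lifting) of_int_abs of_int_le_iff of_int_mult of_int_numeral of_int_of_nat_eq)
  also have "\<dots> \<le> 2 * pi * \<bar>of_int l\<bar>"
    using pi_ge_two by (intro mult_right_mono) auto
  finally show ?thesis
    using assms(2) by (simp add: mesh_mult_freq[OF assms(1)] field_simps)
qed

text \<open>Each frequency of the block is at least |p|/h, so \<open>k\<close> derivatives are
  exchanged for k powers of h/|p|.\<close>

lemma L2_set_mode_block_le:
  fixes c :: "int \<Rightarrow> complex ^ 'n"
  assumes "a < b" "M > 0" "even M" "p \<noteq> 0"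
    and S: "\<And>F. finite F \<Longrightarrow> L2_set (\<lambda>l. \<bar>freq a b l\<bar> ^ k * norm (c l)) F \<le> S"
  shows "L2_set (\<lambda>l. norm (c l)) (mode_block M p) \<le> (mesh a b M / \<bar>of_int p\<bar>) ^ k * S"
proof -
  have h: "mesh a b M > 0" using assms(1,2) by (simp add: mesh_def)
  have "L2_set (\<lambda>l. norm (c l)) (mode_block M p)
      \<le> L2_set (\<lambda>l. (mesh a b M / \<bar>of_int p\<bar>) ^ k * (\<bar>freq a b l\<bar> ^ k * norm (c l))) (mode_block M p)"
  proof (rule L2_set_mono)
    fix l assume "l \<in> mode_block M p"
    then have "1 \<le> mesh a b M / \<bar>of_int p\<bar> * \<bar>freq a b l\<bar>"
      using freq_mode_block[OF assms(1-4)] assms(4) by (simp add: field_simps)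
    then have "1 \<le> (mesh a b M / \<bar>of_int p\<bar> * \<bar>freq a b l\<bar>) ^ k" by simp
    from mult_right_mono[OF this norm_ge_zero[of "c l"]]
    show "norm (c l) \<le> (mesh a b M / \<bar>of_int p\<bar>) ^ k * (\<bar>freq a b l\<bar> ^ k * norm (c l))"
      by (simp only: power_mult_distrib mult.assoc mult_1)
  qed simp
  also have "\<dots> = (mesh a b M / \<bar>of_int p\<bar>) ^ k * L2_set (\<lambda>l. \<bar>freq a b l\<bar> ^ k * norm (c l)) (mode_block M p)"
    using h by (intro L2_set_right_distrib[symmetric]) auto
  also have "\<dots> \<le> (mesh a b M / \<bar>of_int p\<bar>) ^ k * S"
    using h S[OF finite_mode_block] by (intro mult_left_mono) auto
  finally show ?thesis .
qed

lemma grid_norm_mode_block: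
  fixes c :: "int \<Rightarrow> complex ^ 'n"
  assumes "a < b" "M > 0" "even M"
  shows "grid_norm M (\<lambda>j. \<Sum>l\<in>mode_block M p. wave a b l (grid a b M j) *s c l)
    = L2_set (\<lambda>l. norm (c l)) (mode_block M p)"
  by (rule discrete_parseval[OF assms(1,2) finite_mode_block], erule dvd_diff_small)
    (use assms in \<open>auto simp: mode_block_def abs_less_iff elim!: evenE\<close>)

lemma window_Suc:
  assumes "M > 0" "even M"
  shows "window M (Suc P) = window M P \<union> (mode_block M (int (Suc P)) \<union> mode_block M (- int (Suc P)))"
    and "window M P \<inter> (mode_block M (int (Suc P)) \<union> mode_block M (- int (Suc P))) = {}"
    and "mode_block M (int (Suc P)) \<inter> mode_block M (- int (Suc P)) = {}"
proof -
  obtain K where K: "M = 2 * K" "K > 0" using assms by auto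
  define n where "n = int P * int K"
  have n: "n \<ge> 0" by (simp add: n_def)
  have w: "window M P = {- (2 * n + int K)..<2 * n + int K}"
      "window M (Suc P) = {- (2 * n + 3 * int K)..<2 * n + 3 * int K}"
      "mode_block M (int (Suc P)) = {2 * n + int K..<2 * n + 3 * int K}"
      "mode_block M (- int (Suc P)) = {- (2 * n + 3 * int K)..<- (2 * n + int K)}"
    by (auto simp: window_def mode_block_def K n_def algebra_simps)
  show "window M (Suc P) = window M P \<union> (mode_block M (int (Suc P)) \<union> mode_block M (- int (Suc P)))"
    "window M P \<inter> (mode_block M (int (Suc P)) \<union> mode_block M (- int (Suc P))) = {}"
    "mode_block M (int (Suc P)) \<inter> mode_block M (- int (Suc P)) = {}"
    unfolding w using n K(2) by auto
qed

text \<open>A block of \<open>M\<close> consecutive modes is orthogonal on the grid.  Splitting the tail into blocks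
  keeps the full power of the mesh size; a bound by the sum of the moduli of the coefficients
  would lose the factor \<open>sqrt h\<close>.\<close>

lemma grid_norm_tail_partial:
  fixes c :: "int \<Rightarrow> complex ^ 'n"
  assumes "a < b" "M > 0" "even M" "k \<ge> 2"
    and S: "\<And>F. finite F \<Longrightarrow> L2_set (\<lambda>l. \<bar>freq a b l\<bar> ^ k * norm (c l)) F \<le> S"
  shows "grid_norm M (\<lambda>j. (\<Sum>l\<in>window M P. wave a b l (grid a b M j) *s c l)
      - (\<Sum>l\<in>modes M. wave a b l (grid a b M j) *s c l))
    \<le> 2 * mesh a b M ^ k * S * (\<Sum>p = 1..P. 1 / real p ^ 2)"
proof (induction P)
  case 0
  then show ?case by (simp add: modes_eq_window[OF assms(3)])
next
  case (Suc P)
  let ?s = "\<lambda>F j. \<Sum>l\<in>F. wave a b l (grid a b M j) *s c l"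
  let ?B = "mode_block M (int (Suc P))" and ?B' = "mode_block M (- int (Suc P))"
  have S0: "S \<ge> 0" using S[of "{}"] by simp
  have h: "mesh a b M > 0" using assms(1,2) by (simp add: mesh_def)
  have "?s (window M (Suc P)) j = ?s (window M P) j + (?s ?B j + ?s ?B' j)" for j
    using window_Suc[OF assms(2,3), of P] by (simp add: sum.union_disjoint)
  then have "grid_norm M (\<lambda>j. ?s (window M (Suc P)) j - ?s (modes M) j)
      = grid_norm M (\<lambda>j. (?s (window M P) j - ?s (modes M) j) + (?s ?B j + ?s ?B' j))"
    by (simp add: algebra_simps)
  also have "\<dots> \<le> grid_norm M (\<lambda>j. ?s (window M P) j - ?s (modes M) j) + (grid_norm M (?s ?B) + grid_norm M (?s ?B'))"
    by (intro order_trans[OF grid_norm_add] add_left_mono grid_norm_add)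
  also have "\<dots> \<le> 2 * mesh a b M ^ k * S * (\<Sum>p = 1..P. 1 / real p ^ 2)
      + ((mesh a b M / \<bar>of_int (int (Suc P))\<bar>) ^ k * S + (mesh a b M / \<bar>of_int (- int (Suc P))\<bar>) ^ k * S)"
    unfolding grid_norm_mode_block[OF assms(1-3)]
    by (intro add_mono Suc.IH L2_set_mode_block_le[OF assms(1-3) _ S]) auto
  also have "\<dots> = 2 * mesh a b M ^ k * S * ((\<Sum>p = 1..P. 1 / real p ^ 2) + 1 / real (Suc P) ^ k)"
    by (simp add: power_divide algebra_simps)
  also have "\<dots> \<le> 2 * mesh a b M ^ k * S * (\<Sum>p = 1..Suc P. 1 / real p ^ 2)"
  proof (rule mult_left_mono)
    have "1 / real (Suc P) ^ k \<le> 1 / real (Suc P) ^ 2"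
      using assms(4) by (intro divide_left_mono power_increasing) auto
    then show "(\<Sum>p = 1..P. 1 / real p ^ 2) + 1 / real (Suc P) ^ k \<le> (\<Sum>p = 1..Suc P. 1 / real p ^ 2)"
      by simp
  qed (use S0 h in simp)
  finally show ?case .
qed

text \<open>The limit of the blockwise bounds: one factor 2 for the blocks \<open>p\<close> and
  \<open>- p\<close>, another for the sum of 1/p^2, which is where \<open>k \<ge> 2\<close> is
  needed.\<close>

lemma grid_norm_tail:
  fixes c :: "int \<Rightarrow> complex ^ 'n"
  assumes "a < b" "M > 0" "even M" "k \<ge> 2"
    and S: "\<And>F. finite F \<Longrightarrow> L2_set (\<lambda>l. \<bar>freq a b l\<bar> ^ k * norm (c l)) F \<le> S"
    and c: "(\<lambda>l. norm (c l)) summable_on UNIV"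
  shows "grid_norm M (\<lambda>j. (\<Sum>\<^sub>\<infinity>l. wave a b l (grid a b M j) *s c l)
      - (\<Sum>l\<in>modes M. wave a b l (grid a b M j) *s c l)) \<le> 4 * mesh a b M ^ k * S"
proof (rule grid_norm_tendsto)
  fix j
  show "(\<lambda>P. (\<Sum>l\<in>window M P. wave a b l (grid a b M j) *s c l) - (\<Sum>l\<in>modes M. wave a b l (grid a b M j) *s c l))
    \<longlonglongrightarrow> (\<Sum>\<^sub>\<infinity>l. wave a b l (grid a b M j) *s c l) - (\<Sum>l\<in>modes M. wave a b l (grid a b M j) *s c l)"
    by (intro tendsto_intros tendsto_uniform_limitI[OF wave_series_uniform_limit[OF assms(2) c, where A = UNIV]]) simp
next
  fix P
  have S0: "S \<ge> 0" using S[of "{}"] by simp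
  have h: "mesh a b M > 0" using assms(1,2) by (simp add: mesh_def)
  note grid_norm_tail_partial[OF assms(1-4) S, of P]
  also have "2 * mesh a b M ^ k * S * (\<Sum>p = 1..P. 1 / real p ^ 2) \<le> 2 * mesh a b M ^ k * S * 2"
    using S0 h sum_inverse_squares_le[of P] by (intro mult_left_mono) (auto intro: order_trans)
  finally show "grid_norm M (\<lambda>j. (\<Sum>l\<in>window M P. wave a b l (grid a b M j) *s c l)
      - (\<Sum>l\<in>modes M. wave a b l (grid a b M j) *s c l)) \<le> 4 * mesh a b M ^ k * S"
    by simp
qed

text \<open>Truncation as opposed to aliasing: outside the modes |l| \<ge> M/2, hence h |\<mu>_l|
  \<ge> pi. No blocks are needed, as different frequencies are orthogonal on the whole
  interval.\<close>

lemma L2_set_tail_le: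
  fixes c :: "int \<Rightarrow> complex ^ 'n"
  assumes "a < b" "M > 0" "even M" "finite F" "F \<inter> modes M = {}"
    and S: "\<And>F. finite F \<Longrightarrow> L2_set (\<lambda>l. \<bar>freq a b l\<bar> ^ k * norm (c l)) F \<le> S"
  shows "L2_set (\<lambda>l. norm (c l)) F \<le> mesh a b M ^ k * S"
proof -
  have h: "mesh a b M > 0" using assms(1,2) by (simp add: mesh_def)
  have "L2_set (\<lambda>l. norm (c l)) F \<le> L2_set (\<lambda>l. mesh a b M ^ k * (\<bar>freq a b l\<bar> ^ k * norm (c l))) F"
  proof (rule L2_set_mono)
    fix l assume "l \<in> F"
    then have "l \<notin> modes M" using assms(5) by blast
    then have "int M \<le> 2 * \<bar>l\<bar>" using assms(3) by (auto simp: modes_def abs_if elim!: evenE)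
    then have "real M \<le> 2 * \<bar>of_int l\<bar>"
      by (metis (mono_tags, lifting) of_int_abs of_int_le_iff of_int_mult of_int_numeral of_int_of_nat_eq)
    also have "\<dots> \<le> 2 * pi * \<bar>of_int l\<bar>"
      using pi_ge_two by (intro mult_right_mono) auto
    finally have "1 \<le> mesh a b M * \<bar>freq a b l\<bar>"
      using assms(2) by (simp add: mesh_mult_freq[OF assms(1)] field_simps)
    then have "1 \<le> (mesh a b M * \<bar>freq a b l\<bar>) ^ k" by simp
    from mult_right_mono[OF this norm_ge_zero[of "c l"]]
    show "norm (c l) \<le> mesh a b M ^ k * (\<bar>freq a b l\<bar> ^ k * norm (c l))"
      by (simp add: power_mult_distrib mult.assoc)
  qed simp
  also have "\<dots> = mesh a b M ^ k * L2_set (\<lambda>l. \<bar>freq a b l\<bar> ^ k * norm (c l)) F"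
    using h by (intro L2_set_right_distrib[symmetric]) auto
  also have "\<dots> \<le> mesh a b M ^ k * S"
    using h S[OF assms(4)] by (intro mult_left_mono) auto
  finally show ?thesis .
qed

section \<open>The matrix exponential\<close>

lemma scale_mat_of_real: "of_real t *m A = t *\<^sub>R A"
  by (simp add: scale_mat_def vec_eq_iff scaleR_conv_of_real[where 'a = complex])

lemma scale_mat_vector: "(c *m A) *v v = c *s (A *v v)"
  by (simp add: scale_mat_def matrix_vector_mult_def vec_eq_iff sum_distrib_left mult.assoc)

lemma bounded_linear_matrix_vector_mult: "bounded_linear ((*v) (A :: complex^2^2))"
  by (intro linear_conv_bounded_linear[THEN iffD1] linearI)
    (simp_all add: vec_eq_iff matrix_vector_mult_def scaleR_sum_right distrib_left sum.distrib)

lemma matrix_vector_scaleR: "(t *\<^sub>R A) *v v = t *\<^sub>R ((A :: complex^2^2) *v v)"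
  by (simp add: vec_eq_iff matrix_vector_mult_def scaleR_sum_right)

lemma matrix_power_vector: "((((**) A) ^^ n) (mat 1)) *v v = (((*v) (A :: complex^2^2)) ^^ n) v"
  by (induction n) (simp_all flip: matrix_vector_mul_assoc)

lemma mat_exp_sums: "(\<lambda>n. (1 / fact n) *\<^sub>R (((*v) A) ^^ n) v) sums (mat_exp A *v v)"
proof -
  have "linear (\<lambda>X :: complex^2^2. A ** X)"
    by (rule linearI)
      (simp_all add: vec_eq_iff matrix_matrix_mult_def scaleR_sum_right distrib_left sum.distrib)
  then obtain K where K: "K > 0" "\<And>X :: complex^2^2. norm (A ** X) \<le> K * norm X"
    using linear_bounded_pos by blast
  define P where "P n = (((**) A) ^^ n) (mat 1)" for n
  have P: "norm (P n) \<le> K ^ n * norm (mat 1 :: complex^2^2)" for n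
  proof (induction n)
    case (Suc n)
    have "norm (P (Suc n)) \<le> K * norm (P n)" using K(2)[of "P n"] by (simp add: P_def)
    also have "\<dots> \<le> K * (K ^ n * norm (mat 1 :: complex^2^2))" using Suc K by (intro mult_left_mono) auto
    finally show ?case by simp
  qed (simp add: P_def)
  have "summable (\<lambda>n. (1 / fact n) *\<^sub>R P n)"
  proof (rule summable_comparison_test')
    show "summable (\<lambda>n. inverse (fact n) * K ^ n * norm (mat 1 :: complex^2^2))"
      by (intro summable_mult2 summable_exp)
    show "norm ((1 / fact n) *\<^sub>R P n) \<le> inverse (fact n) * K ^ n * norm (mat 1 :: complex^2^2)" for n
      using P[of n] by (simp add: field_simps)
  qed
  then have "(\<lambda>n. (1 / fact n) *\<^sub>R P n) sums mat_exp A"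
    by (simp add: mat_exp_def P_def summable_sums)
  moreover have "bounded_linear (\<lambda>X :: complex^2^2. X *v v)"
    by (intro linear_conv_bounded_linear[THEN iffD1] linearI)
      (simp_all add: matrix_vector_mult_add_rdistrib matrix_vector_scaleR)
  ultimately have "(\<lambda>n. ((1 / fact n) *\<^sub>R P n) *v v) sums (mat_exp A *v v)"
    using bounded_linear.sums by blast
  then show ?thesis by (simp only: matrix_vector_scaleR P_def matrix_power_vector)
qed

lemma mat_exp_scaled_sums:
  "(\<lambda>n. (t ^ n / fact n) *\<^sub>R (((*v) A) ^^ n) v) sums (mat_exp (t *\<^sub>R A) *v v)"
proof -
  have "(((*v) (t *\<^sub>R A)) ^^ n) v = t ^ n *\<^sub>R (((*v) A) ^^ n) v" for n
    by (induction n)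
      (simp_all add: matrix_vector_scaleR linear_cmul[OF bounded_linear.linear[OF bounded_linear_matrix_vector_mult]])
  then show ?thesis using mat_exp_sums[of "t *\<^sub>R A" v] by simp
qed

lemma mat_exp_zero: "mat_exp (0 *\<^sub>R A) *v v = v"
proof (rule sums_unique2[OF mat_exp_scaled_sums])
  have "(\<lambda>n. if n = 0 then v else 0) sums v"
    using sums_single[of 0 "\<lambda>_. v"] by simp
  then show "(\<lambda>n. (0 ^ n / fact n) *\<^sub>R (((*v) A) ^^ n) v) sums v"
    by (rule sums_cong[THEN iffD1, rotated]) auto
qed

lemma mat_exp_commute: "mat_exp (t *\<^sub>R A) *v (A *v v) = A *v (mat_exp (t *\<^sub>R A) *v v)"
proof (rule sums_unique2[OF mat_exp_scaled_sums])
  have "(\<lambda>n. A *v ((t ^ n / fact n) *\<^sub>R (((*v) A) ^^ n) v)) sums (A *v (mat_exp (t *\<^sub>R A) *v v))"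
    by (rule bounded_linear.sums[OF bounded_linear_matrix_vector_mult mat_exp_scaled_sums])
  then show "(\<lambda>n. (t ^ n / fact n) *\<^sub>R (((*v) A) ^^ n) (A *v v)) sums (A *v (mat_exp (t *\<^sub>R A) *v v))"
    by (simp add: linear_cmul[OF bounded_linear.linear[OF bounded_linear_matrix_vector_mult]] funpow_swap1)
qed

text \<open>Pairing with each basis vector leaves a real power series in \<open>t\<close> that
  converges everywhere and may be differentiated termwise.\<close>

lemma mat_exp_has_vector_derivative:
  "((\<lambda>t. mat_exp (t *\<^sub>R A) *v v) has_vector_derivative mat_exp (t *\<^sub>R A) *v (A *v v)) (at t)"
  unfolding has_vector_derivative_def
proof (subst has_derivative_componentwise_within, rule ballI)
  fix w :: "complex^2"
  define c where "c n = (((*v) A) ^^ n) v \<bullet> w / fact n" for n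
  have series: "(\<lambda>n. ((((*v) A) ^^ n) u \<bullet> w / fact n) * t ^ n) sums ((mat_exp (t *\<^sub>R A) *v u) \<bullet> w)" for t u
    using bounded_linear.sums[OF bounded_linear_inner_left[of w] mat_exp_scaled_sums[of t A u]]
    by (simp add: mult.commute)
  have "((\<lambda>t. \<Sum>n. c n * t ^ n) has_field_derivative (\<Sum>n. diffs c n * t ^ n)) (at t)"
    by (rule termdiffs_strong_converges_everywhere) (use series[of v] in \<open>auto simp: c_def sums_iff\<close>)
  moreover have "(\<Sum>n. c n * t ^ n) = (mat_exp (t *\<^sub>R A) *v v) \<bullet> w" for t
    using series[of v t] by (simp add: c_def sums_iff)
  moreover have "diffs c n = (((*v) A) ^^ n) (A *v v) \<bullet> w / fact n" for n
  proof -
    have "of_nat (Suc n) / fact (Suc n) = (1 / fact n :: real)"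
      by (simp add: field_simps del: of_nat_Suc)
    then show ?thesis
      by (simp add: diffs_def c_def funpow_swap1 field_simps del: of_nat_Suc fact_Suc)
  qed
  then have "(\<Sum>n. diffs c n * t ^ n) = (mat_exp (t *\<^sub>R A) *v (A *v v)) \<bullet> w"
    using series[of "A *v v" t] by (simp add: sums_iff)
  ultimately have "((\<lambda>t. (mat_exp (t *\<^sub>R A) *v v) \<bullet> w) has_field_derivative
      (mat_exp (t *\<^sub>R A) *v (A *v v)) \<bullet> w) (at t)"
    by simp
  then show "((\<lambda>t. (mat_exp (t *\<^sub>R A) *v v) \<bullet> w) has_derivative
      (\<lambda>h. (h *\<^sub>R (mat_exp (t *\<^sub>R A) *v (A *v v))) \<bullet> w)) (at t)"
    unfolding has_field_derivative_def
    by (rule back_subst[of "\<lambda>g. (_ has_derivative g) (at t)"]) (simp add: fun_eq_iff)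
qed

section \<open>Taylor bounds and exponentials of skew matrices\<close>

lemma norm_diff_le_vector_derivative:
  fixes y :: "real \<Rightarrow> 'v::real_normed_vector"
  assumes "\<And>s. s \<in> {p..q} \<Longrightarrow> (y has_vector_derivative y' s) (at s within {p..q})"
    and "\<And>s. s \<in> {p..q} \<Longrightarrow> norm (y' s) \<le> c" and "r \<in> {p..q}"
  shows "norm (y r - y p) \<le> c * (r - p)"
proof -
  have "norm (y r - y p) \<le> c * norm (r - p)"
  proof (rule differentiable_bound[OF convex_real_interval(5)])
    show "(y has_derivative (\<lambda>h. h *\<^sub>R y' s)) (at s within {p..q})" if "s \<in> {p..q}" for s
      using assms(1)[OF that] by (simp add: has_vector_derivative_def)
    show "onorm (\<lambda>h. h *\<^sub>R y' s) \<le> c" if "s \<in> {p..q}" for s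
      using assms(2)[OF that] order_trans[OF norm_ge_zero assms(2)[OF that]]
      by (intro onorm_bound) (auto simp: mult.commute[of c] mult_left_mono)
  qed (use assms(3) in auto)
  then show ?thesis using assms(3) by simp
qed

text \<open>The mean value inequality applied twice; it gives \<open>c\<close> where Taylor's
  formula has c/2, which only enlarges the final constant. Derivatives within the interval suffice,
  as needed at the ends of the time interval.\<close>

lemma taylor_second_order:
  fixes y :: "real \<Rightarrow> 'v::real_normed_vector"
  assumes y: "\<And>s. s \<in> {p..q} \<Longrightarrow> (y has_vector_derivative y1 s) (at s within {p..q})"
    and y1: "\<And>s. s \<in> {p..q} \<Longrightarrow> (y1 has_vector_derivative y2 s) (at s within {p..q})"
    and c: "\<And>s. s \<in> {p..q} \<Longrightarrow> norm (y2 s) \<le> c" and "p \<le> q"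
  shows "norm (y q - y p - (q - p) *\<^sub>R y1 p) \<le> c * (q - p)\<^sup>2"
proof -
  have c0: "c \<ge> 0" using order_trans[OF norm_ge_zero c[of p]] \<open>p \<le> q\<close> by simp
  have "norm ((y q - q *\<^sub>R y1 p) - (y p - p *\<^sub>R y1 p)) \<le> (c * (q - p)) * (q - p)"
  proof (rule norm_diff_le_vector_derivative)
    fix s assume s: "s \<in> {p..q}"
    show "((\<lambda>s. y s - s *\<^sub>R y1 p) has_vector_derivative y1 s - y1 p) (at s within {p..q})"
      using y[OF s] by (auto intro!: derivative_eq_intros)
    have "norm (y1 s - y1 p) \<le> c * (s - p)"
      by (rule norm_diff_le_vector_derivative[OF y1 c s])
    also have "\<dots> \<le> c * (q - p)" using s c0 by (intro mult_left_mono) auto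
    finally show "norm (y1 s - y1 p) \<le> c * (q - p)" .
  qed (use \<open>p \<le> q\<close> in auto)
  then show ?thesis by (simp add: algebra_simps power2_eq_square)
qed

text \<open>The inner product is the real one, so the hypothesis says that \<open>A\<close> is skew;
  then the squared norm of the orbit has derivative 0.\<close>

lemma mat_exp_isometry:
  assumes "\<And>v. (A *v v) \<bullet> v = 0"
  shows "norm (mat_exp (t *\<^sub>R A) *v v) = norm v"
proof -
  let ?y = "\<lambda>t. mat_exp (t *\<^sub>R A) *v v"
  have "((\<lambda>t. ?y t \<bullet> ?y t) has_field_derivative 0) (at t)" for t
  proof -
    have "((\<lambda>t. ?y t \<bullet> ?y t) has_vector_derivative ?y t \<bullet> (A *v ?y t) + (A *v ?y t) \<bullet> ?y t) (at t)"
      using mat_exp_has_vector_derivative[of A v t]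
      unfolding mat_exp_commute
      by (intro bounded_bilinear.has_vector_derivative[OF bounded_bilinear_inner])
    then show ?thesis
      using assms[of "?y t"] by (simp add: inner_commute has_real_derivative_iff_has_vector_derivative)
  qed
  then have "?y t \<bullet> ?y t = ?y 0 \<bullet> ?y 0" by (intro DERIV_isconst_all) auto
  then show ?thesis using mat_exp_zero[of A v] by (simp add: norm_eq_sqrt_inner)
qed

lemma mat_exp_first_order:
  assumes "\<And>v. (A *v v) \<bullet> v = 0" "t \<ge> 0"
  shows "norm (mat_exp (t *\<^sub>R A) *v v - v) \<le> t * norm (A *v v)"
  using norm_diff_le_vector_derivative[of 0 t "\<lambda>t. mat_exp (t *\<^sub>R A) *v v" "\<lambda>t. mat_exp (t *\<^sub>R A) *v (A *v v)"
      "norm (A *v v)" t] mat_exp_zero[of A v] assms(2)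
  by (simp add: mat_exp_isometry[OF assms(1)] has_vector_derivative_at_within[OF mat_exp_has_vector_derivative] mult.commute)

text \<open>The second derivative of the orbit is the exponential applied to
  \<open>A *v (A *v v)\<close>; by isometry its norm is constant in time, so no factor exponential
  in t/\<epsilon> arises.\<close>

lemma mat_exp_second_order:
  assumes "\<And>v. (A *v v) \<bullet> v = 0" "t \<ge> 0"
  shows "norm (mat_exp (t *\<^sub>R A) *v v - v - t *\<^sub>R (A *v v)) \<le> t\<^sup>2 * norm (A *v (A *v v))"
  using taylor_second_order[of 0 t "\<lambda>t. mat_exp (t *\<^sub>R A) *v v" "\<lambda>t. mat_exp (t *\<^sub>R A) *v (A *v v)"
      "\<lambda>t. mat_exp (t *\<^sub>R A) *v (A *v (A *v v))" "norm (A *v (A *v v))"]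
    mat_exp_zero[of A v] mat_exp_zero[of A "A *v v"] assms(2)
  by (simp add: mat_exp_isometry[OF assms(1)] has_vector_derivative_at_within[OF mat_exp_has_vector_derivative] mult.commute)

section \<open>Sobolev and time regularity\<close>

lemma test_function_deriv:
  assumes "test_function a b \<phi>"
  shows "test_function a b (deriv \<phi>)"
proof -
  have "deriv \<phi> x = 0" if "x \<notin> closure {x. \<phi> x \<noteq> 0}" for x
  proof (rule DERIV_imp_deriv)
    show "(\<phi> has_field_derivative 0) (at x)"
      by (rule has_field_derivative_transform_within_open[where f = "\<lambda>_. 0" and S = "- closure {x. \<phi> x \<noteq> 0}"])
        (use that closure_subset[of "{x. \<phi> x \<noteq> 0}"] in auto)
  qed
  then have "closure {x. deriv \<phi> x \<noteq> 0} \<subseteq> closure {x. \<phi> x \<noteq> 0}"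
    by (intro closure_minimal) auto
  moreover from this have "compact (closure {x. deriv \<phi> x \<noteq> 0})"
    using assms unfolding test_function_def
    by (metis closed_closure closed_Int_compact inf.absorb_iff1)
  moreover have "(deriv ^^ k) (deriv \<phi>) field_differentiable at x" for k x
    using assms unfolding test_function_def by (metis comp_apply funpow_Suc_right)
  ultimately show ?thesis
    using assms unfolding test_function_def by blast
qed

text \<open>If \<phi> is a test function, so is its derivative; testing the order-k identity with
  the latter links two consecutive orders. This permits induction on the order.\<close>

lemma has_weak_deriv_step:
  assumes "has_weak_deriv a b k f u" "has_weak_deriv a b (Suc k) f v"
  shows "has_weak_deriv a b 1 u v"
  unfolding has_weak_deriv_def
proof (intro conjI allI impI)
  fix \<phi> assume \<phi>: "test_function a b \<phi>"
  have "(-1) ^ k *\<^sub>R (LINT x:{a<..<b}|lebesgue. deriv \<phi> x *\<^sub>R u x)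
      = (LINT x:{a<..<b}|lebesgue. (deriv ^^ k) (deriv \<phi>) x *\<^sub>R f x)"
    using assms(1) test_function_deriv[OF \<phi>] unfolding has_weak_deriv_def by simp
  also have "\<dots> = (-1) ^ Suc k *\<^sub>R (LINT x:{a<..<b}|lebesgue. \<phi> x *\<^sub>R v x)"
  proof -
    have "(deriv ^^ k) (deriv \<phi>) = (deriv ^^ Suc k) \<phi>"
      by (simp only: funpow_Suc_right comp_apply)
    then show ?thesis using assms(2) \<phi> unfolding has_weak_deriv_def by (simp only:)
  qed
  also have "\<dots> = (-1) ^ k *\<^sub>R ((-1) *\<^sub>R (LINT x:{a<..<b}|lebesgue. \<phi> x *\<^sub>R v x))"
    by simp
  finally have "(LINT x:{a<..<b}|lebesgue. deriv \<phi> x *\<^sub>R u x)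
      = (-1) *\<^sub>R (LINT x:{a<..<b}|lebesgue. \<phi> x *\<^sub>R v x)"
    by (rule scaleR_left_imp_eq[rotated]) simp
  then show "(LINT x:{a<..<b}|lebesgue. (deriv ^^ 1) \<phi> x *\<^sub>R u x)
      = (- 1) ^ 1 *\<^sub>R (LINT x:{a<..<b}|lebesgue. \<phi> x *\<^sub>R v x)"
    by simp
qed (use assms in \<open>simp_all add: has_weak_deriv_def\<close>)

text \<open>Below order \<open>m\<close> the space supplies a continuous periodic representative, to
  which integration by parts applies; the last derivative \<open>g\<close> only has to be
  integrable.\<close>

lemma fcoef_weak_deriv:
  fixes f g :: "real \<Rightarrow> complex ^ 'n"
  assumes "a < b" and f: "f \<in> Wminf_per m a b" and "k \<le> m"
    and "has_weak_deriv a b k f g" "integrable (lebesgue_on {a<..<b}) g"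
  shows "fcoef a b g l = (\<i> * of_real (freq a b l)) ^ k *s fcoef a b f l"
  using assms(3-5)
proof (induction k arbitrary: g)
  case 0
  have "continuous_on {a..b} f" using f by (simp add: Wminf_per_def)
  then show ?case
    using fcoef_weak_deriv_0[OF assms(1) 0(2) continuous_integral_open_interval(1) 0(3)] by simp
next
  case (Suc k)
  obtain u where u: "has_weak_deriv a b k f u" "continuous_on {a..b} u" "u a = u b"
    using f Suc.prems(1) unfolding Wminf_per_def mem_Collect_eq by (meson Suc_le_lessD)
  show ?case
    using fcoef_weak_deriv_1[OF assms(1) has_weak_deriv_step[OF u(1) Suc.prems(2)] u(2,3) Suc.prems(3)]
      Suc.IH[OF _ u(1) continuous_integral_open_interval(1)[OF u(2)]] Suc.prems(1)
    by (simp add: vector_smult_assoc)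
qed

section \<open>From essential suprema to bounds at every point and time\<close>

lemma weak_derivI: "has_weak_deriv a b k f g \<Longrightarrow> has_weak_deriv a b k f (weak_deriv a b k f)"
  unfolding weak_deriv_def by (rule someI[of "has_weak_deriv a b k f"])

lemma loc_integrable_measurable:
  fixes g :: "real \<Rightarrow> 'v::euclidean_space"
  assumes "loc_integrable a b g"
  shows "g \<in> borel_measurable (lebesgue_on {a<..<b})"
proof (subst borel_measurable_restrict_space_iff)
  define G where "G n x = indicat_real {a + 1 / real n..b - 1 / real n} x *\<^sub>R g x" for n x
  show "(\<lambda>x. indicat_real {a<..<b} x *\<^sub>R g x) \<in> borel_measurable lebesgue"
  proof (rule borel_measurable_LIMSEQ_metric)
    fix n
    \<comment> \<open>The successor matters: for index 0 the default 1 / 0 = 0 would give all of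
      [a,b], where local integrability says nothing.\<close>
    have "set_integrable lebesgue {a + 1 / real (Suc n)..b - 1 / real (Suc n)} g"
      using assms unfolding loc_integrable_def by simp
    then show "G (Suc n) \<in> borel_measurable lebesgue"
      unfolding set_integrable_def G_def by auto
  next
    fix x
    have lim: "(\<lambda>n. 1 / real (Suc n)) \<longlonglongrightarrow> 0" by (rule LIMSEQ_Suc[OF lim_1_over_n])
    show "(\<lambda>n. G (Suc n) x) \<longlonglongrightarrow> indicat_real {a<..<b} x *\<^sub>R g x"
    proof (rule Lim_transform_eventually[OF tendsto_const])
      show "\<forall>\<^sub>F n in sequentially. indicat_real {a<..<b} x *\<^sub>R g x = G (Suc n) x"
      proof (cases "x \<in> {a<..<b}")
        case True
        then have "\<forall>\<^sub>F n in sequentially. 1 / real (Suc n) < x - a" "\<forall>\<^sub>F n in sequentially. 1 / real (Suc n) < b - x"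
          by (auto intro!: order_tendstoD(2)[OF lim] simp del: of_nat_Suc)
        then show ?thesis
          by eventually_elim (use True in \<open>auto simp: G_def indicator_def\<close>)
      next
        case False
        have "x \<notin> {a + 1 / real (Suc n)..b - 1 / real (Suc n)}" for n
        proof -
          have "0 < 1 / real (Suc n)" by simp
          then show ?thesis using False unfolding greaterThanLessThan_iff atLeastAtMost_iff by linarith
        qed
        then show ?thesis using False by (auto simp: G_def indicator_def)
      qed
    qed
  qed
qed simp

lemma Linf_norm_AE:
  assumes "Linf_norm a b g \<le> ereal c"
  shows "AE x in lebesgue_on {a<..<b}. norm (g x) \<le> c"
  using esssup_AE[of "\<lambda>x. ereal (norm (g x))" "lebesgue_on {a<..<b}"]
proof eventually_elim
  case (elim x)
  then show ?case using order_trans[OF elim assms[unfolded Linf_norm_def]] by simp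
qed

lemma has_weak_deriv_Linf_integrable:
  fixes g :: "real \<Rightarrow> 'v::euclidean_space"
  assumes "has_weak_deriv a b k f g" "Linf_norm a b g \<le> ereal c"
  shows "integrable (lebesgue_on {a<..<b}) g"
  using assms
  by (intro bounded_AE_integrable[OF loc_integrable_measurable Linf_norm_AE]) (auto simp: has_weak_deriv_def)

lemma has_weak_deriv_0_self:
  fixes f :: "real \<Rightarrow> 'v::euclidean_space"
  assumes "continuous_on {a..b} f"
  shows "has_weak_deriv a b 0 f f"
proof -
  have "loc_integrable a b f"
    unfolding loc_integrable_def set_integrable_def
  proof (intro allI impI)
    fix c d assume "a < c \<and> d < b"
    then have "integrable (lebesgue_on {c..d}) f"
      by (intro continuous_imp_integrable_real continuous_on_subset[OF assms]) auto
    then show "integrable lebesgue (\<lambda>x. indicat_real {c..d} x *\<^sub>R f x)"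
      by (simp add: integrable_restrict_space)
  qed
  then show ?thesis by (simp add: has_weak_deriv_def)
qed

text \<open>All norms are taken of a chosen weak derivative, even in order 0; for a continuous
  function the essential bound on that choice holds at every point, grid points included.\<close>

lemma weak_deriv_0_norm_le:
  fixes f :: "real \<Rightarrow> 'v::euclidean_space"
  assumes "a < b" "continuous_on {a..b} f" "Linf_norm a b (weak_deriv a b 0 f) \<le> ereal c" "x \<in> {a..b}"
  shows "norm (f x) \<le> c"
proof -
  note w = weak_derivI[OF has_weak_deriv_0_self[OF assms(2)]]
  show ?thesis
    by (rule weak_deriv_0_sup_bound[OF assms(1) w assms(2) has_weak_deriv_Linf_integrable[OF w assms(3)]
          Linf_norm_AE[OF assms(3)] assms(4)])
qed

lemma Wminf_norm_tendsto_uniform: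
  fixes w :: "real \<Rightarrow> real \<Rightarrow> 'v::euclidean_space"
  assumes "a < b" "((\<lambda>s. Wminf_norm m a b (w s)) \<longlongrightarrow> 0) F"
    and "\<forall>\<^sub>F s in F. continuous_on {a..b} (w s)" and "e > 0"
  shows "\<forall>\<^sub>F s in F. \<forall>x\<in>{a..b}. norm (w s x) \<le> e"
proof -
  have "\<forall>\<^sub>F s in F. Wminf_norm m a b (w s) < ereal e"
    using assms(2,4) by (intro order_tendstoD(2)) auto
  then show ?thesis using assms(3)
  proof eventually_elim
    case (elim s)
    have "Linf_norm a b (weak_deriv a b 0 (w s)) \<le> Wminf_norm m a b (w s)"
      unfolding Wminf_norm_def by (rule SUP_upper) simp
    then have "Linf_norm a b (weak_deriv a b 0 (w s)) \<le> ereal e" using elim by simp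
    then show ?case using weak_deriv_0_norm_le[OF assms(1) elim(2)] by blast
  qed
qed

lemma Wminf_per_continuous: "f \<in> Wminf_per m a b \<Longrightarrow> continuous_on {a..b} f"
  by (simp add: Wminf_per_def)

lemma time_cont_uniform:
  fixes u :: "real \<Rightarrow> real \<Rightarrow> 'v::euclidean_space"
  assumes "a < b" "time_cont m a b T u" "t \<in> {0..T}" "e > 0"
  shows "\<forall>\<^sub>F s in at t within {0..T}. \<forall>x\<in>{a..b}. norm (u s x - u t x) \<le> e"
proof (rule Wminf_norm_tendsto_uniform[OF assms(1) _ _ assms(4)])
  show "((\<lambda>s. Wminf_norm m a b (\<lambda>x. u s x - u t x)) \<longlongrightarrow> 0) (at t within {0..T})"
    using assms(2,3) by (simp add: time_cont_def)
  have "continuous_on {a..b} (u s)" if "s \<in> {0..T}" for s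
    using assms(2) that Wminf_per_continuous[of "u s"] unfolding time_cont_def by blast
  then show "\<forall>\<^sub>F s in at t within {0..T}. continuous_on {a..b} (\<lambda>x. u s x - u t x)"
    using assms(3) by (auto simp: eventually_at_filter intro!: always_eventually continuous_on_diff)
qed

lemma time_cont_pointwise:
  fixes u :: "real \<Rightarrow> real \<Rightarrow> 'v::euclidean_space"
  assumes "a < b" "time_cont m a b T u" "x \<in> {a..b}"
  shows "continuous_on {0..T} (\<lambda>t. u t x)"
  unfolding continuous_on_def
proof
  fix t assume t: "t \<in> {0..T}"
  show "((\<lambda>t. u t x) \<longlongrightarrow> u t x) (at t within {0..T})"
  proof (rule tendstoI)
    fix e :: real assume "e > 0"
    then have "\<forall>\<^sub>F s in at t within {0..T}. \<forall>x\<in>{a..b}. norm (u s x - u t x) \<le> e / 2"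
      by (intro time_cont_uniform[OF assms(1,2) t]) simp
    then show "\<forall>\<^sub>F s in at t within {0..T}. dist (u s x) (u t x) < e"
      by eventually_elim (use assms(3) \<open>e > 0\<close> in \<open>force simp: dist_norm\<close>)
  qed
qed

lemma has_time_deriv_pointwise:
  fixes u :: "real \<Rightarrow> real \<Rightarrow> 'v::euclidean_space"
  assumes "a < b" "time_cont m a b T u" "has_time_deriv m a b T u v t" "t \<in> {0..T}" "x \<in> {a..b}"
  shows "((\<lambda>s. u s x) has_vector_derivative v x) (at t within {0..T})"
  unfolding has_vector_derivative_iff_quotient
proof (rule tendstoI)
  fix e :: real assume "e > 0"
  have "continuous_on {a..b} (u s)" if "s \<in> {0..T}" for s
    using assms(2) that Wminf_per_continuous[of "u s"] unfolding time_cont_def by blast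
  moreover have "continuous_on {a..b} v"
    using assms(3) Wminf_per_continuous by (auto simp: has_time_deriv_def)
  ultimately have "\<forall>\<^sub>F s in at t within {0..T}. continuous_on {a..b} (\<lambda>x. (u s x - u t x) /\<^sub>R (s - t) - v x)"
    using assms(4)
    by (auto simp: eventually_at_filter intro!: always_eventually continuous_on_diff continuous_on_scaleR
        continuous_on_const)
  then have "\<forall>\<^sub>F s in at t within {0..T}. \<forall>x\<in>{a..b}. norm ((u s x - u t x) /\<^sub>R (s - t) - v x) \<le> e / 2"
    using assms(3) \<open>e > 0\<close>
    by (intro Wminf_norm_tendsto_uniform[OF assms(1)]) (auto simp: has_time_deriv_def)
  then show "\<forall>\<^sub>F s in at t within {0..T}. dist ((u s x - u t x) /\<^sub>R (s - t)) (v x) < e"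
    by eventually_elim (use assms(5) \<open>e > 0\<close> in \<open>force simp: dist_norm\<close>)
qed

text \<open>The set where the bound holds is closed and of full measure, so it contains the open
  interval and its closure. The scheme needs bounds at the particular times t_n, while the
  hypotheses are essential suprema in time.\<close>

lemma continuous_AE_le:
  fixes g :: "real \<Rightarrow> real"
  assumes "0 < T" "continuous_on {0..T} g" "AE t in lebesgue_on {0..T}. g t \<le> c" "t \<in> {0..T}"
  shows "g t \<le> c"
proof -
  define C where "C = {t \<in> {0..T}. g t \<le> c}"
  have "closed C"
    unfolding C_def using assms(2) by (intro continuous_on_closed_Collect_le continuous_on_const) auto
  have "AE t in lebesgue. t \<in> {0..T} \<longrightarrow> g t \<le> c"
    using assms(3) by (simp add: AE_restrict_space_iff)
  then have "AE t \<in> {0<..<T} in lebesgue. t \<in> C"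
    by eventually_elim (auto simp: C_def)
  then have "{0<..<T} \<subseteq> C"
    using mem_closed_if_AE_lebesgue_open[OF open_greaterThanLessThan \<open>closed C\<close>] by blast
  then have "closure {0<..<T} \<subseteq> C" using \<open>closed C\<close> by (rule closure_minimal)
  then show ?thesis using assms(1,4) by (auto simp: C_def)
qed

lemma fcoef_diff_le:
  fixes f g :: "real \<Rightarrow> complex ^ 'n"
  assumes "a < b" "continuous_on {a..b} f" "continuous_on {a..b} g"
    "\<And>x. x \<in> {a..b} \<Longrightarrow> norm (f x - g x) \<le> c" "c \<ge> 0"
  shows "norm (fcoef a b f l - fcoef a b g l) \<le> c"
proof -
  have "fcoef a b (\<lambda>x. f x - g x) l = fcoef a b f l - fcoef a b g l"
    using integrable_wave_scale[OF continuous_integral_open_interval(1)[OF assms(2)], of "- l"]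
      integrable_wave_scale[OF continuous_integral_open_interval(1)[OF assms(3)], of "- l"]
    by (simp add: fcoef_def vector_ssub_ldistrib scaleR_diff_right)
  moreover have "(\<Sum>k\<in>{l}. (norm (fcoef a b (\<lambda>x. f x - g x) k))\<^sup>2) \<le> c\<^sup>2"
    by (rule bessel_inequality[OF assms(1) continuous_integral_open_interval(1)[OF continuous_on_diff[OF assms(2,3)]]])
      (auto intro!: AE_I2 assms(4))
  ultimately show ?thesis using assms(5) by (simp add: power2_le_iff_abs_le)
qed

lemma continuous_on_fcoef:
  fixes u :: "real \<Rightarrow> real \<Rightarrow> complex ^ 'n"
  assumes "a < b" "time_cont m a b T u"
  shows "continuous_on {0..T} (\<lambda>t. fcoef a b (u t) l)"
  unfolding continuous_on_def
proof
  fix t assume t: "t \<in> {0..T}"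
  have cont: "continuous_on {a..b} (u s)" if "s \<in> {0..T}" for s
    using assms(2) that Wminf_per_continuous[of "u s"] unfolding time_cont_def by blast
  show "((\<lambda>t. fcoef a b (u t) l) \<longlongrightarrow> fcoef a b (u t) l) (at t within {0..T})"
  proof (rule tendstoI)
    fix e :: real assume "e > 0"
    then have "\<forall>\<^sub>F s in at t within {0..T}. \<forall>x\<in>{a..b}. norm (u s x - u t x) \<le> e / 2"
      by (intro time_cont_uniform[OF assms(1,2) t]) simp
    moreover have "\<forall>\<^sub>F s in at t within {0..T}. s \<in> {0..T}"
      by (simp add: eventually_at_filter)
    ultimately show "\<forall>\<^sub>F s in at t within {0..T}. dist (fcoef a b (u s) l) (fcoef a b (u t) l) < e"
    proof eventually_elim
      case (elim s)
      have "norm (fcoef a b (u s) l - fcoef a b (u t) l) \<le> e / 2"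
        using elim \<open>e > 0\<close> by (intro fcoef_diff_le[OF assms(1) cont cont[OF t]]) auto
      then show ?case using \<open>e > 0\<close> by (simp add: dist_norm)
    qed
  qed
qed

lemma mixed_Linf_norm_sup:
  fixes u :: "real \<Rightarrow> real \<Rightarrow> 'v::euclidean_space"
  assumes "a < b" "0 < T" "time_cont m a b T ((time_deriv m a b T ^^ r) u)"
    and B: "mixed_Linf_norm m a b T r 0 u \<le> ereal B" and t: "t \<in> {0..T}" and x: "x \<in> {a..b}"
  shows "norm ((time_deriv m a b T ^^ r) u t x) \<le> B"
proof (rule continuous_AE_le[OF assms(2) _ _ t])
  define v where "v = (time_deriv m a b T ^^ r) u"
  show "continuous_on {0..T} (\<lambda>t. norm (v t x))"
    using time_cont_pointwise[OF assms(1,3) x] by (intro continuous_intros) (simp add: v_def)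
  have "AE t in lebesgue_on {0..T}. Linf_norm a b (weak_deriv a b 0 (v t)) \<le> ereal B"
    using esssup_AE[of "\<lambda>t. Linf_norm a b (weak_deriv a b 0 (v t))" "lebesgue_on {0..T}"]
    by eventually_elim (erule order_trans[OF _ B[unfolded mixed_Linf_norm_def, folded v_def]])
  then show "AE t in lebesgue_on {0..T}. norm (v t x) \<le> B"
    using AE_space
  proof eventually_elim
    case (elim t)
    have "continuous_on {a..b} (v t)"
      using assms(3) elim(2) by (intro Wminf_per_continuous[of _ m]) (auto simp: time_cont_def v_def)
    then show ?case by (rule weak_deriv_0_norm_le[OF assms(1) _ elim(1) x])
  qed
qed

text \<open>The chosen k-th weak derivative need not be a regular function of time, but a finite sum
  over Fourier coefficients of the solution is continuous in time. So Bessel's bound, valid for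
  almost every time, holds for every time.\<close>

lemma mixed_Linf_norm_fcoef:
  fixes u :: "real \<Rightarrow> real \<Rightarrow> complex ^ 'n"
  assumes "a < b" "0 < T" "time_cont m a b T u" "k \<le> m"
    and B: "mixed_Linf_norm m a b T 0 k u \<le> ereal B" and t: "t \<in> {0..T}" and F: "finite F"
  shows "(\<Sum>l\<in>F. (\<bar>freq a b l\<bar> ^ k * norm (fcoef a b (u t) l))\<^sup>2) \<le> B\<^sup>2"
proof (rule continuous_AE_le[OF assms(2) _ _ t])
  show "continuous_on {0..T} (\<lambda>t. \<Sum>l\<in>F. (\<bar>freq a b l\<bar> ^ k * norm (fcoef a b (u t) l))\<^sup>2)"
    by (intro continuous_intros continuous_on_fcoef[OF assms(1,3)])
  have "AE t in lebesgue_on {0..T}. Linf_norm a b (weak_deriv a b k (u t)) \<le> ereal B"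
    using esssup_AE[of "\<lambda>t. Linf_norm a b (weak_deriv a b k (u t))" "lebesgue_on {0..T}"]
    by eventually_elim (use B in \<open>simp add: mixed_Linf_norm_def order_trans[OF _ B]\<close>)
  then show "AE t in lebesgue_on {0..T}. (\<Sum>l\<in>F. (\<bar>freq a b l\<bar> ^ k * norm (fcoef a b (u t) l))\<^sup>2) \<le> B\<^sup>2"
    using AE_space
  proof eventually_elim
    case (elim t)
    define g where "g = weak_deriv a b k (u t)"
    have ut: "u t \<in> Wminf_per m a b" using assms(3) elim(2) by (auto simp: time_cont_def)
    then have g: "has_weak_deriv a b k (u t) g"
      using assms(4) by (auto simp: Wminf_per_def Wminf_def g_def)
    have int: "integrable (lebesgue_on {a<..<b}) g"
      by (rule has_weak_deriv_Linf_integrable[OF g, of B]) (use elim in \<open>simp add: g_def\<close>)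
    have "\<bar>freq a b l\<bar> ^ k * norm (fcoef a b (u t) l) = norm (fcoef a b g l)" for l
      by (simp add: fcoef_weak_deriv[OF assms(1) ut assms(4) g int] norm_power norm_mult)
    then show ?case
      using bessel_inequality[OF assms(1) int Linf_norm_AE F, of B] elim(1) by (simp add: g_def)
  qed
qed

section \<open>The splitting scheme\<close>

definition free_symbol :: "real \<Rightarrow> real \<Rightarrow> real \<Rightarrow> int \<Rightarrow> complex^2^2" where
  "free_symbol \<epsilon> a b l = (- \<i> * of_real (freq a b l)) *m sigma1 - (\<i> / of_real \<epsilon>) *m sigma3"

definition potential_matrix :: "real \<Rightarrow> real \<Rightarrow> real \<Rightarrow> complex^2^2" where
  "potential_matrix \<epsilon> v w = (- \<i> / of_real \<epsilon> * of_real v) *m mat 1 + (\<i> / of_real \<epsilon> * of_real w) *m sigma1"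

lemma sigma1_vector: "(sigma1 *v u) $ 1 = u $ 2" "(sigma1 *v u) $ 2 = u $ 1"
  by (simp_all add: sigma1_def matrix_vector_mult_def sum_2)

lemma sigma3_vector: "(sigma3 *v u) $ 1 = u $ 1" "(sigma3 *v u) $ 2 = - u $ 2"
  by (simp_all add: sigma3_def matrix_vector_mult_def sum_2)

lemma norm_complex2: "norm (u :: complex^2) = sqrt ((cmod (u $ 1))\<^sup>2 + (cmod (u $ 2))\<^sup>2)"
  by (simp add: norm_vec_def L2_set_def sum_2)

lemma norm_sigma1 [simp]: "norm (sigma1 *v u) = norm u"
  and norm_sigma3 [simp]: "norm (sigma3 *v u) = norm u"
  by (simp_all add: norm_complex2 sigma1_vector sigma3_vector add.commute)

lemma free_symbol_vector:
  "free_symbol \<epsilon> a b l *v u = (- \<i> * of_real (freq a b l)) *s (sigma1 *v u) - (\<i> / of_real \<epsilon>) *s (sigma3 *v u)"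
  by (simp add: free_symbol_def matrix_vector_mult_diff_rdistrib scale_mat_vector)

lemma potential_matrix_vector:
  "potential_matrix \<epsilon> v w *v u = (- \<i> / of_real \<epsilon> * of_real v) *s u + (\<i> / of_real \<epsilon> * of_real w) *s (sigma1 *v u)"
  by (simp add: potential_matrix_def matrix_vector_mult_add_rdistrib scale_mat_vector)

text \<open>The symbol is -i times a real symmetric matrix, and the inner product is the real part
  of the Hermitian one.\<close>

lemma free_symbol_skew: "(free_symbol \<epsilon> a b l *v u) \<bullet> u = 0"
  unfolding free_symbol_vector inner_vec_def sum_2
  by (simp add: sigma1_vector sigma3_vector inner_complex_def algebra_simps Re_divide Im_divide)

lemma potential_matrix_skew: "(potential_matrix \<epsilon> v w *v u) \<bullet> u = 0"
  unfolding potential_matrix_vector inner_vec_def sum_2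
  by (simp add: sigma1_vector inner_complex_def algebra_simps Re_divide Im_divide)

lemma norm_free_symbol:
  assumes "\<epsilon> > 0"
  shows "norm (free_symbol \<epsilon> a b l *v u) \<le> (\<bar>freq a b l\<bar> + 1 / \<epsilon>) * norm u"
  unfolding free_symbol_vector
  using norm_triangle_ineq4[of "(- \<i> * of_real (freq a b l)) *s (sigma1 *v u)" "(\<i> / of_real \<epsilon>) *s (sigma3 *v u)"] assms
  by (simp add: norm_mult norm_divide algebra_simps)

lemma norm_potential_matrix:
  assumes "\<epsilon> > 0" "\<bar>v\<bar> \<le> D" "\<bar>w\<bar> \<le> D"
  shows "norm (potential_matrix \<epsilon> v w *v u) \<le> 2 * D / \<epsilon> * norm u"
proof -
  have "norm (potential_matrix \<epsilon> v w *v u) \<le> \<bar>v\<bar> / \<epsilon> * norm u + \<bar>w\<bar> / \<epsilon> * norm u"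
    unfolding potential_matrix_vector
    using norm_triangle_ineq[of "(- \<i> / of_real \<epsilon> * of_real v) *s u" "(\<i> / of_real \<epsilon> * of_real w) *s (sigma1 *v u)"] assms(1)
    by (simp add: norm_mult norm_divide)
  also have "\<dots> \<le> D / \<epsilon> * norm u + D / \<epsilon> * norm u"
    using assms by (intro add_mono mult_right_mono divide_right_mono) auto
  finally show ?thesis by simp
qed

section \<open>The scheme in Fourier form\<close>

lemma S1_free_eq:
  "S1_free \<epsilon> \<tau> a b M U j =
    (\<Sum>l\<in>modes M. wave a b l (grid a b M j) *s (mat_exp (\<tau> *\<^sub>R free_symbol \<epsilon> a b l) *v dft a b M U l))"
  by (simp add: S1_free_def wave_def cis_conv_exp scale_mat_of_real free_symbol_def)

lemma S1_Suc_eq: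
  "S1 \<epsilon> \<tau> a b M V A1 \<Phi>0 (Suc n) j =
    mat_exp (\<tau> *\<^sub>R potential_matrix \<epsilon> (V (grid a b M j)) (A1 (grid a b M j)))
      *v S1_free \<epsilon> \<tau> a b M (S1 \<epsilon> \<tau> a b M V A1 \<Phi>0 n) j"
  by (simp add: scale_mat_of_real potential_matrix_def)

lemma interpolant_eq: "interpolant a b M U x = (\<Sum>l\<in>modes M. wave a b l x *s dft a b M U l)"
  by (simp add: interpolant_def wave_def cis_conv_exp)

lemma dft_diff: "dft a b M (\<lambda>j. U j - W j) l = dft a b M U l - dft a b M W l"
  by (simp add: dft_def sum_subtractf vector_ssub_ldistrib)

lemma S1_free_diff: "S1_free \<epsilon> \<tau> a b M (\<lambda>j. U j - W j) j = S1_free \<epsilon> \<tau> a b M U j - S1_free \<epsilon> \<tau> a b M W j"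
  by (simp add: S1_free_eq dft_diff matrix_vector_mult_diff_distrib vector_ssub_ldistrib sum_subtractf)

lemma grid_norm_S1_free:
  assumes "a < b" "M > 0" "even M"
  shows "grid_norm M (S1_free \<epsilon> \<tau> a b M U) = grid_norm M U"
  unfolding S1_free_eq[abs_def] modes_parseval[OF assms] grid_norm_dft[OF assms, of U]
  by (simp add: mat_exp_isometry[OF free_symbol_skew])

lemma grid_in_interval:
  assumes "a < b" "j < M"
  shows "grid a b M j \<in> {a..b}"
proof -
  have "real j * ((b - a) / real M) \<le> real M * ((b - a) / real M)"
    using assms by (intro mult_right_mono) auto
  also have "\<dots> = b - a" using assms by simp
  finally show ?thesis using assms by (simp add: grid_def mesh_def)
qed

text \<open>Dividing by i \<epsilon> removes \<epsilon> in front of the space derivative, so the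
  free generator costs |\<mu>| + 1/\<epsilon> per mode. The left-hand side expresses it without a
  space derivative.\<close>

lemma dirac_evolution_form:
  fixes ft fx u :: "complex^2"
  assumes "\<epsilon> > 0"
    and "(\<i> * of_real \<epsilon>) *s ft = ((- \<i> * of_real \<epsilon>) *m sigma1) *v fx
      + (sigma3 + of_real v *m mat 1 - of_real w *m sigma1) *v u"
  shows "ft - potential_matrix \<epsilon> v w *v u = - (sigma1 *v fx) - (\<i> / of_real \<epsilon>) *s (sigma3 *v u)"
proof -
  have "(1 / (\<i> * of_real \<epsilon>)) *s ((\<i> * of_real \<epsilon>) *s ft) = ft"
    using assms(1) by (simp add: vector_smult_assoc)
  then have ft: "ft = (1 / (\<i> * of_real \<epsilon>)) *s (((- \<i> * of_real \<epsilon>) *m sigma1) *v fx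
      + (sigma3 + of_real v *m mat 1 - of_real w *m sigma1) *v u)"
    using assms(2) by simp
  show ?thesis
    unfolding ft using assms(1)
    by (simp add: matrix_vector_mult_add_rdistrib matrix_vector_mult_diff_rdistrib scale_mat_vector
        potential_matrix_vector vec_eq_iff field_simps)
qed

lemma L2_set_add_le:
  assumes "\<And>i. i \<in> F \<Longrightarrow> 0 \<le> f i" "\<And>i. i \<in> F \<Longrightarrow> f i \<le> g i + h i"
  shows "L2_set f F \<le> L2_set g F + L2_set h F"
  using L2_set_mono[of F f "\<lambda>i. g i + h i"] assms L2_set_triangle_ineq[of g h F] by simp

section \<open>The local error\<close>

text \<open>Compares an Euler step of the full generator with the potential step applied to an Euler
  step of the free part; \<open>Kx\<close>, \<open>Ky\<close> are the images of \<open>x\<close>,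
  \<open>y\<close>. Since \<open>y\<close> carries a factor \<open>t\<close>, first order suffices
  for it.\<close>

lemma kick_defect_le:
  fixes x y Bx Kx Ky :: "'v::real_normed_vector"
  assumes "t > 0"
  shows "norm (x + t *\<^sub>R (y + Bx) - (Kx + t *\<^sub>R Ky)) \<le> norm (Kx - x - t *\<^sub>R Bx) + t * norm (Ky - y)"
proof -
  have "x + t *\<^sub>R (y + Bx) - (Kx + t *\<^sub>R Ky) = - ((Kx - x - t *\<^sub>R Bx) + t *\<^sub>R (Ky - y))"
    by (simp add: algebra_simps)
  then show ?thesis
    using norm_triangle_ineq[of "Kx - x - t *\<^sub>R Bx" "t *\<^sub>R (Ky - y)"] assms by (simp only: norm_minus_cancel norm_scaleR abs_of_pos)
qed

text \<open>For \<open>fx\<close>, \<open>fp\<close> the free step applied to \<open>x\<close>,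
  \<open>p\<close>, the four errors are: sampling of the solution, sampling of its generator, the
  Taylor remainder on the truncated series, and the free step applied to the first error.\<close>

lemma free_defect_split:
  fixes x y p q fx fp :: "'v::real_vector"
  shows "fx = (x + t *\<^sub>R y) - ((x - p) + (t *\<^sub>R (y - q) + (- (fp - p - t *\<^sub>R q) + - (fx - fp))))"
  by (simp add: algebra_simps)

lemma local_error_arith:
  fixes \<epsilon> \<tau> h c0 c2 cm cm1 d :: real
  assumes "\<epsilon> > 0" "m > 0"
  shows "c2 / \<epsilon>\<^sup>2 * \<tau>\<^sup>2 + (\<tau>\<^sup>2 * (d / \<epsilon>\<^sup>2) + (4 * h ^ m * (cm / \<epsilon> ^ m)
      + (\<tau> * (4 * h ^ (m - 1) * ((cm + cm1) / \<epsilon> ^ m))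
      + (\<tau>\<^sup>2 * (2 * (c2 + c0) / \<epsilon>\<^sup>2) + 4 * h ^ m * (cm / \<epsilon> ^ m)))))
    = (3 * c2 + 2 * c0 + d) * (\<tau>\<^sup>2 / \<epsilon>\<^sup>2) + 8 * cm * (h / \<epsilon>) ^ m
      + 4 * (cm + cm1) * (\<tau> / \<epsilon> * (h / \<epsilon>) ^ (m - 1))"
proof -
  obtain k where m: "m = Suc k" using assms(2) gr0_conv_Suc by blast
  have "\<tau> * (4 * h ^ (m - 1) * ((cm + cm1) / \<epsilon> ^ m)) = 4 * (cm + cm1) * (\<tau> / \<epsilon> * (h / \<epsilon>) ^ (m - 1))"
    by (simp add: m power_divide)
  moreover have "4 * h ^ m * (cm / \<epsilon> ^ m) = 4 * cm * (h / \<epsilon>) ^ m"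
    by (simp add: power_divide)
  moreover have "c2 / \<epsilon>\<^sup>2 * \<tau>\<^sup>2 = c2 * (\<tau>\<^sup>2 / \<epsilon>\<^sup>2)" "\<tau>\<^sup>2 * (d / \<epsilon>\<^sup>2) = d * (\<tau>\<^sup>2 / \<epsilon>\<^sup>2)"
    "\<tau>\<^sup>2 * (2 * (c2 + c0) / \<epsilon>\<^sup>2) = 2 * (c2 + c0) * (\<tau>\<^sup>2 / \<epsilon>\<^sup>2)"
    by simp_all
  ultimately show ?thesis by (simp only: distrib_right distrib_left) simp
qed

text \<open>A single step from a fixed time \<open>t\<close>: \<open>f\<close>, \<open>f1\<close> and \<open>f'\<close> are the exact solution at time \<open>t\<close>,
  its time derivative and its space derivative.  The bounds \<open>S0\<close> to \<open>Sm1\<close> are the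
  \<open>L\<^sup>2\<close> bounds on the space derivatives, read off the Fourier coefficients.\<close>

locale dirac_step =
  fixes a b \<epsilon> \<tau> D c0 c1 :: real and M m :: nat and V A1 :: "real \<Rightarrow> real"
    and f f1 f' :: "real \<Rightarrow> complex^2" and c2 cm cm1 :: real
  assumes ab: "a < b" and M: "M > 0" "even M" and eps: "\<epsilon> > 0" and tau: "\<tau> > 0" and m: "m \<ge> 4"
    and V: "continuous_on {a..b} V" "\<And>x. x \<in> {a..b} \<Longrightarrow> \<bar>V x\<bar> \<le> D"
    and A1: "continuous_on {a..b} A1" "\<And>x. x \<in> {a..b} \<Longrightarrow> \<bar>A1 x\<bar> \<le> D"
    and f: "continuous_on {a..b} f" "\<And>x. x \<in> {a..b} \<Longrightarrow> norm (f x) \<le> c0"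
    and f1: "continuous_on {a..b} f1" "\<And>x. x \<in> {a..b} \<Longrightarrow> norm (f1 x) \<le> c1 / \<epsilon>"
    and f': "\<And>x. x \<in> {a<..<b} \<Longrightarrow> (f has_vector_derivative f' x) (at x)"
    and pde: "\<And>x. x \<in> {a<..<b} \<Longrightarrow> (\<i> * of_real \<epsilon>) *s f1 x = ((- \<i> * of_real \<epsilon>) *m sigma1) *v f' x
      + (sigma3 + of_real (V x) *m mat 1 - of_real (A1 x) *m sigma1) *v f x"
    and S0: "\<And>F. finite F \<Longrightarrow> L2_set (\<lambda>l. norm (fcoef a b f l)) F \<le> c0"
    and S2: "\<And>F. finite F \<Longrightarrow> L2_set (\<lambda>l. \<bar>freq a b l\<bar> ^ 2 * norm (fcoef a b f l)) F \<le> c2 / \<epsilon> ^ 2"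
    and Sm: "\<And>F. finite F \<Longrightarrow> L2_set (\<lambda>l. \<bar>freq a b l\<bar> ^ m * norm (fcoef a b f l)) F \<le> cm / \<epsilon> ^ m"
    and Sm1: "\<And>F. finite F \<Longrightarrow> L2_set (\<lambda>l. \<bar>freq a b l\<bar> ^ (m - 1) * norm (fcoef a b f l)) F \<le> cm1 / \<epsilon> ^ (m - 1)"
begin

abbreviation "h \<equiv> mesh a b M"
abbreviation "x\<^sub>j j \<equiv> grid a b M j"
abbreviation "p \<equiv> fcoef a b f"
abbreviation "G \<equiv> free_symbol \<epsilon> a b"
abbreviation "B x \<equiv> potential_matrix \<epsilon> (V x) (A1 x)"
abbreviation "synth c j \<equiv> \<Sum>l\<in>modes M. wave a b l (grid a b M j) *s (c l :: complex^2)"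
abbreviation "free \<equiv> S1_free \<epsilon> \<tau> a b M"
abbreviation "kick j v \<equiv> mat_exp (\<tau> *\<^sub>R B (grid a b M j)) *v v"

lemma grid_mem: "j < M \<Longrightarrow> x\<^sub>j j \<in> {a..b}"
  using grid_in_interval[OF ab] .

lemma D_nonneg: "D \<ge> 0" using V(2)[of a] ab by (auto intro: order_trans[OF abs_ge_zero])

lemma c_nonneg: "c0 \<ge> 0" "c1 \<ge> 0" "c2 \<ge> 0" "cm \<ge> 0" "cm1 \<ge> 0"
proof -
  show "c0 \<ge> 0" using S0[of "{}"] by simp
  have "0 \<le> c1 / \<epsilon>" using f1(2)[of a] ab order_trans[OF norm_ge_zero] by auto
  then show "c1 \<ge> 0" using eps by (simp add: zero_le_divide_iff)
  have nonneg: "0 \<le> c" if "0 \<le> c / \<epsilon> ^ k" for c k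
    using mult_right_mono[OF that, of "\<epsilon> ^ k"] eps by simp
  show "c2 \<ge> 0" by (rule nonneg[of _ 2]) (use S2[of "{}"] in simp)
  show "cm \<ge> 0" by (rule nonneg[of _ m]) (use Sm[of "{}"] in simp)
  show "cm1 \<ge> 0" by (rule nonneg[of _ "m - 1"]) (use Sm1[of "{}"] in simp)
qed

lemma summable_freq: "(\<lambda>l. \<bar>freq a b l\<bar> * norm (p l)) summable_on UNIV"
proof (rule summable_on_freq_coef[OF ab])
  fix F :: "int set" assume "finite F"
  then have "(L2_set (\<lambda>l. \<bar>freq a b l\<bar> ^ 2 * norm (p l)) F)\<^sup>2 \<le> (c2 / \<epsilon> ^ 2)\<^sup>2"
    by (intro power_mono S2 L2_set_nonneg)
  moreover have "(L2_set (\<lambda>l. \<bar>freq a b l\<bar> ^ 2 * norm (p l)) F)\<^sup>2 = (\<Sum>l\<in>F. (\<bar>freq a b l\<bar> ^ 2 * norm (p l))\<^sup>2)"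
    unfolding L2_set_def by (rule real_sqrt_pow2) (simp add: sum_nonneg)
  ultimately show "(\<Sum>l\<in>F. (\<bar>freq a b l\<bar> ^ 2 * norm (p l))\<^sup>2) \<le> (c2 / \<epsilon> ^ 2)\<^sup>2"
    by (simp only:)
qed

lemma summable_p: "(\<lambda>l. norm (p l)) summable_on UNIV"
  by (rule summable_on_coef[OF ab summable_freq])

lemma summable_Gp: "(\<lambda>l. norm (G l *v p l)) summable_on UNIV"
proof (rule summable_on_comparison_test)
  show "(\<lambda>l. \<bar>freq a b l\<bar> * norm (p l) + 1 / \<epsilon> * norm (p l)) summable_on UNIV"
    by (intro summable_on_add summable_on_cmult_right summable_freq summable_p)
  show "norm (G l *v p l) \<le> \<bar>freq a b l\<bar> * norm (p l) + 1 / \<epsilon> * norm (p l)" for l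
    using norm_free_symbol[OF eps, of a b l "p l"] by (simp add: distrib_right)
qed simp

lemma f_series: "x \<in> {a..b} \<Longrightarrow> f x = (\<Sum>\<^sub>\<infinity>l. wave a b l x *s p l)"
  by (rule fourier_series_eq[OF ab f(1) f' summable_p])

lemma summable_wave:
  fixes c :: "int \<Rightarrow> complex ^ 'n"
  assumes "(\<lambda>l. norm (c l)) summable_on UNIV"
  shows "(\<lambda>l. wave a b l x *s c l) summable_on UNIV"
  by (rule abs_summable_summable) (simp add: assms)

text \<open>The equation is only assumed in the open interval, but the grid contains \<open>a\<close>.\<close>

lemma free_part_series:
  assumes "x \<in> {a..b}"
  shows "f1 x - B x *v f x = (\<Sum>\<^sub>\<infinity>l. wave a b l x *s (G l *v p l))"
proof (rule continuous_eq_on_closed_interval[OF ab _ wave_series_continuous[OF summable_Gp] _ assms])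
  show "continuous_on {a..b} (\<lambda>x. f1 x - B x *v f x)"
    unfolding potential_matrix_vector
    by (intro continuous_intros f1(1) f(1) V(1) A1(1)
        bounded_linear.continuous_on[OF bounded_linear_matrix_vector_mult f(1)])
  fix x assume x: "x \<in> {a<..<b}"
  define d where "d l = (\<i> * of_real (freq a b l)) *s p l" for l
  have sd: "(\<lambda>l. norm (d l)) summable_on UNIV"
    using summable_freq by (simp add: d_def norm_mult)
  \<comment> \<open>The derivative in the equation is thereby the termwise derivative of the Fourier
    series.\<close>
  have "(f has_vector_derivative (\<Sum>\<^sub>\<infinity>l. wave a b l x *s d l)) (at x)"
    unfolding d_def
    by (rule has_vector_derivative_transform_within_open[OF
          wave_series_has_vector_derivative[OF ab summable_freq] open_greaterThanLessThan x])
      (rule f_series[symmetric], simp)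
  then have f'x: "f' x = (\<Sum>\<^sub>\<infinity>l. wave a b l x *s d l)"
    by (rule vector_derivative_unique_at[OF f'[OF x]])
  have "f1 x - B x *v f x = - (sigma1 *v f' x) - (\<i> / of_real \<epsilon>) *s (sigma3 *v f x)"
    by (rule dirac_evolution_form[OF eps pde[OF x]])
  also have "\<dots> = (- 1) *s (sigma1 *v f' x) + (- \<i> / of_real \<epsilon>) *s (sigma3 *v f x)"
    by (simp add: vec_eq_iff)
  also have "\<dots> = (\<Sum>\<^sub>\<infinity>l. (- 1) *s (sigma1 *v (wave a b l x *s d l)))
      + (\<Sum>\<^sub>\<infinity>l. (- \<i> / of_real \<epsilon>) *s (sigma3 *v (wave a b l x *s p l)))"
  proof -
    have bl: "bounded_linear (\<lambda>v. c *s (A *v v))" for c and A :: "complex^2^2"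
      by (rule bounded_linear_compose[OF bounded_linear_vector_scale bounded_linear_matrix_vector_mult])
    have fx: "f x = (\<Sum>\<^sub>\<infinity>l. wave a b l x *s p l)" by (rule f_series) (use x in simp)
    show ?thesis
      unfolding f'x fx
      by (simp only: infsumI[OF has_sum_bounded_linear[OF bl has_sum_infsum[OF summable_wave[OF sd]]]]
        infsumI[OF has_sum_bounded_linear[OF bl has_sum_infsum[OF summable_wave[OF summable_p]]]])
  qed
  also have "\<dots> = (\<Sum>\<^sub>\<infinity>l. (- 1) *s (sigma1 *v (wave a b l x *s d l)) +
      (- \<i> / of_real \<epsilon>) *s (sigma3 *v (wave a b l x *s p l)))"
  proof (rule infsum_add[symmetric])
    show "(\<lambda>l. (- 1) *s (sigma1 *v (wave a b l x *s d l))) summable_on UNIV"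
      by (rule abs_summable_summable) (simp add: sd)
    show "(\<lambda>l. (- \<i> / of_real \<epsilon>) *s (sigma3 *v (wave a b l x *s p l))) summable_on UNIV"
      by (rule abs_summable_summable)
        (use summable_on_cmult_right[OF summable_p, of "cmod (\<i> / of_real \<epsilon>)"] in \<open>simp add: norm_divide\<close>)
  qed
  also have "\<dots> = (\<Sum>\<^sub>\<infinity>l. wave a b l x *s (G l *v p l))"
  proof (rule infsum_cong)
    fix l
    have "A *v (c *s v) = c *s (A *v v)" for c v and A :: "complex^2^2"
      by (simp add: vec_eq_iff matrix_vector_mult_def sum_distrib_left mult_ac)
    then show "(- 1) *s (sigma1 *v (wave a b l x *s d l)) +
        (- \<i> / of_real \<epsilon>) *s (sigma3 *v (wave a b l x *s p l)) = wave a b l x *s (G l *v p l)"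
      by (simp add: d_def free_symbol_vector vec_eq_iff algebra_simps)
  qed
  finally show "f1 x - B x *v f x = (\<Sum>\<^sub>\<infinity>l. wave a b l x *s (G l *v p l))" .
qed

section \<open>Sampling errors and the remainders of the two sub-steps\<close>

abbreviation "X j \<equiv> f (grid a b M j)"
text \<open>By the equation, samples of the free generator applied to the solution; \<open>Q\<close>
  is the corresponding truncated series, as \<open>P\<close> is for \<open>X\<close>.\<close>

abbreviation "Y j \<equiv> f1 (grid a b M j) - B (grid a b M j) *v f (grid a b M j)"
abbreviation "P j \<equiv> synth p j"
abbreviation "Q j \<equiv> synth (\<lambda>l. G l *v p l) j"

lemma sample_error: "grid_norm M (\<lambda>j. X j - P j) \<le> 4 * h ^ m * (cm / \<epsilon> ^ m)"
proof -
  have "grid_norm M (\<lambda>j. X j - P j) = grid_norm M (\<lambda>j. (\<Sum>\<^sub>\<infinity>l. wave a b l (x\<^sub>j j) *s p l) - P j)"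
    by (rule grid_norm_cong) (simp only: f_series[OF grid_mem])
  also have "\<dots> \<le> 4 * h ^ m * (cm / \<epsilon> ^ m)"
    using m by (intro grid_norm_tail ab M Sm summable_p) auto
  finally show ?thesis .
qed

text \<open>One of the \<open>m\<close> derivatives is spent on \<open>G\<close>: its part |\<mu>|
  uses the bound of order m, its part 1/\<epsilon> the bound of order m - 1, and both end up at
  1/\<epsilon>^m.\<close>

lemma free_sample_error: "grid_norm M (\<lambda>j. Y j - Q j) \<le> 4 * h ^ (m - 1) * ((cm + cm1) / \<epsilon> ^ m)"
proof -
  have "grid_norm M (\<lambda>j. Y j - Q j)
      = grid_norm M (\<lambda>j. (\<Sum>\<^sub>\<infinity>l. wave a b l (x\<^sub>j j) *s (G l *v p l)) - Q j)"
    by (rule grid_norm_cong) (simp only: free_part_series[OF grid_mem])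
  also have "\<dots> \<le> 4 * h ^ (m - 1) * ((cm + cm1) / \<epsilon> ^ m)"
  proof (rule grid_norm_tail[OF ab M])
    fix F :: "int set" assume F: "finite F"
    have "L2_set (\<lambda>l. \<bar>freq a b l\<bar> ^ (m - 1) * norm (G l *v p l)) F
        \<le> L2_set (\<lambda>l. \<bar>freq a b l\<bar> ^ m * norm (p l)) F
          + L2_set (\<lambda>l. (1 / \<epsilon>) * (\<bar>freq a b l\<bar> ^ (m - 1) * norm (p l))) F"
    proof (rule L2_set_add_le)
      fix l
      have "\<bar>freq a b l\<bar> ^ (m - 1) * norm (G l *v p l)
          \<le> \<bar>freq a b l\<bar> ^ (m - 1) * ((\<bar>freq a b l\<bar> + 1 / \<epsilon>) * norm (p l))"
        by (intro mult_left_mono norm_free_symbol eps) simp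
      also have "\<dots> = (\<bar>freq a b l\<bar> * \<bar>freq a b l\<bar> ^ (m - 1)) * norm (p l)
          + (1 / \<epsilon>) * (\<bar>freq a b l\<bar> ^ (m - 1) * norm (p l))"
        by (simp only: distrib_left distrib_right mult_ac)
      also have "\<bar>freq a b l\<bar> * \<bar>freq a b l\<bar> ^ (m - 1) = \<bar>freq a b l\<bar> ^ m"
        using m by (metis Suc_pred' le_zero_eq not_gr_zero numeral_eq_iff power_Suc zero_neq_numeral)
      finally show "\<bar>freq a b l\<bar> ^ (m - 1) * norm (G l *v p l)
          \<le> \<bar>freq a b l\<bar> ^ m * norm (p l) + (1 / \<epsilon>) * (\<bar>freq a b l\<bar> ^ (m - 1) * norm (p l))" .
    qed simp
    also have "L2_set (\<lambda>l. (1 / \<epsilon>) * (\<bar>freq a b l\<bar> ^ (m - 1) * norm (p l))) F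
        = (1 / \<epsilon>) * L2_set (\<lambda>l. \<bar>freq a b l\<bar> ^ (m - 1) * norm (p l)) F"
      using eps by (intro L2_set_right_distrib[symmetric]) simp
    also have "L2_set (\<lambda>l. \<bar>freq a b l\<bar> ^ m * norm (p l)) F + \<dots>
        \<le> cm / \<epsilon> ^ m + (1 / \<epsilon>) * (cm1 / \<epsilon> ^ (m - 1))"
      using eps by (intro add_mono mult_left_mono Sm Sm1 F) simp
    also have "(1 / \<epsilon>) * (cm1 / \<epsilon> ^ (m - 1)) = cm1 / \<epsilon> ^ m"
      using m power_minus_mult[of m \<epsilon>] by (simp add: mult.commute)
    finally show "L2_set (\<lambda>l. \<bar>freq a b l\<bar> ^ (m - 1) * norm (G l *v p l)) F \<le> (cm + cm1) / \<epsilon> ^ m"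
      by (simp add: add_divide_distrib)
  qed (use m summable_Gp in auto)
  finally show ?thesis .
qed

text \<open>The transform of \<open>P\<close> returns exactly the coefficients \<open>p\<close>, so
  the free step acts mode by mode. Two factors \<open>G\<close> cost (|\<mu>| + 1/\<epsilon>)^2
  \<le> 2 \<mu>^2 + 2/\<epsilon>^2, which the bounds of orders 2 and 0 absorb.\<close>

lemma free_remainder:
  "grid_norm M (\<lambda>j. free P j - P j - \<tau> *\<^sub>R Q j) \<le> \<tau>\<^sup>2 * (2 * (c2 + c0) / \<epsilon>\<^sup>2)"
proof -
  have "free P j - P j - \<tau> *\<^sub>R Q j
      = synth (\<lambda>l. mat_exp (\<tau> *\<^sub>R G l) *v p l - p l - \<tau> *\<^sub>R (G l *v p l)) j" for j
    by (simp add: S1_free_eq dft_synthesis[OF ab M] scaleR_sum_right sum_subtractf vector_ssub_ldistrib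
        scaleR_eq_vector_scale vector_scale_sum vector_smult_assoc mult.commute)
  then have "grid_norm M (\<lambda>j. free P j - P j - \<tau> *\<^sub>R Q j)
      = L2_set (\<lambda>l. norm (mat_exp (\<tau> *\<^sub>R G l) *v p l - p l - \<tau> *\<^sub>R (G l *v p l))) (modes M)"
    by (simp only: modes_parseval[OF ab M])
  also have "\<dots> \<le> L2_set (\<lambda>l. 2 * \<tau>\<^sup>2 * (\<bar>freq a b l\<bar> ^ 2 * norm (p l))) (modes M)
      + L2_set (\<lambda>l. (2 * \<tau>\<^sup>2 / \<epsilon>\<^sup>2) * norm (p l)) (modes M)"
  proof (rule L2_set_add_le)
    fix l
    have "norm (mat_exp (\<tau> *\<^sub>R G l) *v p l - p l - \<tau> *\<^sub>R (G l *v p l)) \<le> \<tau>\<^sup>2 * norm (G l *v (G l *v p l))"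
      using tau by (intro mat_exp_second_order free_symbol_skew) simp
    also have "\<dots> \<le> \<tau>\<^sup>2 * ((\<bar>freq a b l\<bar> + 1 / \<epsilon>) * ((\<bar>freq a b l\<bar> + 1 / \<epsilon>) * norm (p l)))"
      using eps by (intro mult_left_mono order_trans[OF norm_free_symbol] norm_free_symbol) auto
    also have "\<dots> = \<tau>\<^sup>2 * ((\<bar>freq a b l\<bar> + 1 / \<epsilon>)\<^sup>2 * norm (p l))"
      by (simp add: power2_eq_square)
    also have "\<dots> \<le> \<tau>\<^sup>2 * ((2 * \<bar>freq a b l\<bar>\<^sup>2 + 2 * (1 / \<epsilon>)\<^sup>2) * norm (p l))"
      using zero_le_power2[of "\<bar>freq a b l\<bar> - 1 / \<epsilon>"]
      by (intro mult_left_mono mult_right_mono) (auto simp: power2_sum power2_diff)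
    finally show "norm (mat_exp (\<tau> *\<^sub>R G l) *v p l - p l - \<tau> *\<^sub>R (G l *v p l))
        \<le> 2 * \<tau>\<^sup>2 * (\<bar>freq a b l\<bar> ^ 2 * norm (p l)) + (2 * \<tau>\<^sup>2 / \<epsilon>\<^sup>2) * norm (p l)"
      by (simp add: power_divide algebra_simps)
  qed simp
  also have "\<dots> = 2 * \<tau>\<^sup>2 * L2_set (\<lambda>l. \<bar>freq a b l\<bar> ^ 2 * norm (p l)) (modes M)
      + (2 * \<tau>\<^sup>2 / \<epsilon>\<^sup>2) * L2_set (\<lambda>l. norm (p l)) (modes M)"
    by (subst (1 2) L2_set_right_distrib) auto
  also have "\<dots> \<le> 2 * \<tau>\<^sup>2 * (c2 / \<epsilon>\<^sup>2) + (2 * \<tau>\<^sup>2 / \<epsilon>\<^sup>2) * c0"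
    by (intro add_mono mult_left_mono S0 S2) auto
  also have "\<dots> = \<tau>\<^sup>2 * (2 * (c2 + c0) / \<epsilon>\<^sup>2)" by (simp add: algebra_simps add_divide_distrib)
  finally show ?thesis .
qed

text \<open>Pointwise, from suprema alone: \<open>Y\<close> is bounded by the time derivative and
  the potentials. The constant collects (2D)^2 c0 from expanding on \<open>X\<close> and 2D (c1 + 2D
  c0) from the action on \<open>Y\<close>.\<close>

lemma kick_remainder:
  assumes "j < M"
  shows "norm (X j + \<tau> *\<^sub>R f1 (x\<^sub>j j) - kick j (X j + \<tau> *\<^sub>R Y j))
    \<le> \<tau>\<^sup>2 * ((2 * D * (c1 + 4 * D * c0)) / \<epsilon>\<^sup>2)"
proof -
  let ?B = "B (x\<^sub>j j)"
  note x = grid_mem[OF assms]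
  note nB = norm_potential_matrix[OF eps V(2)[OF x] A1(2)[OF x]]
  have D': "2 * D / \<epsilon> \<ge> 0" using D_nonneg eps by simp
  have BX: "norm (?B *v X j) \<le> 2 * D / \<epsilon> * c0"
    by (rule order_trans[OF nB mult_left_mono[OF f(2)[OF x] D']])
  have Y: "norm (Y j) \<le> c1 / \<epsilon> + 2 * D / \<epsilon> * c0"
    by (rule order_trans[OF norm_triangle_ineq4 add_mono[OF f1(2)[OF x] BX]])
  have "kick j (X j + \<tau> *\<^sub>R Y j) = kick j (X j) + \<tau> *\<^sub>R kick j (Y j)"
    by (simp only: linear_add linear_cmul bounded_linear.linear[OF bounded_linear_matrix_vector_mult])
  moreover have "Y j + ?B *v X j = f1 (x\<^sub>j j)" by (rule diff_add_cancel)
  ultimately have "norm (X j + \<tau> *\<^sub>R f1 (x\<^sub>j j) - kick j (X j + \<tau> *\<^sub>R Y j))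
      \<le> norm (kick j (X j) - X j - \<tau> *\<^sub>R (?B *v X j)) + \<tau> * norm (kick j (Y j) - Y j)"
    using kick_defect_le[OF tau, of "X j" "Y j" "?B *v X j" "kick j (X j)" "kick j (Y j)"] by (simp only:)
  also have "\<dots> \<le> \<tau>\<^sup>2 * norm (?B *v (?B *v X j)) + \<tau> * (\<tau> * norm (?B *v Y j))"
    using tau by (intro add_mono mult_left_mono mat_exp_second_order mat_exp_first_order potential_matrix_skew) auto
  also have "\<dots> \<le> \<tau>\<^sup>2 * (2 * D / \<epsilon> * (2 * D / \<epsilon> * c0)) + \<tau> * (\<tau> * (2 * D / \<epsilon> * (c1 / \<epsilon> + 2 * D / \<epsilon> * c0)))"
    using tau by (intro add_mono mult_left_mono order_trans[OF nB] BX Y D') auto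
  also have "\<dots> = \<tau>\<^sup>2 * ((2 * D * (c1 + 4 * D * c0)) / \<epsilon>\<^sup>2)"
    using eps by (simp add: power2_eq_square field_simps)
  finally show ?thesis .
qed

text \<open>\<open>g\<close> stands for the solution one step later. The coefficient 3 c2 is one
  from Taylor in time and two from \<open>free_remainder\<close>; 8 cm is two sampling errors of 4
  cm, one of them carried through the free step.\<close>

lemma local_error:
  assumes g: "\<And>x. x \<in> {a..b} \<Longrightarrow> norm (g x - f x - \<tau> *\<^sub>R f1 x) \<le> c2 / \<epsilon>\<^sup>2 * \<tau>\<^sup>2"
  shows "grid_norm M (\<lambda>j. g (x\<^sub>j j) - kick j (free X j))
    \<le> (3 * c2 + 2 * c0 + 2 * D * (c1 + 4 * D * c0)) * (\<tau>\<^sup>2 / \<epsilon>\<^sup>2)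
      + 8 * cm * (h / \<epsilon>) ^ m + 4 * (cm + cm1) * (\<tau> / \<epsilon> * (h / \<epsilon>) ^ (m - 1))"
proof -
  let ?N = "grid_norm M"
  let ?R = "\<lambda>j. free P j - P j - \<tau> *\<^sub>R Q j"
  have split: "g (x\<^sub>j j) - kick j (free X j) = (g (x\<^sub>j j) - X j - \<tau> *\<^sub>R f1 (x\<^sub>j j))
      + ((X j + \<tau> *\<^sub>R f1 (x\<^sub>j j) - kick j (X j + \<tau> *\<^sub>R Y j))
      + kick j ((X j - P j) + (\<tau> *\<^sub>R (Y j - Q j) + (- ?R j + - free (\<lambda>j. X j - P j) j))))" for j
  proof -
    have "free X j = (X j + \<tau> *\<^sub>R Y j)
      - ((X j - P j) + (\<tau> *\<^sub>R (Y j - Q j) + (- ?R j + - free (\<lambda>j. X j - P j) j)))"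
      unfolding S1_free_diff by (rule free_defect_split)
    then have "kick j (free X j) = kick j (X j + \<tau> *\<^sub>R Y j)
      - kick j ((X j - P j) + (\<tau> *\<^sub>R (Y j - Q j) + (- ?R j + - free (\<lambda>j. X j - P j) j)))"
      by (simp only: matrix_vector_mult_diff_distrib)
    then show ?thesis by (simp only: diff_diff_eq2 diff_add_cancel add.assoc add_diff_eq) simp
  qed
  have "?N (\<lambda>j. g (x\<^sub>j j) - kick j (free X j)) \<le> ?N (\<lambda>j. g (x\<^sub>j j) - X j - \<tau> *\<^sub>R f1 (x\<^sub>j j))
      + (?N (\<lambda>j. X j + \<tau> *\<^sub>R f1 (x\<^sub>j j) - kick j (X j + \<tau> *\<^sub>R Y j))
      + ?N (\<lambda>j. (X j - P j) + (\<tau> *\<^sub>R (Y j - Q j) + (- ?R j + - free (\<lambda>j. X j - P j) j))))"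
  proof -
    have "?N (\<lambda>j. kick j ((X j - P j) + (\<tau> *\<^sub>R (Y j - Q j) + (- ?R j + - free (\<lambda>j. X j - P j) j))))
        = ?N (\<lambda>j. (X j - P j) + (\<tau> *\<^sub>R (Y j - Q j) + (- ?R j + - free (\<lambda>j. X j - P j) j)))"
      by (rule grid_norm_cong) (rule mat_exp_isometry[OF potential_matrix_skew])
    then show ?thesis
      unfolding split
      by (intro order_trans[OF grid_norm_add] add_left_mono order_trans[OF grid_norm_add] eq_refl
          arg_cong2[where f = "(+)"] refl)
  qed
  also have "?N (\<lambda>j. (X j - P j) + (\<tau> *\<^sub>R (Y j - Q j) + (- ?R j + - free (\<lambda>j. X j - P j) j)))
      \<le> ?N (\<lambda>j. X j - P j) + (\<tau> * ?N (\<lambda>j. Y j - Q j) + (?N ?R + ?N (\<lambda>j. X j - P j)))"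
  proof -
    have neg: "?N (\<lambda>j. - U j) = ?N U" for U :: "nat \<Rightarrow> complex^2"
      by (rule grid_norm_cong) simp
    have "?N (\<lambda>j. - ?R j + - free (\<lambda>j. X j - P j) j) \<le> ?N ?R + ?N (\<lambda>j. X j - P j)"
      using grid_norm_add[of M "\<lambda>j. - ?R j" "\<lambda>j. - free (\<lambda>j. X j - P j) j"]
      unfolding neg grid_norm_S1_free[OF ab M] .
    moreover have "?N (\<lambda>j. \<tau> *\<^sub>R (Y j - Q j)) = \<tau> * ?N (\<lambda>j. Y j - Q j)"
      using tau by (simp add: grid_norm_scaleR)
    ultimately show ?thesis
      by (intro order_trans[OF grid_norm_add] add_left_mono order_trans[OF grid_norm_add]) simp
  qed
  also have "?N (\<lambda>j. g (x\<^sub>j j) - X j - \<tau> *\<^sub>R f1 (x\<^sub>j j)) \<le> c2 / \<epsilon>\<^sup>2 * \<tau>\<^sup>2"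
    using c_nonneg by (intro grid_norm_bound M g grid_mem) auto
  also have "?N (\<lambda>j. X j + \<tau> *\<^sub>R f1 (x\<^sub>j j) - kick j (X j + \<tau> *\<^sub>R Y j))
      \<le> \<tau>\<^sup>2 * ((2 * D * (c1 + 4 * D * c0)) / \<epsilon>\<^sup>2)"
    using c_nonneg D_nonneg by (intro grid_norm_bound M kick_remainder) auto
  also note sample_error
  also note free_sample_error
  also note free_remainder
  finally have "?N (\<lambda>j. g (x\<^sub>j j) - kick j (free X j)) \<le> c2 / \<epsilon>\<^sup>2 * \<tau>\<^sup>2
      + (\<tau>\<^sup>2 * ((2 * D * (c1 + 4 * D * c0)) / \<epsilon>\<^sup>2)
      + (4 * h ^ m * (cm / \<epsilon> ^ m) + (\<tau> * (4 * h ^ (m - 1) * ((cm + cm1) / \<epsilon> ^ m))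
      + (\<tau>\<^sup>2 * (2 * (c2 + c0) / \<epsilon>\<^sup>2) + 4 * h ^ m * (cm / \<epsilon> ^ m)))))"
    using tau by simp
  then show ?thesis using m by (subst (asm) local_error_arith[OF eps]) auto
qed

end

section \<open>The interpolation error\<close>

lemma L2_set_union_le:
  assumes "finite A" "finite B" "A \<inter> B = {}"
  shows "L2_set f (A \<union> B) \<le> L2_set f A + L2_set f B"
proof (rule power2_le_imp_le)
  have sq: "(L2_set f S)\<^sup>2 = (\<Sum>i\<in>S. (f i)\<^sup>2)" for S
    by (simp add: L2_set_def sum_nonneg)
  show "(L2_set f (A \<union> B))\<^sup>2 \<le> (L2_set f A + L2_set f B)\<^sup>2"
    unfolding power2_sum sq sum.union_disjoint[OF assms] by simp
qed simp

context dirac_step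
begin

text \<open>Inside the modes the error coefficients are measured on the grid (aliasing, factor 4,
  plus the grid error); outside they are the truncated tail (factor 1), hence the 5. Parseval is
  applied to trigonometric polynomials, then the window grows.\<close>

lemma interpolation_error:
  "L2_norm_on a b (\<lambda>x. f x - interpolant a b M U x)
    \<le> sqrt (b - a) * (5 * h ^ m * (cm / \<epsilon> ^ m) + grid_norm M (\<lambda>j. X j - U j))"
proof -
  define q where "q l = (if l \<in> modes M then dft a b M U l else 0)" for l
  define r where "r l = p l - q l" for l
  define E where "E = 5 * h ^ m * (cm / \<epsilon> ^ m) + grid_norm M (\<lambda>j. X j - U j)"
  define W where "W x = f x - interpolant a b M U x" for x
  define WP where "WP n x = (\<Sum>l\<in>window M n. wave a b l x *s r l)" for n x
  let ?M = "lebesgue_on {a<..<b}"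
  have modes_window: "modes M \<subseteq> window M n" for n
    unfolding modes_eq_window[OF M(2)] window_def by auto
  have WP_eq: "WP n x = (\<Sum>l\<in>window M n. wave a b l x *s p l) - interpolant a b M U x" for n x
  proof -
    have "(\<Sum>l\<in>window M n. wave a b l x *s q l) = (\<Sum>l\<in>modes M. wave a b l x *s dft a b M U l)"
      by (rule sum.mono_neutral_cong_right[OF finite_window modes_window]) (auto simp: q_def)
    then show ?thesis
      by (simp add: WP_def r_def interpolant_eq vector_ssub_ldistrib sum_subtractf)
  qed
  have coef: "L2_set (\<lambda>l. norm (r l)) (window M n) \<le> E" for n
  proof -
    have "L2_set (\<lambda>l. norm (r l)) (window M n)
        \<le> L2_set (\<lambda>l. norm (r l)) (modes M) + L2_set (\<lambda>l. norm (r l)) (window M n - modes M)"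
      using L2_set_union_le[of "modes M" "window M n - modes M" "\<lambda>l. norm (r l)"] modes_window[of n]
      by (simp add: Un_absorb1)
    also have "L2_set (\<lambda>l. norm (r l)) (window M n - modes M) = L2_set (\<lambda>l. norm (p l)) (window M n - modes M)"
      by (rule L2_set_cong) (auto simp: r_def q_def)
    also have "\<dots> \<le> h ^ m * (cm / \<epsilon> ^ m)"
      by (rule L2_set_tail_le[OF ab M _ _ Sm]) auto
    also have "L2_set (\<lambda>l. norm (r l)) (modes M) \<le> 4 * h ^ m * (cm / \<epsilon> ^ m) + grid_norm M (\<lambda>j. X j - U j)"
    proof -
      have "L2_set (\<lambda>l. norm (r l)) (modes M) = grid_norm M (\<lambda>j. synth r j)"
        by (rule modes_parseval[OF ab M, symmetric])
      also have "\<dots> = grid_norm M (\<lambda>j. (X j - P j) + - (X j - U j))"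
      proof (rule grid_norm_cong)
        fix j assume j: "j < M"
        have "synth r j = synth (\<lambda>l. p l - dft a b M U l) j"
          by (rule sum.cong) (auto simp: r_def q_def)
        also have "\<dots> = P j - U j"
          by (simp add: vector_ssub_ldistrib sum_subtractf dft_inversion[OF ab M j])
        finally have "synth r j = - ((X j - P j) + - (X j - U j))" by simp
        then show "norm (synth r j) = norm ((X j - P j) + - (X j - U j))"
          by (simp only: norm_minus_cancel)
      qed
      also have "\<dots> \<le> grid_norm M (\<lambda>j. X j - P j) + grid_norm M (\<lambda>j. - (X j - U j))"
        by (rule grid_norm_add)
      also have "grid_norm M (\<lambda>j. - (X j - U j)) = grid_norm M (\<lambda>j. X j - U j)"
        by (rule grid_norm_cong) (simp only: norm_minus_cancel)
      finally show ?thesis using sample_error by simp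
    qed
    finally show ?thesis by (simp add: E_def mult_ac)
  qed
  have E0: "E \<ge> 0" using order_trans[OF L2_set_nonneg coef] .
  have intWP: "integral\<^sup>L ?M (\<lambda>x. (norm (WP n x))\<^sup>2) \<le> (b - a) * E\<^sup>2" for n
  proof -
    have "(L2_set (\<lambda>l. norm (r l)) (window M n))\<^sup>2 \<le> E\<^sup>2"
      by (intro power_mono coef L2_set_nonneg)
    then have "(\<Sum>l\<in>window M n. (norm (r l))\<^sup>2) \<le> E\<^sup>2"
      by (simp add: L2_set_def sum_nonneg)
    then show ?thesis
      unfolding WP_def trig_poly_norm_square[OF ab finite_window]
      using ab by (intro mult_left_mono) auto
  qed
  \<comment> \<open>A majorant independent of the window, for dominated convergence.\<close>
  define K where "K = (\<Sum>\<^sub>\<infinity>l. norm (p l)) + (\<Sum>l\<in>modes M. norm (dft a b M U l))"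
  have bound: "norm (WP n x) \<le> K" for n x
  proof -
    have "norm (\<Sum>l\<in>window M n. wave a b l x *s p l) \<le> (\<Sum>l\<in>window M n. norm (p l))"
      by (rule sum_norm_le) simp
    also have "\<dots> \<le> (\<Sum>\<^sub>\<infinity>l. norm (p l))"
      by (rule finite_sum_le_infsum[OF summable_p]) auto
    finally have 1: "norm (\<Sum>l\<in>window M n. wave a b l x *s p l) \<le> (\<Sum>\<^sub>\<infinity>l. norm (p l))" .
    have 2: "norm (interpolant a b M U x) \<le> (\<Sum>l\<in>modes M. norm (dft a b M U l))"
      unfolding interpolant_eq by (rule sum_norm_le) simp
    show ?thesis
      unfolding WP_eq K_def by (rule order_trans[OF norm_triangle_ineq4 add_mono[OF 1 2]])
  qed
  have cont_int: "continuous_on {a..b} (interpolant a b M U)"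
    unfolding interpolant_eq[abs_def] by (intro continuous_intros)
  have "(\<lambda>n. integral\<^sup>L ?M (\<lambda>x. (norm (WP n x))\<^sup>2)) \<longlonglongrightarrow> integral\<^sup>L ?M (\<lambda>x. (norm (W x))\<^sup>2)"
  proof (rule integral_dominated_convergence)
    have "continuous_on {a..b} (\<lambda>x. (norm (W x))\<^sup>2)"
      unfolding W_def by (intro continuous_intros f(1) cont_int)
    from continuous_integral_open_interval(1)[OF this]
    show "(\<lambda>x. (norm (W x))\<^sup>2) \<in> borel_measurable ?M" by (rule borel_measurable_integrable)
    have "continuous_on {a..b} (\<lambda>x. (norm (WP n x))\<^sup>2)" for n
      unfolding WP_def by (intro continuous_intros)
    from continuous_integral_open_interval(1)[OF this]
    show "(\<lambda>x. (norm (WP n x))\<^sup>2) \<in> borel_measurable ?M" for n by (rule borel_measurable_integrable)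
    show "integrable ?M (\<lambda>x. K\<^sup>2)"
      by (intro continuous_integral_open_interval(1) continuous_on_const)
    show "AE x in ?M. norm ((norm (WP n x))\<^sup>2) \<le> K\<^sup>2" for n
      using bound by (intro AE_I2) (simp add: power_mono)
    show "AE x in ?M. (\<lambda>n. (norm (WP n x))\<^sup>2) \<longlonglongrightarrow> (norm (W x))\<^sup>2"
    proof (rule AE_I2)
      fix x assume "x \<in> space ?M"
      then have x: "x \<in> {a..b}" by simp
      have "(\<lambda>n. \<Sum>l\<in>window M n. wave a b l x *s p l) \<longlonglongrightarrow> f x"
        unfolding f_series[OF x]
        by (rule tendsto_uniform_limitI[OF wave_series_uniform_limit[OF M(1) summable_p, where A = UNIV]]) simp
      then show "(\<lambda>n. (norm (WP n x))\<^sup>2) \<longlonglongrightarrow> (norm (W x))\<^sup>2"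
        unfolding WP_eq W_def by (intro tendsto_intros)
    qed
  qed
  then have "integral\<^sup>L ?M (\<lambda>x. (norm (W x))\<^sup>2) \<le> (b - a) * E\<^sup>2"
    by (rule LIMSEQ_le_const2) (use intWP in blast)
  then have "L2_norm_on a b W \<le> sqrt ((b - a) * E\<^sup>2)"
    unfolding L2_norm_on_def by (subst LINT_lebesgue_on) auto
  also have "\<dots> = sqrt (b - a) * E"
    using E0 by (simp add: real_sqrt_mult)
  finally show ?thesis unfolding E_def W_def[abs_def] .
qed

end

section \<open>The global error\<close>

text \<open>Applied with \<rho> = \<tau>/\<epsilon> and s = h/\<epsilon>. If \<rho> \<le> s, the
  product is at most s^m; otherwise one factor s is replaced by \<rho> and the remaining m - 2 by
  \<open>H\<close>.\<close>

lemma mixed_rate_le: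
  fixes \<rho> s H :: real
  assumes "0 \<le> \<rho>" "0 \<le> s" "s \<le> H" "2 \<le> m"
  shows "\<rho> * s ^ (m - 1) \<le> H ^ (m - 2) * \<rho>\<^sup>2 + s ^ m"
proof -
  obtain k where m: "m = Suc (Suc k)" using assms(4) by (metis Suc_le_D numeral_2_eq_2 Suc_le_mono)
  show ?thesis
  proof (cases "\<rho> \<le> s")
    case True
    then have "\<rho> * s ^ (m - 1) \<le> s * s ^ (m - 1)" using assms by (intro mult_right_mono) auto
    moreover have "0 \<le> H ^ (m - 2) * \<rho>\<^sup>2" using assms by simp
    ultimately show ?thesis by (simp add: m)
  next
    case False
    have "\<rho> * s ^ (m - 1) = (\<rho> * s) * s ^ k" by (simp add: m)
    also have "\<dots> \<le> (\<rho> * \<rho>) * H ^ k"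
      using False assms by (intro mult_mono mult_left_mono power_mono) auto
    finally show ?thesis using assms by (simp add: m power2_eq_square mult_ac add_increasing2)
  qed
qed

lemma continuous_Linf_norm_le:
  fixes W :: "real \<Rightarrow> real"
  assumes "a < b" "continuous_on {a..b} W" "Linf_norm a b W \<le> ereal c" "x \<in> {a..b}"
  shows "\<bar>W x\<bar> \<le> c"
  using weak_deriv_0_sup_bound[OF assms(1) has_weak_deriv_0_self[OF assms(2)] assms(2)
      continuous_integral_open_interval(1)[OF assms(2)] Linf_norm_AE[OF assms(3)] assms(4)] by simp

lemma L2_set_le_of_sum_squares:
  assumes "(\<Sum>i\<in>F. (f i)\<^sup>2) \<le> c\<^sup>2" "0 \<le> c"
  shows "L2_set f F \<le> c"
  using real_sqrt_le_mono[OF assms(1)] assms(2) by (simp add: L2_set_def)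

text \<open>Absolute values appear because \<open>C\<close> and \<open>D\<close> carry no sign
  assumption. \<open>C 2\<close> serves for second derivatives in time and in space alike, as the
  constants depend on r + k.\<close>

lemma dirac_step_of_solution:
  fixes \<Phi> :: "real \<Rightarrow> real \<Rightarrow> complex^2"
  assumes "a < b" "0 < T" "m \<ge> 4" "0 < \<epsilon>" "0 < \<tau>" "0 < M" "even M"
    and V: "continuous_on {a..b} V" "Linf_norm a b V \<le> ereal D"
    and A1: "continuous_on {a..b} A1" "Linf_norm a b A1 \<le> ereal D"
    and sol: "dirac_solution \<epsilon> a b T V A1 \<Phi>0 \<Phi>" and C2: "C_time 2 m a b T \<Phi>"
    and mixed: "\<forall>r\<le>2. \<forall>k\<le>m. mixed_Linf_norm m a b T r k \<Phi> \<le> ereal (C (r + k) / \<epsilon> ^ (r + k))"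
    and t: "t \<in> {0..T}"
  shows "dirac_step a b \<epsilon> \<tau> \<bar>D\<bar> \<bar>C 0\<bar> \<bar>C 1\<bar> M m V A1 (\<Phi> t) (time_deriv m a b T \<Phi> t)
    (\<lambda>x. vector_derivative (\<Phi> t) (at x)) \<bar>C 2\<bar> \<bar>C m\<bar> \<bar>C (m - 1)\<bar>"
proof -
  let ?u = "\<lambda>r. (time_deriv m a b T ^^ r) \<Phi>"
  have tc: "time_cont m a b T (?u r)" if "r \<le> 2" for r
    using C2 that by (simp add: C_time_def)
  have cont: "continuous_on {a..b} (?u r t)" if "r \<le> 2" for r
    using tc[OF that] t Wminf_per_continuous unfolding time_cont_def by blast
  have sup: "norm (?u r t x) \<le> \<bar>C r\<bar> / \<epsilon> ^ r" if "r \<le> 2" "x \<in> {a..b}" for r x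
  proof -
    have "norm (?u r t x) \<le> C r / \<epsilon> ^ r"
      using mixed that(1) by (intro mixed_Linf_norm_sup[OF assms(1,2) tc _ t that(2)]) force+
    also have "\<dots> \<le> \<bar>C r\<bar> / \<epsilon> ^ r" using assms(4) by (intro divide_right_mono) auto
    finally show ?thesis .
  qed
  have S: "L2_set (\<lambda>l. \<bar>freq a b l\<bar> ^ k * norm (fcoef a b (\<Phi> t) l)) F \<le> \<bar>C k\<bar> / \<epsilon> ^ k"
    if "k \<le> m" "finite F" for k F
  proof (rule L2_set_le_of_sum_squares)
    have "time_cont m a b T \<Phi>" using tc[of 0] by simp
    moreover have "mixed_Linf_norm m a b T 0 k \<Phi> \<le> ereal (C k / \<epsilon> ^ k)"
      using mixed that(1) by force
    ultimately have "(\<Sum>l\<in>F. (\<bar>freq a b l\<bar> ^ k * norm (fcoef a b (\<Phi> t) l))\<^sup>2) \<le> (C k / \<epsilon> ^ k)\<^sup>2"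
      by (rule mixed_Linf_norm_fcoef[OF assms(1,2) _ that(1) _ t that(2)])
    also have "(C k / \<epsilon> ^ k)\<^sup>2 = (\<bar>C k\<bar> / \<epsilon> ^ k)\<^sup>2" by (simp add: power_divide)
    finally show "(\<Sum>l\<in>F. (\<bar>freq a b l\<bar> ^ k * norm (fcoef a b (\<Phi> t) l))\<^sup>2) \<le> (\<bar>C k\<bar> / \<epsilon> ^ k)\<^sup>2" .
  qed (use assms(4) in simp)
  have htd: "has_time_deriv m a b T \<Phi> (time_deriv m a b T \<Phi> t) t"
    using C2 t unfolding C_time_def by force
  have eq: "(\<Phi> t has_vector_derivative vector_derivative (\<Phi> t) (at x)) (at x)"
    "(\<i> * of_real \<epsilon>) *s time_deriv m a b T \<Phi> t x
      = ((- \<i> * of_real \<epsilon>) *m sigma1) *v vector_derivative (\<Phi> t) (at x)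
        + (sigma3 + of_real (V x) *m mat 1 - of_real (A1 x) *m sigma1) *v \<Phi> t x"
    if x: "x \<in> {a<..<b}" for x
  proof -
    obtain \<Phi>t \<Phi>x where d: "((\<lambda>s. \<Phi> s x) has_vector_derivative \<Phi>t) (at t within {0..T})"
      "(\<Phi> t has_vector_derivative \<Phi>x) (at x)"
      "(\<i> * of_real \<epsilon>) *s \<Phi>t = ((- \<i> * of_real \<epsilon>) *m sigma1) *v \<Phi>x
          + (sigma3 + of_real (V x) *m mat 1 - of_real (A1 x) *m sigma1) *v \<Phi> t x"
      using sol t x unfolding dirac_solution_def by blast
    have "((\<lambda>s. \<Phi> s x) has_vector_derivative time_deriv m a b T \<Phi> t x) (at t within {0..T})"
      using has_time_deriv_pointwise[OF assms(1) _ htd t, of x] tc[of 0] x by simp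
    \<comment> \<open>The equation uses a classical derivative at each point, the regularity a
      derivative in norm; the latter implies the former, and derivatives within [0,T] are
      unique.\<close>
    then have "\<Phi>t = time_deriv m a b T \<Phi> t x"
      using vector_derivative_unique_within_closed_interval[of 0 T t "\<lambda>s. \<Phi> s x" \<Phi>t] d(1) t assms(2)
      by simp
    moreover have "\<Phi>x = vector_derivative (\<Phi> t) (at x)"
      using d(2) by (simp add: vector_derivative_at)
    ultimately show "(\<Phi> t has_vector_derivative vector_derivative (\<Phi> t) (at x)) (at x)"
      "(\<i> * of_real \<epsilon>) *s time_deriv m a b T \<Phi> t x
      = ((- \<i> * of_real \<epsilon>) *m sigma1) *v vector_derivative (\<Phi> t) (at x)
        + (sigma3 + of_real (V x) *m mat 1 - of_real (A1 x) *m sigma1) *v \<Phi> t x"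
      using d(2,3) by simp_all
  qed
  have VD: "\<bar>V x\<bar> \<le> \<bar>D\<bar>" "\<bar>A1 x\<bar> \<le> \<bar>D\<bar>" if "x \<in> {a..b}" for x
    using continuous_Linf_norm_le[OF assms(1) V that] continuous_Linf_norm_le[OF assms(1) A1 that]
    by linarith+
  show ?thesis
  proof
    show "L2_set (\<lambda>l. norm (fcoef a b (\<Phi> t) l)) F \<le> \<bar>C 0\<bar>" if "finite F" for F
      using S[of 0 F] that by simp
    show "norm (\<Phi> t x) \<le> \<bar>C 0\<bar>" if "x \<in> {a..b}" for x
      using sup[of 0 x] that by simp
    show "norm (time_deriv m a b T \<Phi> t x) \<le> \<bar>C 1\<bar> / \<epsilon>" if "x \<in> {a..b}" for x
      using sup[of 1 x] that by simp
    show "continuous_on {a..b} (\<Phi> t)" using cont[of 0] by simp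
    show "continuous_on {a..b} (time_deriv m a b T \<Phi> t)" using cont[of 1] by simp
    show "L2_set (\<lambda>l. \<bar>freq a b l\<bar> ^ 2 * norm (fcoef a b (\<Phi> t) l)) F \<le> \<bar>C 2\<bar> / \<epsilon> ^ 2" if "finite F" for F
      using S[of 2 F] that assms(3) by simp
    show "L2_set (\<lambda>l. \<bar>freq a b l\<bar> ^ m * norm (fcoef a b (\<Phi> t) l)) F \<le> \<bar>C m\<bar> / \<epsilon> ^ m" if "finite F" for F
      using S[of m F] that by simp
    show "L2_set (\<lambda>l. \<bar>freq a b l\<bar> ^ (m - 1) * norm (fcoef a b (\<Phi> t) l)) F \<le> \<bar>C (m - 1)\<bar> / \<epsilon> ^ (m - 1)"
      if "finite F" for F
      using S[of "m - 1" F] that by simp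
  qed (use assms eq VD in blast)+
qed

lemma time_taylor:
  fixes \<Phi> :: "real \<Rightarrow> real \<Rightarrow> complex^2"
  assumes "a < b" "0 < T" "0 < \<epsilon>" "0 < \<tau>" and C2: "C_time 2 m a b T \<Phi>"
    and mixed: "mixed_Linf_norm m a b T 2 0 \<Phi> \<le> ereal (c / \<epsilon>\<^sup>2)"
    and t: "0 \<le> t" "t + \<tau> \<le> T" and x: "x \<in> {a..b}"
  shows "norm (\<Phi> (t + \<tau>) x - \<Phi> t x - \<tau> *\<^sub>R time_deriv m a b T \<Phi> t x) \<le> \<bar>c\<bar> / \<epsilon>\<^sup>2 * \<tau>\<^sup>2"
proof -
  let ?u = "\<lambda>r. (time_deriv m a b T ^^ r) \<Phi>"
  have tc: "time_cont m a b T (?u r)" if "r \<le> 2" for r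
    using C2 that by (simp add: C_time_def)
  have d: "((\<lambda>s. ?u r s x) has_vector_derivative ?u (Suc r) s x) (at s within {t..t + \<tau>})"
    if r: "r < 2" and s: "s \<in> {t..t + \<tau>}" for r s
  proof -
    have s': "s \<in> {0..T}" using s t by auto
    have "has_time_deriv m a b T (?u r) (?u (Suc r) s) s"
      using C2 r s' unfolding C_time_def by blast
    then have "((\<lambda>s. ?u r s x) has_vector_derivative ?u (Suc r) s x) (at s within {0..T})"
      using has_time_deriv_pointwise[OF assms(1) tc _ s' x] r by simp
    then show ?thesis
      by (rule has_vector_derivative_within_subset) (use t in auto)
  qed
  have "norm (?u 0 (t + \<tau>) x - ?u 0 t x - (t + \<tau> - t) *\<^sub>R ?u 1 t x) \<le> \<bar>c\<bar> / \<epsilon>\<^sup>2 * (t + \<tau> - t)\<^sup>2"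
  proof (rule taylor_second_order[of t "t + \<tau>" "\<lambda>s. ?u 0 s x" "\<lambda>s. ?u 1 s x" "\<lambda>s. ?u 2 s x"])
    fix s assume s: "s \<in> {t..t + \<tau>}"
    show "((\<lambda>s. ?u 0 s x) has_vector_derivative ?u 1 s x) (at s within {t..t + \<tau>})"
      using d[of 0 s] s by simp
    show "((\<lambda>s. ?u 1 s x) has_vector_derivative ?u 2 s x) (at s within {t..t + \<tau>})"
      using d[of 1 s] s by (simp add: numeral_2_eq_2)
    have "norm (?u 2 s x) \<le> c / \<epsilon>\<^sup>2"
      by (rule mixed_Linf_norm_sup[OF assms(1,2) tc mixed _ x]) (use s t in auto)
    also have "\<dots> \<le> \<bar>c\<bar> / \<epsilon>\<^sup>2" by (intro divide_right_mono) auto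
    finally show "norm (?u 2 s x) \<le> \<bar>c\<bar> / \<epsilon>\<^sup>2" .
  qed (use assms(4) in simp)
  then show ?thesis by simp
qed

lemma global_grid_error:
  fixes \<Phi> :: "real \<Rightarrow> real \<Rightarrow> complex^2"
  assumes "a < b" "0 < T" "m \<ge> 4" "0 < \<epsilon>" "0 < \<tau>" "0 < M" "even M"
    and V: "continuous_on {a..b} V" "Linf_norm a b V \<le> ereal D"
    and A1: "continuous_on {a..b} A1" "Linf_norm a b A1 \<le> ereal D"
    and sol: "dirac_solution \<epsilon> a b T V A1 \<Phi>0 \<Phi>" and C2: "C_time 2 m a b T \<Phi>"
    and mixed: "\<forall>r\<le>2. \<forall>k\<le>m. mixed_Linf_norm m a b T r k \<Phi> \<le> ereal (C (r + k) / \<epsilon> ^ (r + k))"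
    and \<delta>: "(3 * \<bar>C 2\<bar> + 2 * \<bar>C 0\<bar> + 2 * \<bar>D\<bar> * (\<bar>C 1\<bar> + 4 * \<bar>D\<bar> * \<bar>C 0\<bar>)) * (\<tau>\<^sup>2 / \<epsilon>\<^sup>2)
      + 8 * \<bar>C m\<bar> * (mesh a b M / \<epsilon>) ^ m
      + 4 * (\<bar>C m\<bar> + \<bar>C (m - 1)\<bar>) * (\<tau> / \<epsilon> * (mesh a b M / \<epsilon>) ^ (m - 1)) \<le> \<delta>"
    and n: "real n * \<tau> \<le> T"
  shows "grid_norm M (\<lambda>j. \<Phi> (real n * \<tau>) (grid a b M j) - S1 \<epsilon> \<tau> a b M V A1 \<Phi>0 n j) \<le> real n * \<delta>"
  using n
proof (induction n)
  case 0
  have "grid_norm M (\<lambda>j. \<Phi> (real 0 * \<tau>) (grid a b M j) - S1 \<epsilon> \<tau> a b M V A1 \<Phi>0 0 j) = grid_norm M (\<lambda>j. 0 :: complex^2)"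
    by (rule grid_norm_cong)
      (use sol grid_in_interval[OF assms(1)] in \<open>simp add: dirac_solution_def\<close>)
  then show ?case by simp
next
  case (Suc n)
  define t where "t = real n * \<tau>"
  have t1: "real (Suc n) * \<tau> = t + \<tau>" by (simp add: t_def algebra_simps)
  have t: "0 \<le> t" "t + \<tau> \<le> T" using Suc.prems assms(5) by (auto simp: t_def algebra_simps)
  interpret dirac_step a b \<epsilon> \<tau> "\<bar>D\<bar>" "\<bar>C 0\<bar>" "\<bar>C 1\<bar>" M m V A1 "\<Phi> t" "time_deriv m a b T \<Phi> t"
    "\<lambda>x. vector_derivative (\<Phi> t) (at x)" "\<bar>C 2\<bar>" "\<bar>C m\<bar>" "\<bar>C (m - 1)\<bar>"
    by (rule dirac_step_of_solution[OF assms(1-7) V A1 sol C2 mixed]) (use t assms(5) in auto)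
  let ?U = "S1 \<epsilon> \<tau> a b M V A1 \<Phi>0 n"
  have "mixed_Linf_norm m a b T 2 0 \<Phi> \<le> ereal (C 2 / \<epsilon>\<^sup>2)"
    using mixed by force
  from local_error[OF time_taylor[OF assms(1,2,4,5) C2 this t]] \<delta>
  have loc: "grid_norm M (\<lambda>j. \<Phi> (t + \<tau>) (grid a b M j) - kick j (free X j)) \<le> \<delta>" by linarith
  \<comment> \<open>Both sub-steps are linear, so the old error is propagated isometrically and
    stability has constant 1.\<close>
  have "kick j (free X j) - kick j (free ?U j) = kick j (free (\<lambda>j. X j - ?U j) j)" for j
    unfolding S1_free_diff by (rule matrix_vector_mult_diff_distrib[symmetric])
  then have "grid_norm M (\<lambda>j. kick j (free X j) - kick j (free ?U j)) = grid_norm M (free (\<lambda>j. X j - ?U j))"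
    by (intro grid_norm_cong) (simp only: mat_exp_isometry[OF potential_matrix_skew])
  also have "\<dots> \<le> real n * \<delta>"
    unfolding grid_norm_S1_free[OF ab M]
    using Suc.IH t assms(5) by (simp add: t_def)
  finally have st: "grid_norm M (\<lambda>j. kick j (free X j) - kick j (free ?U j)) \<le> real n * \<delta>" .
  have "grid_norm M (\<lambda>j. \<Phi> (real (Suc n) * \<tau>) (grid a b M j) - S1 \<epsilon> \<tau> a b M V A1 \<Phi>0 (Suc n) j)
      = grid_norm M (\<lambda>j. (\<Phi> (t + \<tau>) (grid a b M j) - kick j (free X j)) + (kick j (free X j) - kick j (free ?U j)))"
    unfolding t1 S1_Suc_eq by (rule grid_norm_cong) simp
  also have "\<dots> \<le> \<delta> + real n * \<delta>"
    by (rule order_trans[OF grid_norm_add add_mono[OF loc st]])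
  finally show ?case by (simp add: algebra_simps)
qed

theorem theorem3p1:
  fixes m :: nat and a b Tend :: real and C D :: "nat \<Rightarrow> real" and \<eta> :: "real \<Rightarrow> real"
  assumes "4 \<le> m" and "a < b" and "0 < Tend"
    and "\<And>\<epsilon>. \<epsilon> \<in> {0<..1} \<Longrightarrow> 0 < \<eta> \<epsilon>"
    and "bounded (\<eta> ` {0<..1})"
    and "(\<eta> \<longlongrightarrow> 0) (at_right 0)"
  shows "\<exists>C1>0. \<exists>E>0.
    \<forall>(V :: real \<Rightarrow> real) (A1 :: real \<Rightarrow> real) (\<epsilon> :: real)
      (\<Phi>0 :: real \<Rightarrow> complex^2) (\<Phi> :: real \<Rightarrow> real \<Rightarrow> complex^2) (\<tau> :: real) (M :: nat) (n :: nat).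
      Cm_on m {a<..<b} V \<and> periodic_derivs m a b V \<and>
      Cm_on m {a<..<b} A1 \<and> periodic_derivs m a b A1 \<and>
      (\<forall>k\<le>m. Linf_norm a b ((deriv ^^ k) V) \<le> ereal (D k)) \<and>
      (\<forall>k\<le>m. Linf_norm a b ((deriv ^^ k) A1) \<le> ereal (D k)) \<and>
      0 < \<epsilon> \<and> \<epsilon> \<le> 1 \<and>
      dirac_solution \<epsilon> a b Tend V A1 \<Phi>0 \<Phi> \<and>
      C_time 2 m a b Tend \<Phi> \<and>
      (\<forall>r\<le>2. \<forall>k\<le>m. mixed_Linf_norm m a b Tend r k \<Phi> \<le> ereal (C (r + k) / \<epsilon> ^ (r + k))) \<and>
      0 < M \<and> even M \<and> 0 < \<tau> \<and>
      \<tau> / \<epsilon> \<le> \<eta> \<epsilon> \<and> mesh a b M / \<epsilon> \<le> \<eta> \<epsilon> \<and>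
      real n \<le> Tend / \<tau>
      \<longrightarrow> L2_norm_on a b (\<lambda>x. \<Phi> (real n * \<tau>) x - interpolant a b M (S1 \<epsilon> \<tau> a b M V A1 \<Phi>0 n) x)
            \<le> C1 * Tend * (\<tau> / \<epsilon>\<^sup>2) + E * (Tend / \<tau>) * (mesh a b M / (\<epsilon> * (b - a))) ^ m"
proof -
  from assms(5) obtain H0 where "\<forall>y\<in>\<eta> ` {0<..1}. norm y \<le> H0"
    unfolding bounded_iff by blast
  then have H0: "\<bar>\<eta> \<epsilon>\<bar> \<le> H0" if "\<epsilon> \<in> {0<..1}" for \<epsilon>
    using that by simp
  \<comment> \<open>A positive bound for \<open>\<eta>\<close>, hence for both \<tau>/\<epsilon> and
    h/\<epsilon>.\<close>
  define H where "H = \<bar>H0\<bar> + 1"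
  define d where "d = \<bar>D 0\<bar>"
  define \<alpha> where "\<alpha> = 3 * \<bar>C 2\<bar> + 2 * \<bar>C 0\<bar> + 2 * d * (\<bar>C 1\<bar> + 4 * d * \<bar>C 0\<bar>)"
  define \<beta> where "\<beta> = 4 * (\<bar>C m\<bar> + \<bar>C (m - 1)\<bar>)"
  define \<gamma> where "\<gamma> = 8 * \<bar>C m\<bar> + \<beta>"
  define L where "L = sqrt (b - a)"
  define C1 where "C1 = L * (\<alpha> + \<beta> * H ^ (m - 2)) + 1"
  \<comment> \<open>The first summand absorbs the final interpolation error, \<gamma> the local
    errors; (b - a)^m compensates the normalisation of h by b - a, \<open>L\<close> comes from
    Parseval, and the 1 only ensures positivity.\<close>
  define E where "E = L * (5 * \<bar>C m\<bar> * H / Tend + \<gamma>) * (b - a) ^ m + 1"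
  have H: "H > 0" and L: "L > 0" and nn: "\<alpha> \<ge> 0" "\<beta> \<ge> 0" "\<gamma> \<ge> 0"
    using assms(2) by (auto simp: H_def L_def d_def \<alpha>_def \<beta>_def \<gamma>_def)
  have C1: "C1 > 0" unfolding C1_def using L nn H by (intro add_nonneg_pos mult_nonneg_nonneg add_nonneg_nonneg) auto
  have E: "E > 0" unfolding E_def using L nn H assms(2,3)
    by (intro add_nonneg_pos mult_nonneg_nonneg add_nonneg_nonneg divide_nonneg_pos zero_le_power) auto
  show ?thesis
  proof (rule exI[of _ C1], rule conjI[OF C1], rule exI[of _ E], rule conjI[OF E], intro allI impI, elim conjE)
    fix V A1 :: "real \<Rightarrow> real" and \<epsilon> :: real and \<Phi>0 :: "real \<Rightarrow> complex^2"
      and \<Phi> :: "real \<Rightarrow> real \<Rightarrow> complex^2" and \<tau> :: real and M n :: nat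
    assume V: "periodic_derivs m a b V" "\<forall>k\<le>m. Linf_norm a b ((deriv ^^ k) V) \<le> ereal (D k)"
      and A1: "periodic_derivs m a b A1" "\<forall>k\<le>m. Linf_norm a b ((deriv ^^ k) A1) \<le> ereal (D k)"
      and eps: "0 < \<epsilon>" "\<epsilon> \<le> 1" and sol: "dirac_solution \<epsilon> a b Tend V A1 \<Phi>0 \<Phi>"
      and C2: "C_time 2 m a b Tend \<Phi>"
      and mixed: "\<forall>r\<le>2. \<forall>k\<le>m. mixed_Linf_norm m a b Tend r k \<Phi> \<le> ereal (C (r + k) / \<epsilon> ^ (r + k))"
      and M: "0 < M" "even M" and tau: "0 < \<tau>" "\<tau> / \<epsilon> \<le> \<eta> \<epsilon>"
      and mesh: "mesh a b M / \<epsilon> \<le> \<eta> \<epsilon>" and n: "real n \<le> Tend / \<tau>"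
    define h where "h = mesh a b M"
    define s where "s = (h / \<epsilon>) ^ m"
    define \<delta> where "\<delta> = (\<alpha> + \<beta> * H ^ (m - 2)) * (\<tau>\<^sup>2 / \<epsilon>\<^sup>2) + \<gamma> * s"
    have "h > 0" using assms(2) M by (simp add: h_def mesh_def)
    have "\<eta> \<epsilon> \<le> H" using H0[of \<epsilon>] eps by (auto simp: H_def)
    then have tH: "\<tau> / \<epsilon> \<le> H" and hH: "h / \<epsilon> \<le> H" using tau mesh by (auto simp: h_def)
    \<comment> \<open>Here \<epsilon> \<le> 1 enters: it bounds \<tau> itself, so that H/\<tau>
      \<ge> 1.\<close>
    have "\<tau> \<le> \<tau> / \<epsilon>"
      using mult_left_mono[OF eps(2), of \<tau>] tau(1) eps(1) by (simp add: pos_le_divide_eq)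
    then have "\<tau> \<le> H" using tH by linarith
    have s0: "s \<ge> 0" using \<open>h > 0\<close> eps by (simp add: s_def)
    have contV: "continuous_on {a..b} V" and contA: "continuous_on {a..b} A1"
      using V(1) A1(1) by (auto simp: periodic_derivs_def)
    have LV: "Linf_norm a b V \<le> ereal (D 0)" and LA: "Linf_norm a b A1 \<le> ereal (D 0)"
      using spec[OF V(2), of 0] spec[OF A1(2), of 0] by simp_all
    have nT: "real n * \<tau> \<le> Tend" using n tau by (simp add: field_simps)
    have rate: "\<tau> / \<epsilon> * (h / \<epsilon>) ^ (m - 1) \<le> H ^ (m - 2) * (\<tau> / \<epsilon>)\<^sup>2 + s"
      unfolding s_def using tau eps \<open>h > 0\<close> hH assms(1) by (intro mixed_rate_le) auto
    \<comment> \<open>The mixed term is shared out: its part \<beta> H^(m-2) goes to the time error,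
      its part \<beta> into \<gamma>.\<close>
    have "\<alpha> * (\<tau>\<^sup>2 / \<epsilon>\<^sup>2) + 8 * \<bar>C m\<bar> * s + \<beta> * (\<tau> / \<epsilon> * (h / \<epsilon>) ^ (m - 1)) \<le> \<delta>"
      using mult_left_mono[OF rate nn(2)]
      unfolding \<delta>_def \<gamma>_def power_divide[of \<tau> \<epsilon> 2] by (simp only: distrib_left distrib_right mult.assoc)
    then have grid: "grid_norm M (\<lambda>j. \<Phi> (real n * \<tau>) (grid a b M j) - S1 \<epsilon> \<tau> a b M V A1 \<Phi>0 n j) \<le> real n * \<delta>"
      by (intro global_grid_error[OF assms(2,3,1) eps(1) tau(1) M contV LV contA LA sol C2 mixed _ nT])
        (simp add: \<alpha>_def \<beta>_def s_def h_def d_def)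
    interpret dirac_step a b \<epsilon> \<tau> "\<bar>D 0\<bar>" "\<bar>C 0\<bar>" "\<bar>C 1\<bar>" M m V A1 "\<Phi> (real n * \<tau>)"
      "time_deriv m a b Tend \<Phi> (real n * \<tau>)" "\<lambda>x. vector_derivative (\<Phi> (real n * \<tau>)) (at x)"
      "\<bar>C 2\<bar>" "\<bar>C m\<bar>" "\<bar>C (m - 1)\<bar>"
      by (rule dirac_step_of_solution[OF assms(2,3,1) eps(1) tau(1) M contV LV contA LA sol C2 mixed])
        (use nT tau in auto)
    have "L2_norm_on a b (\<lambda>x. \<Phi> (real n * \<tau>) x - interpolant a b M (S1 \<epsilon> \<tau> a b M V A1 \<Phi>0 n) x)
        \<le> L * (5 * h ^ m * (\<bar>C m\<bar> / \<epsilon> ^ m) + real n * \<delta>)"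
      unfolding L_def h_def
      by (rule order_trans[OF interpolation_error mult_left_mono[OF add_left_mono[OF grid]]])
        (use assms(2) in simp)
    also have "5 * h ^ m * (\<bar>C m\<bar> / \<epsilon> ^ m) = 5 * \<bar>C m\<bar> * s"
      by (simp add: s_def power_divide)
    \<comment> \<open>The interpolation error occurs once, without a factor T/\<tau>; inserting
      H/\<tau> \<ge> 1 gives it the shape of the second term of the claim.\<close>
    also have "L * (5 * \<bar>C m\<bar> * s + real n * \<delta>)
        \<le> L * (5 * \<bar>C m\<bar> * s * (H / \<tau>) + (Tend / \<tau>) * \<delta>)"
    proof -
      have "5 * \<bar>C m\<bar> * s * 1 \<le> 5 * \<bar>C m\<bar> * s * (H / \<tau>)"
        using s0 tau \<open>\<tau> \<le> H\<close> by (intro mult_left_mono) auto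
      moreover have "real n * \<delta> \<le> (Tend / \<tau>) * \<delta>"
        using n s0 nn H by (intro mult_right_mono) (auto simp: \<delta>_def)
      ultimately show ?thesis using L by (intro mult_left_mono) auto
    qed
    also have "\<dots> = (L * (\<alpha> + \<beta> * H ^ (m - 2))) * Tend * (\<tau> / \<epsilon>\<^sup>2)
        + (L * (5 * \<bar>C m\<bar> * H / Tend + \<gamma>)) * (Tend / \<tau>) * s"
      using tau eps assms(3) by (simp add: \<delta>_def field_simps power2_eq_square)
    also have "s = (b - a) ^ m * (h / (\<epsilon> * (b - a))) ^ m"
      using assms(2) by (simp add: s_def flip: power_mult_distrib)
    also have "(L * (\<alpha> + \<beta> * H ^ (m - 2))) * Tend * (\<tau> / \<epsilon>\<^sup>2)
        + (L * (5 * \<bar>C m\<bar> * H / Tend + \<gamma>)) * (Tend / \<tau>) * ((b - a) ^ m * (h / (\<epsilon> * (b - a))) ^ m)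
        = (C1 - 1) * Tend * (\<tau> / \<epsilon>\<^sup>2) + (E - 1) * (Tend / \<tau>) * (h / (\<epsilon> * (b - a))) ^ m"
      by (simp add: C1_def E_def)
    also have "\<dots> \<le> C1 * Tend * (\<tau> / \<epsilon>\<^sup>2) + E * (Tend / \<tau>) * (h / (\<epsilon> * (b - a))) ^ m"
      using tau eps assms(2,3) \<open>h > 0\<close> by (intro add_mono mult_right_mono) auto
    finally show "L2_norm_on a b (\<lambda>x. \<Phi> (real n * \<tau>) x - interpolant a b M (S1 \<epsilon> \<tau> a b M V A1 \<Phi>0 n) x)
        \<le> C1 * Tend * (\<tau> / \<epsilon>\<^sup>2) + E * (Tend / \<tau>) * (mesh a b M / (\<epsilon> * (b - a))) ^ m"
      unfolding h_def .
  qed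
qed

end
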